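(* The maximal size of a finite intersection $I(\pi_1,\pi_2)=\pi_1(E_{1,\mathrm{tors}})\cap\pi_2(E_{2,\mathrm{tors}})$, taken over all pairs of double covers $\pi_1\colon E_1\to\mathbb{P}^1$, $\pi_2\colon E_2\to\mathbb{P}^1$ with $E_1,E_2$ elliptic curves over $\mathbb{C}$ such that the origin of $E_j$ is a ramification point of $\pi_j$ $(j=1,2)$ and $I(\pi_1,\pi_2)$ is finite, is at least as large as the maximal size of a hyperelliptic torsion packet on a bielliptic curve of genus $2$ over $\mathbb{C}$.
   Context: All objects are over $\mathbb{C}$. For an elliptic curve $E$, $E_{\mathrm{tors}}$ is its set of torsion points. A torsion packet on a curve $C$ of genus $\ge 2$ is a maximal set of points of $C$ such that the linear equivalence class of the difference of any two points in the set has finite order in the Jacobian of $C$. For $C$ hyperelliptic, the hyperelliptic torsion packet of $C$ is the torsion packet containing the ramification points (Weierstrass points) of the hyperelliptic double cover $C\to\mathbb{P}^1$. A genus $2$ curve $C$ is bielliptic if there is a double cover $C\to E$ with $E$ an elliptic curve. It is known that $I(\pi_1,\pi_2)$ is finite if and only if $\pi_1(E_1[2])\neq\pi_2(E_2[2])$, and that both maxima exist (uniform bounds are known). *)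

theory Defs
  imports "HOL-Algebra.Algebra" "HOL-Algebra.Algebraic_Closure_Type"
begin

text \<open>
  Smooth projective curves over the complex numbers are represented by their function fields: a
  curve is a field \<open>K\<close> finitely generated and of transcendence degree one over \<open>\<complex>\<close>, its points are
  the valuation rings of \<open>K/\<complex>\<close> (the abstract nonsingular curve of \<open>K\<close>, see Hartshorne I.6), and a
  nonconstant morphism \<open>C \<rightarrow> D\<close> is a \<open>\<complex>\<close>-embedding of the function field of \<open>D\<close> into that of \<open>C\<close>.

  Every such field is a finite extension of some \<open>\<complex>(t)\<close>, so up to isomorphism it is a subfield of
  an algebraic closure of \<open>\<complex>(t)\<close>.  All function fields are therefore taken inside this one field.
\<close>

type_synonym func = "complex poly fract alg_closure"

abbreviation Omega :: "func ring"
  where "Omega \<equiv> ring_of_type_algebra"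

definition const :: "complex \<Rightarrow> func"
  where "const c = to_ac (Fraction_Field.Fract [:c:] 1)"

abbreviation constants :: "func set"
  where "constants \<equiv> range const"

abbreviation restr :: "func set \<Rightarrow> func ring"
  where "restr K \<equiv> Omega\<lparr>carrier := K\<rparr>"

definition has_dim_over :: "func set \<Rightarrow> func set \<Rightarrow> nat \<Rightarrow> bool"
  where "has_dim_over F V n \<longleftrightarrow> ring.dimension Omega n F V"

definition curve :: "func set \<Rightarrow> bool"
  where "curve K \<longleftrightarrow> subfield K Omega \<and> constants \<subseteq> K \<and>
    (\<exists>x\<in>K. ring.transcendental Omega constants x \<and>
       (\<exists>n. has_dim_over (generate_field Omega (insert x constants)) K n))"

text \<open>The function field \<open>\<complex>(t)\<close>.\<close>

definition projective_line :: "func set"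
  where "projective_line = range to_ac"


section \<open>Points and orders of vanishing\<close>

definition points :: "func set \<Rightarrow> func set set"
  where "points K = {P. subring P Omega \<and> constants \<subseteq> P \<and> P \<subset> K \<and>
    (\<forall>f\<in>K. f \<in> P \<or> inverse f \<in> P)}"

text \<open>A point \<open>P\<close> is a discrete valuation ring; \<open>maximal_ideal P\<close> consists of its non-units.\<close>

definition maximal_ideal :: "func set \<Rightarrow> func set"
  where "maximal_ideal P = {f \<in> P. f = 0 \<or> inverse f \<notin> P}"

definition uniformizer :: "func set \<Rightarrow> func \<Rightarrow> bool"
  where "uniformizer P t \<longleftrightarrow> t \<in> P \<and> maximal_ideal P = (\<lambda>g. t * g) ` P"

text \<open>Only meaningful for \<open>f \<noteq> 0\<close> in the function field.\<close>

definition ord_at :: "func set \<Rightarrow> func \<Rightarrow> int"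
  where "ord_at P f = (THE n. \<exists>t u. uniformizer P t \<and> u \<in> P - maximal_ideal P \<and> f = u * t powi n)"


section \<open>Divisors, genus and torsion in the Jacobian\<close>

definition divisor :: "func set \<Rightarrow> (func set \<Rightarrow> int) \<Rightarrow> bool"
  where "divisor K D \<longleftrightarrow> finite {P. D P \<noteq> 0} \<and> {P. D P \<noteq> 0} \<subseteq> points K"

text \<open>All residue fields are \<open>\<complex>\<close>, so each point has degree one.\<close>

definition deg_div :: "(func set \<Rightarrow> int) \<Rightarrow> int"
  where "deg_div D = (\<Sum>P | D P \<noteq> 0. D P)"

definition riemann_roch_space :: "func set \<Rightarrow> (func set \<Rightarrow> int) \<Rightarrow> func set"
  where "riemann_roch_space K D = {f \<in> K. f = 0 \<or> (\<forall>P\<in>points K. ord_at P f \<ge> - D P)}"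

text \<open>The genus is the maximum of \<open>deg D - \<ell>(D) + 1\<close> over all divisors \<open>D\<close>
  (Stichtenoth, Algebraic Function Fields and Codes, Definition 1.4.15).\<close>

definition has_genus :: "func set \<Rightarrow> nat \<Rightarrow> bool"
  where "has_genus K g \<longleftrightarrow>
    (\<forall>D l. divisor K D \<and> has_dim_over constants (riemann_roch_space K D) l
       \<longrightarrow> deg_div D - int l + 1 \<le> int g) \<and>
    (\<exists>D l. divisor K D \<and> has_dim_over constants (riemann_roch_space K D) l
       \<and> deg_div D - int l + 1 = int g)"

definition principal :: "func set \<Rightarrow> (func set \<Rightarrow> int) \<Rightarrow> bool"
  where "principal K D \<longleftrightarrow> divisor K D \<and> (\<exists>f\<in>K. f \<noteq> 0 \<and> (\<forall>P\<in>points K. D P = ord_at P f))"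

definition point_div :: "func set \<Rightarrow> func set \<Rightarrow> int"
  where "point_div P = (\<lambda>R. if R = P then 1 else 0)"

text \<open>The class of \<open>P - Q\<close> has finite order in the Jacobian, i.e. in the group of divisors of degree
  zero modulo principal divisors.\<close>

definition torsion_difference :: "func set \<Rightarrow> func set \<Rightarrow> func set \<Rightarrow> bool"
  where "torsion_difference K P Q \<longleftrightarrow>
    (\<exists>n::nat. n > 0 \<and> principal K (\<lambda>R. int n * (point_div P R - point_div Q R)))"

definition torsion_packet :: "func set \<Rightarrow> func set set \<Rightarrow> bool"
  where "torsion_packet K T \<longleftrightarrow>
    T \<subseteq> points K \<and> (\<forall>P\<in>T. \<forall>Q\<in>T. torsion_difference K P Q) \<and>
    (\<forall>T'. T \<subseteq> T' \<and> T' \<subseteq> points K \<and> (\<forall>P\<in>T'. \<forall>Q\<in>T'. torsion_difference K P Q) \<longrightarrow> T' = T)"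


section \<open>Morphisms and double covers\<close>

text \<open>\<open>morphism \<phi> K L\<close>: a nonconstant morphism from the curve \<open>K\<close> to the curve \<open>L\<close>, given by its
  comorphism \<open>\<phi>\<close> from \<open>L\<close> to \<open>K\<close>.  Only the values of \<open>\<phi>\<close> on \<open>L\<close> matter.\<close>

definition morphism :: "(func \<Rightarrow> func) \<Rightarrow> func set \<Rightarrow> func set \<Rightarrow> bool"
  where "morphism \<phi> K L \<longleftrightarrow> \<phi> \<in> ring_hom (restr L) (restr K) \<and> (\<forall>c. \<phi> (const c) = const c)"

definition point_map :: "(func \<Rightarrow> func) \<Rightarrow> func set \<Rightarrow> func set \<Rightarrow> func set"
  where "point_map \<phi> L P = {f \<in> L. \<phi> f \<in> P}"

definition double_cover :: "(func \<Rightarrow> func) \<Rightarrow> func set \<Rightarrow> func set \<Rightarrow> bool"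
  where "double_cover \<phi> K L \<longleftrightarrow> morphism \<phi> K L \<and> has_dim_over (\<phi> ` L) K 2"

definition ramification_index :: "(func \<Rightarrow> func) \<Rightarrow> func set \<Rightarrow> func set \<Rightarrow> int"
  where "ramification_index \<phi> L P = ord_at P (\<phi> (SOME t. uniformizer (point_map \<phi> L P) t))"

definition ramification_points :: "(func \<Rightarrow> func) \<Rightarrow> func set \<Rightarrow> func set \<Rightarrow> func set set"
  where "ramification_points \<phi> K L = {P \<in> points K. ramification_index \<phi> L P > 1}"


section \<open>Elliptic curves and curves of genus two\<close>

definition elliptic_curve :: "func set \<Rightarrow> func set \<Rightarrow> bool"
  where "elliptic_curve E Z \<longleftrightarrow> curve E \<and> has_genus E 1 \<and> Z \<in> points E"

text \<open>The group law on an elliptic curve \<open>E\<close> with origin \<open>Z\<close> is the one transported from the group of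
  divisor classes of degree zero along \<open>P \<mapsto> [P - Z]\<close>.\<close>

definition torsion_points :: "func set \<Rightarrow> func set \<Rightarrow> func set set"
  where "torsion_points E Z = {P \<in> points E. torsion_difference E P Z}"

definition bielliptic :: "func set \<Rightarrow> bool"
  where "bielliptic K \<longleftrightarrow> curve K \<and> has_genus K 2 \<and>
    (\<exists>E Z \<phi>. elliptic_curve E Z \<and> double_cover \<phi> K E)"

definition hyperelliptic_torsion_packet :: "func set \<Rightarrow> func set set \<Rightarrow> bool"
  where "hyperelliptic_torsion_packet K T \<longleftrightarrow> torsion_packet K T \<and>
    (\<exists>\<phi>. double_cover \<phi> K projective_line \<and> ramification_points \<phi> K projective_line \<subseteq> T)"

definition common_torsion ::
  "(func \<Rightarrow> func) \<Rightarrow> func set \<Rightarrow> func set \<Rightarrow> (func \<Rightarrow> func) \<Rightarrow> func set \<Rightarrow> func set \<Rightarrow> func set set"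
  where "common_torsion \<phi>1 E1 Z1 \<phi>2 E2 Z2 =
    point_map \<phi>1 projective_line ` torsion_points E1 Z1 \<inter>
    point_map \<phi>2 projective_line ` torsion_points E2 Z2"

definition elliptic_double_cover :: "(func \<Rightarrow> func) \<Rightarrow> func set \<Rightarrow> func set \<Rightarrow> bool"
  where "elliptic_double_cover \<phi> E Z \<longleftrightarrow> elliptic_curve E Z \<and>
    double_cover \<phi> E projective_line \<and> Z \<in> ramification_points \<phi> E projective_line"

definition maximal_size :: "'a set set \<Rightarrow> nat \<Rightarrow> bool"
  where "maximal_size F M \<longleftrightarrow> (\<exists>A\<in>F. finite A \<and> card A = M) \<and> (\<forall>A\<in>F. finite A \<and> card A \<le> M)"

end

theory Submission
  imports Defs
begin

text \<open>
  Let \<open>K\<close> be a bielliptic curve of genus two. The bielliptic involution normalises the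
  hyperelliptic one, and this puts \<open>K\<close> into the symmetric form \<open>K = \<complex>(z, e1, e2)\<close> with
  \<open>e1\<^sup>2 = z (z - 1) (z - p)\<close> and \<open>e2\<^sup>2 = z (z - 1) (z - q)\<close> (\<open>bielliptic_normal_form\<close>). The
  Jacobian of \<open>K\<close> is isogenous to the product of the elliptic curves \<open>E1 = \<complex>(z, e1)\<close> and
  \<open>E2 = \<complex>(z, e2)\<close>, so a point of \<open>K\<close> differs from a Weierstrass point by torsion exactly if its
  images in \<open>E1\<close> and \<open>E2\<close> do (\<open>biquad.torsion_iff\<close>). Hence the hyperelliptic torsion packet is the
  full preimage in \<open>K\<close> of a set \<open>A\<close> of points of the \<open>z\<close>-line, namely of the intersection of the
  images of the torsion of \<open>E1\<close> and \<open>E2\<close>. As \<open>K\<close> has degree four over the \<open>z\<close>-line, \<open>A\<close> itself is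
  too small by a factor of about four.

  The remedy is to replace the \<open>z\<close>-line by its four-to-one cover by the \<open>w\<close>-line with
  \<open>z = ((w + 1/w) / 2)\<^sup>2\<close>, which is branched, with index two, over the three common branch points
  \<open>0, 1, \<infinity>\<close> and nowhere else. The pullback of \<open>E1\<close> is the double cover of the \<open>w\<close>-line given by the
  square root of \<open>z - p\<close>; it has only the four branch points above \<open>p\<close>, so it is again elliptic,
  and its map to \<open>E1\<close> is multiplication by two. So its torsion points are exactly the points above
  torsion points of \<open>E1\<close> (\<open>pulled_back.torsion_image\<close>), and likewise for \<open>E2\<close>. The two pulled back
  curves therefore meet in the full preimage of \<open>A\<close> in the \<open>w\<close>-line. Its fibres are at least as
  large as those of the packet: over \<open>0, 1, \<infinity>\<close> both have two points, elsewhere the \<open>w\<close>-line has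
  four and \<open>K\<close> at most four. Since the packet is finite, so are \<open>A\<close> and the new intersection.

  Every function field whose points matter is reached from some \<open>\<complex>(x)\<close> by adjoining square roots. A
  point of such a field is the pullback of the power series ring under an embedding into Laurent
  series, and square roots of Laurent series can be written down, so the points above a given point
  of a quadratic extension are known completely (\<open>quad_points\<close>). Torsion descends along a quadratic
  extension by taking norms (\<open>quad_torsion_iff\<close>), and along a biquadratic one by an identity in the
  group ring of the Klein four-group. For \<open>y\<^sup>2 = \<Prod>(x - a)\<close> with \<open>2 g + 2\<close> factors, the Riemann-Roch
  spaces of the multiples of the divisor at infinity are computed explicitly, which gives the genus
  \<open>g\<close> (\<open>hyperelliptic.genus\<close>). This is used in both directions: genus two forces six branch points,
  and the pulled back curves have genus one. The uniqueness of the hyperelliptic pencil, needed for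
  the normal form, follows from the same explicit spaces (\<open>hyperelliptic.auto_preserves_line\<close>).
\<close>

section \<open>Embeddings of the constants\<close>

text \<open>
  The constants occur inside \<open>func\<close> and inside the Laurent series; polynomials over \<open>\<complex>\<close> are
  evaluated in both, through the respective embedding \<open>h\<close>.
\<close>

definition field_hom :: "(complex \<Rightarrow> 'a::field) \<Rightarrow> bool"
  where "field_hom h \<longleftrightarrow> h 1 = 1 \<and> (\<forall>a b. h (a + b) = h a + h b \<and> h (a * b) = h a * h b)"

lemma field_hom_simps:
  assumes "field_hom h"
  shows "h 1 = 1" "h 0 = 0" "h (a + b) = h a + h b" "h (a * b) = h a * h b"
    "h (- a) = - h a" "h (a - b) = h a - h b" "h a = 0 \<longleftrightarrow> a = 0" "h (a ^ n) = h a ^ n"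
proof -
  note H = assms[unfolded field_hom_def]
  show 1: "h 1 = 1" and 3: "h (a + b) = h a + h b" and 4: "h (a * b) = h a * h b" for a b
    using H by auto
  have "h 0 = h 0 + h 0" using H by (metis add_0)
  then show 0: "h 0 = 0" by (metis add_cancel_right_right)
  show m: "h (- a) = - h a" for a
    using 3[of a "- a"] 0 by (simp add: eq_neg_iff_add_eq_0 add.commute)
  show "h (a - b) = h a - h b"
    using 3[of a "- b"] m[of b] by simp
  show "h a = 0 \<longleftrightarrow> a = 0"
  proof
    assume "h a = 0"
    then show "a = 0" using 4[of a "inverse a"] 1 by (cases "a = 0") auto
  qed (simp add: 0)
  show "h (a ^ n) = h a ^ n" by (induction n) (auto simp: 1 4)
qed

lemma field_hom_const: "field_hom const"
  unfolding field_hom_def const_def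
  by (auto simp: One_fract_def one_pCons mult.commute simp flip: to_ac_add to_ac_mult to_ac_1)

lemma field_hom_fls_const: "field_hom fls_const"
  unfolding field_hom_def by (auto simp: fls_const_mult_const fls_plus_const)

lemmas const_simps [simp] = field_hom_simps[OF field_hom_const]

lemma const_inject [simp]: "const a = const b \<longleftrightarrow> a = b"
  by (metis eq_iff_diff_eq_0 const_simps(6,7))

lemma const_inverse [simp]: "const (inverse a) = inverse (const a)"
proof (cases "a = 0")
  case False
  then have "const (inverse a) * const a = 1"
    by (metis const_simps(1,4) left_inverse)
  then show ?thesis by (metis inverse_unique inverse_inverse_eq mult.commute)
qed simp

lemma const_divide [simp]: "const (a / b) = const a / const b"
  by (simp add: divide_inverse)

lemma const_of_nat [simp]: "const (of_nat n) = of_nat n"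
  by (induction n) auto

lemma const_numeral [simp]: "const (numeral n) = numeral n"
  using const_of_nat[of "numeral n"] by simp

lemma const_prod: "const (\<Prod>a\<in>S. f a) = (\<Prod>a\<in>S. const (f a))"
  by (induction S rule: infinite_finite_induct) auto

lemma two_neq_zero [simp]: "(2 :: func) \<noteq> 0"
  using const_simps(7)[of 2] by (simp del: const_simps(7))

lemma four_neq_zero [simp]: "(4 :: func) \<noteq> 0"
  using const_simps(7)[of 4] by (simp del: const_simps(7))

section \<open>Subfields containing the constants\<close>

text \<open>
  The closure form of an intermediate field of \<open>func\<close> over \<open>\<complex>\<close>; \<open>cfield_iff\<close> links it with the
  structural notion.
\<close>

definition cfield :: "func set \<Rightarrow> bool"
  where "cfield K \<longleftrightarrow> constants \<subseteq> K \<and> (\<forall>x\<in>K. \<forall>y\<in>K. x + y \<in> K \<and> x * y \<in> K) \<and>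
    (\<forall>x\<in>K. inverse x \<in> K)"

lemma cf_const [simp]: "cfield K \<Longrightarrow> const c \<in> K"
  by (auto simp: cfield_def)

lemma cf_add: "cfield K \<Longrightarrow> x \<in> K \<Longrightarrow> y \<in> K \<Longrightarrow> x + y \<in> K"
  and cf_mult: "cfield K \<Longrightarrow> x \<in> K \<Longrightarrow> y \<in> K \<Longrightarrow> x * y \<in> K"
  and cf_inverse: "cfield K \<Longrightarrow> x \<in> K \<Longrightarrow> inverse x \<in> K"
  by (auto simp: cfield_def)

lemma cf_0: "cfield K \<Longrightarrow> 0 \<in> K" and cf_1: "cfield K \<Longrightarrow> 1 \<in> K"
  and cf_numeral: "cfield K \<Longrightarrow> numeral n \<in> K"
  using cf_const[of K 0] cf_const[of K 1] cf_const[of K "numeral n"] by auto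

lemma cf_uminus: "cfield K \<Longrightarrow> x \<in> K \<Longrightarrow> - x \<in> K"
  using cf_mult[of K "const (-1)" x] cf_const[of K "-1"] by (simp del: cf_const)

lemma cf_diff: "cfield K \<Longrightarrow> x \<in> K \<Longrightarrow> y \<in> K \<Longrightarrow> x - y \<in> K"
  using cf_add[of K x "- y"] cf_uminus[of K y] by simp

lemma cf_divide: "cfield K \<Longrightarrow> x \<in> K \<Longrightarrow> y \<in> K \<Longrightarrow> x / y \<in> K"
  using cf_mult[of K x "inverse y"] cf_inverse[of K y] by (simp add: divide_inverse)

lemma cf_power: "cfield K \<Longrightarrow> x \<in> K \<Longrightarrow> x ^ n \<in> K"
  by (induction n) (auto intro: cf_1 cf_mult)

lemma cf_powi: "cfield K \<Longrightarrow> x \<in> K \<Longrightarrow> x powi n \<in> K"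
  by (auto simp: power_int_def intro: cf_power cf_inverse)

lemma cf_prod: "cfield K \<Longrightarrow> (\<And>a. a \<in> S \<Longrightarrow> f a \<in> K) \<Longrightarrow> prod f S \<in> K"
  by (induction S rule: infinite_finite_induct) (auto intro: cf_1 cf_mult)

lemmas cf = cf_add cf_mult cf_inverse cf_0 cf_1 cf_numeral cf_uminus cf_diff cf_divide cf_power
  cf_powi cf_const

lemma Omega_simps [simp]:
  "carrier Omega = UNIV" "monoid.mult Omega = (*)" "one Omega = 1" "ring.zero Omega = 0" "ring.add Omega = (+)"
  by (auto simp: ring_of_type_algebra_def)

lemma Omega_field: "field Omega" by rule

interpretation Om: cring Omega by rule

lemma Omega_uminus [simp]: "a_inv Omega x = - x"
  by (rule Om.add.inv_equality) auto

lemma Omega_m_inv [simp]: "x \<noteq> 0 \<Longrightarrow> m_inv Omega x = inverse x"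
  by (rule Om.comm_inv_char) auto

lemma subring_Omega_iff:
  "subring P Omega \<longleftrightarrow> 1 \<in> P \<and> (\<forall>x\<in>P. \<forall>y\<in>P. x + y \<in> P \<and> x * y \<in> P) \<and> (\<forall>x\<in>P. - x \<in> P)"
proof
  assume "subring P Omega"
  then show "1 \<in> P \<and> (\<forall>x\<in>P. \<forall>y\<in>P. x + y \<in> P \<and> x * y \<in> P) \<and> (\<forall>x\<in>P. - x \<in> P)"
    using subringE[of P Omega] by auto
next
  assume "1 \<in> P \<and> (\<forall>x\<in>P. \<forall>y\<in>P. x + y \<in> P \<and> x * y \<in> P) \<and> (\<forall>x\<in>P. - x \<in> P)"
  then show "subring P Omega"
    by (intro Om.subringI) auto
qed

lemma cfield_iff: "cfield K \<longleftrightarrow> subfield K Omega \<and> constants \<subseteq> K"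
proof
  assume K: "cfield K"
  have "subfield K Omega"
  proof (rule field.subfieldI'[OF Omega_field])
    show "subring K Omega" using K by (auto simp: subring_Omega_iff intro: cf)
  qed (use K in \<open>auto intro: cf\<close>)
  then show "subfield K Omega \<and> constants \<subseteq> K" using K by auto
next
  assume K: "subfield K Omega \<and> constants \<subseteq> K"
  have "inverse x \<in> K" if "x \<in> K" for x
    using Om.subfield_m_inv(1)[of K x] that K by (cases "x = 0") auto
  moreover have "subring K Omega" using K subfieldE(1) by blast
  ultimately show "cfield K" using K unfolding cfield_def subring_Omega_iff by auto
qed

lemma cfield_constants: "cfield constants"
proof -
  have "const a + const b \<in> constants" "const a * const b \<in> constants" "inverse (const a) \<in> constants" for a b
    by (metis const_simps(3) rangeI, metis const_simps(4) rangeI, metis const_inverse rangeI)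
  then show ?thesis by (auto simp: cfield_def)
qed

section \<open>Evaluation of polynomials and rational function fields\<close>

definition evh :: "(complex \<Rightarrow> 'a::field) \<Rightarrow> 'a \<Rightarrow> complex poly \<Rightarrow> 'a"
  where "evh h x p = poly (map_poly h p) x"

abbreviation ev :: "func \<Rightarrow> complex poly \<Rightarrow> func"
  where "ev \<equiv> evh const"

lemma evh_pCons: "field_hom h \<Longrightarrow> evh h x (pCons a p) = h a + x * evh h x p"
  by (simp add: evh_def map_poly_pCons field_hom_simps)

lemma evh_0 [simp]: "evh h x 0 = 0"
  by (simp add: evh_def)

lemma evh_1: "field_hom h \<Longrightarrow> evh h x 1 = 1"
  by (simp add: evh_def field_hom_simps)

lemma evh_add: "field_hom h \<Longrightarrow> evh h x (p + q) = evh h x p + evh h x q"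
  by (induction p q rule: poly_induct2) (auto simp: evh_pCons field_hom_simps algebra_simps)

lemma evh_smult: "field_hom h \<Longrightarrow> evh h x (smult a p) = h a * evh h x p"
  by (induction p) (auto simp: evh_pCons field_hom_simps algebra_simps)

lemma evh_mult: "field_hom h \<Longrightarrow> evh h x (p * q) = evh h x p * evh h x q"
  by (induction p) (auto simp: evh_pCons evh_add evh_smult field_hom_simps algebra_simps)

lemma evh_uminus: "field_hom h \<Longrightarrow> evh h x (- p) = - evh h x p"
  using evh_smult[of h x "-1" p] by (simp add: field_hom_simps)

lemma evh_power: "field_hom h \<Longrightarrow> evh h x (p ^ n) = evh h x p ^ n"
  by (induction n) (auto simp: evh_1 evh_mult)

lemma evh_prod: "field_hom h \<Longrightarrow> evh h x (\<Prod>a\<in>S. f a) = (\<Prod>a\<in>S. evh h x (f a))"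
  by (induction S rule: infinite_finite_induct) (auto simp: evh_1 evh_mult)

lemma evh_diff: "field_hom h \<Longrightarrow> evh h x (p - q) = evh h x p - evh h x q"
  using evh_add[of h x p "- q"] evh_uminus[of h x q] by simp

lemma evh_linear: "field_hom h \<Longrightarrow> evh h x [:- a, 1:] = x - h a"
  by (simp add: evh_pCons field_hom_simps)

lemmas evh_simps = evh_diff evh_pCons evh_0 evh_1 evh_add evh_smult evh_mult evh_uminus evh_power evh_prod

lemmas ev_simps [simp] = evh_diff[OF field_hom_const] evh_pCons[OF field_hom_const] evh_1[OF field_hom_const]
  evh_add[OF field_hom_const] evh_smult[OF field_hom_const] evh_mult[OF field_hom_const]
  evh_uminus[OF field_hom_const] evh_power[OF field_hom_const] evh_prod[OF field_hom_const]

lemma poly_linear_induct [consumes 1, case_names const linear]: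
  fixes p :: "complex poly"
  assumes "p \<noteq> 0" "\<And>c. c \<noteq> 0 \<Longrightarrow> Q [:c:]" "\<And>b q. q \<noteq> 0 \<Longrightarrow> Q q \<Longrightarrow> Q ([:- b, 1:] * q)"
  shows "Q p"
  using assms(1)
proof (induction "degree p" arbitrary: p)
  case 0
  then obtain c where "p = [:c:]" "c \<noteq> 0" by (metis degree_eq_zeroE pCons_eq_0_iff)
  then show ?case using assms(2) by simp
next
  case (Suc n)
  then obtain b where "poly p b = 0" using alg_closed_imp_poly_has_root[of p] by auto
  then obtain q where q: "p = [:- b, 1:] * q" by (meson dvdE poly_eq_0_iff_dvd)
  have "q \<noteq> 0" using Suc(2) q by auto
  moreover from this have "degree p = Suc (degree q)" using q by (subst q, subst degree_mult_eq) auto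
  ultimately show ?case using Suc(1)[of q] Suc(2) assms(3) q by auto
qed

text \<open>Because \<open>\<complex>\<close> is algebraically closed, a polynomial in \<open>x\<close> splits into linear factors, none of
  which vanishes when \<open>x\<close> is not a constant: every non-constant is transcendental.\<close>

lemma evh_nonzero:
  assumes h: "field_hom h" and x: "x \<notin> range h" and p: "p \<noteq> 0"
  shows "evh h x p \<noteq> 0"
  using p
proof (induction p rule: poly_linear_induct)
  case (const c)
  then show ?case using h by (simp add: evh_pCons field_hom_simps)
next
  case (linear b q)
  moreover have "x - h b \<noteq> 0" using x by auto
  ultimately show ?case unfolding evh_mult[OF h] evh_linear[OF h] by simp
qed

definition rat :: "func \<Rightarrow> func set"
  where "rat x = {ev x p / ev x q | p q. ev x q \<noteq> 0}"

lemma ratI: "ev x q \<noteq> 0 \<Longrightarrow> ev x p / ev x q \<in> rat x"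
  by (auto simp: rat_def)

lemma ratE:
  assumes "f \<in> rat x"
  obtains p q where "ev x q \<noteq> 0" "f = ev x p / ev x q"
  using assms by (auto simp: rat_def)

lemma cfield_rat [simp]: "cfield (rat x)"
proof -
  have "const c \<in> rat x" for c
    using ratI[of x 1 "[:c:]"] by simp
  moreover have "f + g \<in> rat x" "f * g \<in> rat x" if fg: "f \<in> rat x" "g \<in> rat x" for f g
  proof -
    obtain p q where 1: "ev x q \<noteq> 0" "f = ev x p / ev x q" by (rule ratE[OF fg(1)])
    obtain r s where 2: "ev x s \<noteq> 0" "g = ev x r / ev x s" by (rule ratE[OF fg(2)])
    show "f * g \<in> rat x" using ratI[of x "q * s" "p * r"] 1 2 by simp
    show "f + g \<in> rat x" using ratI[of x "q * s" "p * s + r * q"] 1 2 by (simp add: add_frac_eq)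
  qed
  moreover have "inverse f \<in> rat x" if f: "f \<in> rat x" for f
  proof -
    obtain p q where 1: "ev x q \<noteq> 0" "f = ev x p / ev x q" by (rule ratE[OF f])
    show ?thesis
    proof (cases "ev x p = 0")
      case True
      then show ?thesis using 1 ratI[of x 1 0] by simp
    qed (use 1 ratI[of x p q] in simp)
  qed
  ultimately show ?thesis by (auto simp: cfield_def)
qed

lemma gen_in_rat [simp]: "x \<in> rat x"
  using ratI[of x 1 "[:0, 1:]"] by simp

lemma ev_in: "cfield K \<Longrightarrow> x \<in> K \<Longrightarrow> ev x p \<in> K"
  by (induction p) (auto intro: cf)

lemma rat_least: "cfield K \<Longrightarrow> x \<in> K \<Longrightarrow> rat x \<subseteq> K"
  by (auto simp: rat_def intro!: cf_divide ev_in)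

lemma ev_in_rat [simp]: "ev x p \<in> rat x"
  by (rule ev_in) auto

lemma rat_eqI: "x \<in> rat y \<Longrightarrow> y \<in> rat x \<Longrightarrow> rat x = rat y"
  using rat_least by (simp add: subset_antisym)

lemma ev_nonzero: "x \<notin> constants \<Longrightarrow> ev x p = 0 \<longleftrightarrow> p = 0"
  using evh_nonzero[OF field_hom_const] by auto

lemma ev_inj: "x \<notin> constants \<Longrightarrow> ev x p = ev x q \<longleftrightarrow> p = q"
  using ev_nonzero[of x "p - q"] by simp

text \<open>
  Together with \<open>transcendental_iff\<close> this is what shows that an explicitly constructed field is a
  \<open>curve\<close>.
\<close>

lemma generate_field_rat: "generate_field Omega (insert x constants) = rat x"
proof
  have "subfield (rat x) Omega" using cfield_iff cfield_rat by blast
  then show "generate_field Omega (insert x constants) \<subseteq> rat x"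
    by (intro field.generate_field_min_subfield1[OF Omega_field]) auto
  have "subfield (generate_field Omega (insert x constants)) Omega"
    by (rule field.generate_field_is_subfield[OF Omega_field]) auto
  moreover have "constants \<subseteq> generate_field Omega (insert x constants)"
    "x \<in> generate_field Omega (insert x constants)" by (auto intro: generate_field.incl)
  ultimately show "rat x \<subseteq> generate_field Omega (insert x constants)"
    using rat_least cfield_iff by blast
qed

text \<open>
  Polynomials over the structure \<open>Omega\<close> are lists with the leading coefficient first and nonzero;
  reversing such a list loses nothing, so the statement reduces to \<open>ev_inj\<close>.
\<close>

lemma transcendental_iff:
  assumes "x \<notin> constants"
  shows "ring.transcendental Omega constants x"
proof -
  define F where "F p = Poly (rev (map (inv_into UNIV const) p))" for p
  have i: "inv_into UNIV const (const c) = c" for c by (meson const_inject injI inv_f_f)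
  have pw: "a [^]\<^bsub>Omega\<^esub> n = a ^ n" for a :: func and n :: nat
    by (induction n) auto
  have evm: "ev x (monom c n) = const c * x ^ n" for c n
    by (induction n) (auto simp: monom_0 monom_Suc algebra_simps)
  have evF: "Om.eval p x = ev x (F p)" if "set p \<subseteq> constants" for p
    using that
  proof (induction p)
    case (Cons a p)
    then obtain c where c: "a = const c" by auto
    have "F (a # p) = F p + monom c (length p)"
      using c i by (simp add: F_def Poly_snoc)
    then show ?case using Cons c by (simp add: evm pw)
  qed (simp add: F_def)
  have injF: "p = q" if "F p = F q" and p: "polynomial\<^bsub>Omega\<^esub> constants p" and q: "polynomial\<^bsub>Omega\<^esub> constants q" for p q
  proof -
    have *: "coeffs (F p) = rev (map (inv_into UNIV const) p) \<and> set p \<subseteq> constants"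
      if pp: "polynomial\<^bsub>Omega\<^esub> constants p" for p
    proof (cases p)
      case (Cons a l)
      then obtain c where "a = const c" "c \<noteq> 0" using pp by (auto simp: polynomial_def)
      then have "inv_into UNIV const a \<noteq> 0" using i by simp
      then show ?thesis using pp Cons by (auto simp: F_def polynomial_def)
    qed (simp add: F_def)
    have "map (inv_into UNIV const) p = map (inv_into UNIV const) q"
      using *[OF p] *[OF q] that(1) by (metis rev_rev_ident)
    then have "map const (map (inv_into UNIV const) p) = map const (map (inv_into UNIV const) q)" by simp
    moreover have "map const (map (inv_into UNIV const) l) = l" if "set l \<subseteq> constants" for l
      using that by (induction l) (auto simp: i)
    ultimately show ?thesis using *[OF p] *[OF q] by metis
  qed
  have "inj_on (\<lambda>p. Om.eval p x) {p. polynomial\<^bsub>Omega\<^esub> constants p}"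
  proof (rule inj_onI)
    fix p q assume "p \<in> {p. polynomial\<^bsub>Omega\<^esub> constants p}" "q \<in> {p. polynomial\<^bsub>Omega\<^esub> constants p}"
      and e: "Om.eval p x = Om.eval q x"
    then have P: "polynomial\<^bsub>Omega\<^esub> constants p" "polynomial\<^bsub>Omega\<^esub> constants q" by auto
    then have "set p \<subseteq> constants" "set q \<subseteq> constants" by (auto simp: polynomial_def)
    then have "ev x (F p) = ev x (F q)" using e evF by simp
    then show "p = q" using ev_inj[OF assms] injF P by blast
  qed
  moreover have "carrier (constants [X]\<^bsub>Omega\<^esub>) = {p. polynomial\<^bsub>Omega\<^esub> constants p}"
    by (auto simp: univ_poly_carrier)
  ultimately show ?thesis by (simp add: Om.transcendental_def)
qed

section \<open>Quadratic extensions\<close>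

definition adj :: "func set \<Rightarrow> func \<Rightarrow> func set"
  where "adj k b = {p + q * b | p q. p \<in> k \<and> q \<in> k}"

definition quad :: "func set \<Rightarrow> func \<Rightarrow> bool"
  where "quad k b \<longleftrightarrow> cfield k \<and> b\<^sup>2 \<in> k \<and> b \<notin> k"

text \<open>
  The nontrivial automorphism of \<open>adj k b\<close> over \<open>k\<close>, for \<open>quad k b\<close>.
\<close>

definition conj :: "func set \<Rightarrow> func \<Rightarrow> func \<Rightarrow> func"
  where "conj k b f = (THE g. \<exists>p\<in>k. \<exists>q\<in>k. f = p + q * b \<and> g = p - q * b)"

lemma adjI: "p \<in> k \<Longrightarrow> q \<in> k \<Longrightarrow> p + q * b \<in> adj k b"
  by (auto simp: adj_def)

lemma adjE:
  assumes "f \<in> adj k b"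
  obtains p q where "p \<in> k" "q \<in> k" "f = p + q * b"
  using assms by (auto simp: adj_def)

lemma adj_least: "cfield K \<Longrightarrow> k \<subseteq> K \<Longrightarrow> b \<in> K \<Longrightarrow> adj k b \<subseteq> K"
  by (auto simp: adj_def intro!: cf)

lemma base_in_adj: "cfield k \<Longrightarrow> f \<in> k \<Longrightarrow> f \<in> adj k b"
  using adjI[of f k 0 b] by (auto intro: cf)

lemma gen_in_adj: "cfield k \<Longrightarrow> b \<in> adj k b"
  using adjI[of 0 k 1 b] by (auto intro: cf)

lemma quad_nonzero: "quad k b \<Longrightarrow> b \<noteq> 0"
  by (auto simp: quad_def intro: cf)

lemma quad_unique:
  assumes "quad k b" "p \<in> k" "q \<in> k" "p' \<in> k" "q' \<in> k" "p + q * b = p' + q' * b"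
  shows "p = p' \<and> q = q'"
proof (rule ccontr)
  assume n: "\<not> (p = p' \<and> q = q')"
  have "q \<noteq> q'" using n assms(6) by auto
  then have "b = (p - p') / (q' - q)" using assms(6) by (simp add: field_simps)
  then show False using assms by (auto simp: quad_def intro: cf)
qed

lemma quad_zero_iff:
  assumes "quad k b" "p \<in> k" "q \<in> k"
  shows "p + q * b = 0 \<longleftrightarrow> p = 0 \<and> q = 0"
  using quad_unique[OF assms, of 0 0] assms(1) by (auto simp: quad_def intro: cf)

lemma conj_eq:
  assumes "quad k b" "p \<in> k" "q \<in> k"
  shows "conj k b (p + q * b) = p - q * b"
  unfolding conj_def
proof (rule the_equality)
  fix g assume "\<exists>p'\<in>k. \<exists>q'\<in>k. p + q * b = p' + q' * b \<and> g = p' - q' * b"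
  then show "g = p - q * b" using quad_unique assms by blast
qed (use assms in blast)

lemma quad_cfield_adj:
  assumes "quad k b"
  shows "cfield (adj k b)"
proof -
  have k: "cfield k" and B: "b\<^sup>2 \<in> k" using assms by (auto simp: quad_def)
  have 1: "const c \<in> adj k b" for c using k base_in_adj by (simp add: cf)
  have 2: "f + g \<in> adj k b \<and> f * g \<in> adj k b" if fg: "f \<in> adj k b" "g \<in> adj k b" for f g
  proof -
    obtain p q where f: "p \<in> k" "q \<in> k" "f = p + q * b" by (rule adjE[OF fg(1)])
    obtain p' q' where g: "p' \<in> k" "q' \<in> k" "g = p' + q' * b" by (rule adjE[OF fg(2)])
    have "f + g = (p + p') + (q + q') * b" "f * g = (p * p' + q * q' * b\<^sup>2) + (p * q' + q * p') * b"
      using f g by (auto simp: algebra_simps power2_eq_square)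
    moreover have "(p + p') + (q + q') * b \<in> adj k b"
      "(p * p' + q * q' * b\<^sup>2) + (p * q' + q * p') * b \<in> adj k b"
      using f g k B by (auto intro!: adjI cf)
    ultimately show ?thesis by metis
  qed
  have 3: "inverse f \<in> adj k b" if fA: "f \<in> adj k b" for f
  proof (cases "f = 0")
    case False
    obtain p q where f: "p \<in> k" "q \<in> k" "f = p + q * b" by (rule adjE[OF fA])
    define n where "n = p\<^sup>2 - q\<^sup>2 * b\<^sup>2"
    have n: "n = f * (p - q * b)" using f by (simp add: n_def algebra_simps power2_eq_square)
    have "p - q * b \<noteq> 0"
      using quad_zero_iff[OF assms f(1) cf_uminus[OF k f(2)]] False f(3) by auto
    then have "n \<noteq> 0" using False n by auto
    then have "inverse f = (p - q * b) / n"
      using False n by (simp add: inverse_eq_divide)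
    then have "inverse f = p / n + (- q / n) * b"
      by (simp add: diff_divide_distrib)
    moreover have "n \<in> k" using f k B by (auto simp: n_def intro!: cf)
    ultimately have "p / n \<in> k" "- q / n \<in> k" and i: "inverse f = p / n + (- q / n) * b"
      using f k by (auto intro!: cf)
    then show ?thesis unfolding i by (intro adjI)
  qed (use 1[of 0] in simp)
  show ?thesis using 1 2 3 by (auto simp: cfield_def)
qed

text \<open>
  An automorphism of \<open>K\<close> over \<open>\<complex>\<close> that is its own inverse; its values outside \<open>K\<close> are arbitrary.
\<close>

definition auto_on :: "func set \<Rightarrow> (func \<Rightarrow> func) \<Rightarrow> bool"
  where "auto_on K s \<longleftrightarrow> (\<forall>x\<in>K. s x \<in> K \<and> s (s x) = x) \<and> (\<forall>c. s (const c) = const c) \<and>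
    (\<forall>x\<in>K. \<forall>y\<in>K. s (x + y) = s x + s y \<and> s (x * y) = s x * s y)"

lemma auto_on_simps:
  assumes "auto_on K s" "x \<in> K"
  shows "s x \<in> K" "s (s x) = x"
    "y \<in> K \<Longrightarrow> s (x + y) = s x + s y" "y \<in> K \<Longrightarrow> s (x * y) = s x * s y"
  using assms by (auto simp: auto_on_def)

lemma auto_on_const: "auto_on K s \<Longrightarrow> s (const c) = const c" "auto_on K s \<Longrightarrow> s 0 = 0" "auto_on K s \<Longrightarrow> s 1 = 1"
  unfolding auto_on_def by (auto, metis const_simps(2), metis const_simps(1))

lemma auto_on_more:
  assumes "cfield K" "auto_on K s" "x \<in> K"
  shows "s (- x) = - s x" "y \<in> K \<Longrightarrow> s (x - y) = s x - s y" "s (inverse x) = inverse (s x)"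
    "y \<in> K \<Longrightarrow> s (y / x) = s y / s x" "s (x ^ n) = s x ^ n" "s x = 0 \<longleftrightarrow> x = 0"
proof -
  have m: "s (- x) = - s x" if "x \<in> K" for x
    using auto_on_simps(3)[OF assms(2) that, of "- x"] auto_on_const(2)[OF assms(2)] cf_uminus[OF assms(1) that]
    by (simp add: eq_neg_iff_add_eq_0 add.commute)
  show "s (- x) = - s x" using m assms(3) .
  show "s (x - y) = s x - s y" if "y \<in> K"
    using auto_on_simps(3)[OF assms(2,3), of "- y"] m[OF that] cf_uminus[OF assms(1) that] by simp
  show i: "s (inverse x) = inverse (s x)"
  proof (cases "x = 0")
    case True
    then show ?thesis by (simp add: auto_on_const(2)[OF assms(2)])
  next
    case False
    then have "s x * s (inverse x) = 1"
      using auto_on_simps(4)[OF assms(2,3), of "inverse x"] cf_inverse[OF assms(1,3)] auto_on_const(3)[OF assms(2)]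
      by simp
    then show ?thesis by (simp add: inverse_unique)
  qed
  show "s (y / x) = s y / s x" if "y \<in> K"
    using auto_on_simps(4)[OF assms(2) that, of "inverse x"] cf_inverse[OF assms(1,3)] i
    by (simp add: divide_inverse)
  show "s (x ^ n) = s x ^ n"
    using assms by (induction n) (auto simp: auto_on_const(3)[OF assms(2)] auto_on_simps(4)[OF assms(2)] cf)
  show "s x = 0 \<longleftrightarrow> x = 0"
    using auto_on_simps(2)[OF assms(2,3)] auto_on_const(2)[OF assms(2)] by auto
qed

lemma auto_on_ev:
  assumes "cfield K" "auto_on K s" "x \<in> K"
  shows "s (ev x p) = ev (s x) p"
  using assms
  by (induction p) (auto simp: auto_on_const[OF assms(2)] auto_on_simps[OF assms(2)] ev_in cf)

lemma conj_base: "quad k b \<Longrightarrow> f \<in> k \<Longrightarrow> conj k b f = f"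
  using conj_eq[of k b f 0] by (auto simp: quad_def intro: cf)

lemma conj_gen: "quad k b \<Longrightarrow> conj k b b = - b"
  using conj_eq[of k b 0 1] by (auto simp: quad_def intro: cf)

lemma auto_on_conj:
  assumes "quad k b"
  shows "auto_on (adj k b) (conj k b)"
proof -
  have k: "cfield k" and B: "b\<^sup>2 \<in> k" using assms by (auto simp: quad_def)
  have 1: "conj k b f \<in> adj k b \<and> conj k b (conj k b f) = f" if fA: "f \<in> adj k b" for f
  proof -
    obtain p q where f: "p \<in> k" "q \<in> k" "f = p + q * b" by (rule adjE[OF fA])
    have c: "conj k b f = p + (- q) * b" using conj_eq[OF assms f(1,2)] f by simp
    have "- q \<in> k" using cf_uminus[OF k f(2)] .
    then have "p + (- q) * b \<in> adj k b" "conj k b (p + (- q) * b) = p - (- q) * b"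
      using f(1) conj_eq[OF assms f(1), of "- q"] adjI[of p k "- q" b] by blast+
    then show ?thesis unfolding c using f(3) by (metis diff_minus_eq_add mult_minus_left)
  qed
  have 2: "conj k b (f + g) = conj k b f + conj k b g \<and> conj k b (f * g) = conj k b f * conj k b g"
    if fg: "f \<in> adj k b" "g \<in> adj k b" for f g
  proof -
    obtain p q where f: "p \<in> k" "q \<in> k" "f = p + q * b" by (rule adjE[OF fg(1)])
    obtain p' q' where g: "p' \<in> k" "q' \<in> k" "g = p' + q' * b" by (rule adjE[OF fg(2)])
    have e: "f + g = (p + p') + (q + q') * b" "f * g = (p * p' + q * q' * b\<^sup>2) + (p * q' + q * p') * b"
      using f g by (auto simp: algebra_simps power2_eq_square)
    have "conj k b (f + g) = (p + p') - (q + q') * b"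
      unfolding e(1) by (rule conj_eq[OF assms]) (use f g k in \<open>auto intro!: cf_add cf_mult\<close>)
    moreover have "conj k b (f * g) = (p * p' + q * q' * b\<^sup>2) - (p * q' + q * p') * b"
      unfolding e(2) by (rule conj_eq[OF assms]) (use f g k B in \<open>auto intro!: cf_add cf_mult\<close>)
    moreover have "conj k b f = p - q * b" "conj k b g = p' - q' * b" using f g conj_eq[OF assms] by auto
    ultimately show ?thesis by (auto simp: algebra_simps power2_eq_square)
  qed
  show ?thesis using 1 2 conj_base[OF assms] k by (auto simp: auto_on_def)
qed

lemma conj_fixed:
  assumes "quad k b" "f \<in> adj k b" "conj k b f = f"
  shows "f \<in> k"
proof -
  obtain p q where f: "p \<in> k" "q \<in> k" "f = p + q * b" by (rule adjE[OF assms(2)])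
  then have "p + q * b = p - q * b" using conj_eq[OF assms(1)] assms(3) by metis
  then have "2 * (q * b) = 0" by (simp add: algebra_simps)
  then have "q = 0" using quad_nonzero[OF assms(1)] by simp
  then show ?thesis using f by simp
qed

lemma conj_norm:
  assumes "quad k b" "f \<in> adj k b"
  shows "f * conj k b f \<in> k"
proof -
  obtain p q where f: "p \<in> k" "q \<in> k" "f = p + q * b" by (rule adjE[OF assms(2)])
  have "f * conj k b f = (p + q * b) * (p - q * b)"
    using conj_eq[OF assms(1) f(1,2)] f(3) by simp
  then have "f * conj k b f = p\<^sup>2 - q\<^sup>2 * b\<^sup>2"
    by (simp add: algebra_simps power2_eq_square)
  then show ?thesis using f assms(1) by (auto simp: quad_def intro!: cf)
qed

text \<open>
  Multiplying the generator by a nonzero element of \<open>k\<close> changes neither the extension nor its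
  automorphism. It serves to give the radicand order zero or one at a chosen point.
\<close>

lemma adj_scale:
  assumes "quad k b" "l \<in> k" "l \<noteq> 0"
  shows "quad k (l * b)" "adj k (l * b) = adj k b" "f \<in> adj k b \<Longrightarrow> conj k (l * b) f = conj k b f"
proof -
  have k: "cfield k" and B: "b\<^sup>2 \<in> k" "b \<notin> k" using assms by (auto simp: quad_def)
  have "l * b \<notin> k"
  proof
    assume "l * b \<in> k"
    then have "(l * b) / l \<in> k" using cf_divide[OF k _ assms(2)] by blast
    then show False using assms(3) B(2) by simp
  qed
  then show q: "quad k (l * b)" using k B assms by (auto simp: quad_def power_mult_distrib intro: cf)
  show "adj k (l * b) = adj k b"
  proof
    show "adj k (l * b) \<subseteq> adj k b"
      using k assms adjI[of _ k "_ * l" b] by (auto simp: adj_def[of k "l * b"] mult.assoc[symmetric] intro: cf)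
    show "adj k b \<subseteq> adj k (l * b)"
    proof
      fix f assume "f \<in> adj k b"
      then obtain p q where f: "p \<in> k" "q \<in> k" "f = p + q * b" by (rule adjE)
      then have "f = p + (q / l) * (l * b)" using assms by simp
      then show "f \<in> adj k (l * b)" using f k assms by (metis adjI cf_divide)
    qed
  qed
  assume "f \<in> adj k b"
  then obtain p r where f: "p \<in> k" "r \<in> k" "f = p + r * b" by (rule adjE)
  then have "f = p + (r / l) * (l * b)" using assms by simp
  then have "conj k (l * b) f = p - (r / l) * (l * b)" using f k assms conj_eq[OF q] by (metis cf_divide)
  then show "conj k (l * b) f = conj k b f" using f assms conj_eq[OF assms(1)] by simp
qed

lemma line_extension_Omega: "Om.line_extension k v E = {c * v + w | c w. c \<in> k \<and> w \<in> E}"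
proof -
  have "u \<in> Om.line_extension k v E \<longleftrightarrow> (\<exists>c\<in>k. \<exists>w\<in>E. u = c * v + w)" for u
    by (simp add: Om.line_extension_mem_iff)
  then show ?thesis by blast
qed

text \<open>
  Write \<open>K\<close> as \<open>k v1 + k v2\<close>. Dividing by \<open>v2\<close> gives \<open>K = k + k m\<close>, and completing the square in
  the quadratic equation of \<open>m\<close> gives a generator whose square lies in \<open>k\<close>.
\<close>

lemma has_dim_2_quad:
  assumes "cfield k" "cfield K" "k \<subseteq> K" "has_dim_over k K 2"
  obtains b where "quad k b" "K = adj k b"
proof -
  have "Om.dimension (Suc (Suc 0)) k K" using assms(4) by (simp add: has_dim_over_def numeral_2_eq_2)
  then obtain v1 E1 where 1: "v1 \<notin> E1" "Om.dimension (Suc 0) k E1" "K = Om.line_extension k v1 E1"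
    by (cases rule: Om.dimension.cases) auto
  from 1(2) obtain v2 E2 where 2: "v2 \<notin> E2" "Om.dimension 0 k E2" "E1 = Om.line_extension k v2 E2"
    by (cases rule: Om.dimension.cases) auto
  have sk: "subfield k Omega" using assms(1) cfield_iff by blast
  have E2: "E2 = {0}" using Om.dimension_zero[OF sk 2(2)] by simp
  have E1: "E1 = {c * v2 | c. c \<in> k}" using 2(3) E2 by (auto simp: line_extension_Omega)
  have K: "K = {c * v1 + d * v2 | c d. c \<in> k \<and> d \<in> k}"
    unfolding 1(3) E1 line_extension_Omega by blast
  have v2: "v2 \<noteq> 0" using 2 E2 by auto
  define m where "m = v1 / v2"
  have "v1 = 1 * v1 + 0 * v2" "v2 = 0 * v1 + 1 * v2" by auto
  then have v: "v1 \<in> K" "v2 \<in> K"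
    using K cf_0[OF assms(1)] cf_1[OF assms(1)] by blast+
  have mk: "m \<notin> k" using 1(1) E1 v2 by (auto simp: m_def field_simps)
  have mK: "m \<in> K" using v assms(2) by (auto simp: m_def intro: cf)
  have Km: "\<exists>p\<in>k. \<exists>q\<in>k. f = p + q * m" if "f \<in> K" for f
  proof -
    have "f * v2 \<in> K" using that v assms(2) by (auto intro: cf)
    then obtain c d where "c \<in> k" "d \<in> k" "f * v2 = c * v1 + d * v2" using K by auto
    then have "f = (c * v1 + d * v2) / v2" using v2 by (metis nonzero_mult_div_cancel_right)
    then have "f = d + c * m" using v2 by (simp add: m_def add_divide_distrib)
    then show ?thesis using \<open>c \<in> k\<close> \<open>d \<in> k\<close> by blast
  qed
  obtain p q where pq: "p \<in> k" "q \<in> k" "m\<^sup>2 = p + q * m" using Km[of "m\<^sup>2"] mK assms(2) by (auto intro: cf)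
  define b where "b = m - q / 2"
  have b2: "b\<^sup>2 = p + q\<^sup>2 / 4"
    unfolding b_def power2_diff by (simp add: power_divide pq(3))
  have "b \<notin> k"
  proof
    assume "b \<in> k"
    then have "b + q / 2 \<in> k" using assms(1) pq by (intro cf)
    then show False using mk by (simp add: b_def)
  qed
  then have q: "quad k b" using assms(1) pq b2 by (auto simp: quad_def intro!: cf)
  have "b \<in> K" using mK pq assms by (auto simp: b_def intro!: cf)
  then have "adj k b \<subseteq> K" using adj_least assms by blast
  moreover have "K \<subseteq> adj k b"
  proof
    fix f assume "f \<in> K"
    then obtain r s where rs: "r \<in> k" "s \<in> k" "f = r + s * m" using Km by blast
    then have "f = (r + s * q / 2) + s * b" by (simp add: b_def algebra_simps)
    moreover have "r + s * q / 2 \<in> k" using rs pq assms(1) by (intro cf)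
    ultimately show "f \<in> adj k b" using rs(2) by (metis adjI)
  qed
  ultimately show thesis using that q by blast
qed

lemma quad_has_dim_2:
  assumes "quad k b"
  shows "has_dim_over k (adj k b) 2"
proof -
  have k: "cfield k" using assms by (simp add: quad_def)
  have "Om.dimension 0 k {0}" using Om.zero_dim[of k] by simp
  then have "Om.dimension (Suc 0) k (Om.line_extension k 1 {0})"
    by (intro Om.Suc_dim) auto
  moreover have "Om.line_extension k 1 {0} = k" by (auto simp: line_extension_Omega)
  ultimately have "Om.dimension (Suc 0) k k" by simp
  then have "Om.dimension (Suc (Suc 0)) k (Om.line_extension k b k)"
    using assms by (intro Om.Suc_dim) (auto simp: quad_def)
  moreover have "Om.line_extension k b k = adj k b"
    by (auto simp: line_extension_Omega adj_def add.commute)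
  ultimately show ?thesis by (simp add: has_dim_over_def numeral_2_eq_2)
qed

lemma curve_cfield: "curve K \<Longrightarrow> cfield K"
  by (simp add: curve_def cfield_iff)

lemma curve_adj:
  assumes "quad (rat x) b" "x \<notin> constants"
  shows "curve (adj (rat x) b)"
proof -
  have "x \<in> adj (rat x) b" by (rule base_in_adj) auto
  moreover have "has_dim_over (generate_field Omega (insert x constants)) (adj (rat x) b) 2"
    using quad_has_dim_2[OF assms(1)] generate_field_rat[of x] by simp
  ultimately show ?thesis
    unfolding curve_def using quad_cfield_adj[OF assms(1)] transcendental_iff[OF assms(2)] cfield_iff
    by blast
qed

section \<open>Points as embeddings into Laurent series\<close>

text \<open>
  An embedding whose image contains a series of order one. Then the pullback of the power series is
  a discrete valuation ring whose valuation is the order of the series, without any rescaling.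
\<close>

definition laurent :: "func set \<Rightarrow> (func \<Rightarrow> complex fls) \<Rightarrow> bool"
  where "laurent K e \<longleftrightarrow> (\<forall>c. e (const c) = fls_const c) \<and>
    (\<forall>x\<in>K. \<forall>y\<in>K. e (x + y) = e x + e y \<and> e (x * y) = e x * e y) \<and>
    (\<exists>t\<in>K. fls_subdegree (e t) = 1)"

abbreviation sd :: "complex fls \<Rightarrow> int" where "sd \<equiv> fls_subdegree"

definition vring :: "func set \<Rightarrow> (func \<Rightarrow> complex fls) \<Rightarrow> func set"
  where "vring K e = {f \<in> K. sd (e f) \<ge> 0}"

lemma laurent_simps:
  assumes "laurent K e"
  shows "e (const c) = fls_const c" "e 0 = 0" "e 1 = 1"
    "x \<in> K \<Longrightarrow> y \<in> K \<Longrightarrow> e (x + y) = e x + e y" "x \<in> K \<Longrightarrow> y \<in> K \<Longrightarrow> e (x * y) = e x * e y"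
proof -
  have c: "e (const c) = fls_const c" for c using assms by (auto simp: laurent_def)
  show "e (const c) = fls_const c" "e 0 = 0" "e 1 = 1"
    using c c[of 0] c[of 1] by auto
qed (use assms in \<open>auto simp: laurent_def\<close>)

lemma laurent_more:
  assumes K: "cfield K" and e: "laurent K e" and x: "x \<in> K"
  shows "e (- x) = - e x" "y \<in> K \<Longrightarrow> e (x - y) = e x - e y" "e (inverse x) = inverse (e x)"
    "e x = 0 \<longleftrightarrow> x = 0" "e (x ^ n) = e x ^ n" "e (x powi i) = e x powi i"
    "y \<in> K \<Longrightarrow> e (y / x) = e y / e x" "sd (e (inverse x)) = - sd (e x)"
    "x \<noteq> 0 \<Longrightarrow> y \<in> K \<Longrightarrow> y \<noteq> 0 \<Longrightarrow> sd (e (x * y)) = sd (e x) + sd (e y)"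
    "sd (e (x powi i)) = i * sd (e x)" "sd (e (x ^ n)) = int n * sd (e x)"
    "sd (e (- x)) = sd (e x)"
proof -
  note S = laurent_simps[OF e]
  have m: "e (- x) = - e x" if "x \<in> K" for x
    using S(4)[OF that cf_uminus[OF K that]] S(2) by (simp add: eq_neg_iff_add_eq_0 add.commute)
  show m1: "e (- x) = - e x" using m x .
  show "e (x - y) = e x - e y" if "y \<in> K"
    using S(4)[OF x cf_uminus[OF K that]] m[OF that] by simp
  show i: "e (inverse x) = inverse (e x)"
  proof (cases "x = 0")
    case False
    then have "e x * e (inverse x) = 1"
      using S(5)[OF x cf_inverse[OF K x]] S(3) by simp
    then show ?thesis by (simp add: inverse_unique)
  qed (simp add: S)
  have z: "e x = 0 \<longleftrightarrow> x = 0" if "x \<in> K" for x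
  proof
    assume "e x = 0"
    then show "x = 0" using S(5)[OF that cf_inverse[OF K that]] S(3) by (cases "x = 0") auto
  qed (simp add: S)
  show "e x = 0 \<longleftrightarrow> x = 0" using z x .
  have p: "e (x ^ n) = e x ^ n" if "x \<in> K" for x n
    using that K by (induction n) (auto simp: S cf)
  show "e (x ^ n) = e x ^ n" using p x .
  show pi: "e (x powi i) = e x powi i"
    using p[OF x] p[OF cf_inverse[OF K x]] i by (auto simp: power_int_def)
  show "e (y / x) = e y / e x" if "y \<in> K"
    using S(5)[OF that cf_inverse[OF K x]] i by (simp add: divide_inverse)
  show "sd (e (inverse x)) = - sd (e x)" using i by simp
  show "sd (e (x * y)) = sd (e x) + sd (e y)" if "x \<noteq> 0" "y \<in> K" "y \<noteq> 0"
    using S(5)[OF x that(2)] z[OF x] z[OF that(2)] that by simp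
  show "sd (e (x powi i)) = i * sd (e x)" using pi by simp
  show "sd (e (x ^ n)) = int n * sd (e x)" using p[OF x] by (simp add: fls_subdegree_pow)
  show "sd (e (- x)) = sd (e x)" using m1 by simp
qed

text \<open>
  The residue is the constant coefficient.
\<close>

lemma laurent_residue:
  assumes K: "cfield K" and e: "laurent K e" and x: "x \<in> K" "sd (e x) \<ge> 0"
  obtains c where "x = const c \<or> sd (e (x - const c)) > 0"
proof (cases "x = const (fls_nth (e x) 0)")
  case False
  define y where "y = x - const (fls_nth (e x) 0)"
  have "y \<in> K" "y \<noteq> 0" using x K False by (auto simp: y_def cf)
  then have "e y \<noteq> 0" using laurent_more(4)[OF K e] by simp
  have ey: "e y = e x - fls_const (fls_nth (e x) 0)"
    using laurent_more(2)[OF K e x(1), of "const (fls_nth (e x) 0)"] K laurent_simps(1)[OF e] by (simp add: y_def)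
  have "fls_nth (e y) n = 0" if "n < 1" for n
  proof (cases "n = 0")
    case False
    then have "n < sd (e x)" using that x(2) by linarith
    then show ?thesis using ey False by simp
  qed (simp add: ey)
  then have "sd (e y) \<ge> 1" using fls_subdegree_geI[OF \<open>e y \<noteq> 0\<close>] by blast
  then have "sd (e y) > 0" by simp
  then show thesis using that unfolding y_def by blast
qed (use that in blast)

lemma fls_subdegree_add_ge: "f + g \<noteq> 0 \<Longrightarrow> n \<le> sd f \<Longrightarrow> n \<le> sd g \<Longrightarrow> n \<le> sd (f + g)"
  using fls_plus_subdegree[of f g] by linarith

lemma fls_subdegree_add_ge0: "0 \<le> sd f \<Longrightarrow> 0 \<le> sd g \<Longrightarrow> 0 \<le> sd (f + g)"
  using fls_subdegree_add_ge[of f g 0] by (cases "f + g = 0") auto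

lemma fls_subdegree_mult_ge0: "0 \<le> sd f \<Longrightarrow> 0 \<le> sd g \<Longrightarrow> 0 \<le> sd (f * g)"
  by (cases "f = 0 \<or> g = 0") auto

lemma vring_in_points:
  assumes K: "cfield K" and e: "laurent K e"
  shows "vring K e \<in> points K"
proof -
  note S = laurent_simps[OF e] and M = laurent_more[OF K e]
  obtain t where t: "t \<in> K" "sd (e t) = 1" using e by (auto simp: laurent_def)
  have "subring (vring K e) Omega"
    unfolding subring_Omega_iff vring_def using K
    by (auto simp: S M cf fls_subdegree_add_ge0 fls_subdegree_mult_ge0)
  moreover have "constants \<subseteq> vring K e" using K S by (auto simp: vring_def)
  moreover have "inverse t \<in> K - vring K e" using t M(8)[OF t(1)] K by (auto simp: vring_def cf)
  ultimately show ?thesis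
    unfolding points_def by (auto simp: vring_def M(8) K cf)
qed

lemma maximal_ideal_vring:
  assumes K: "cfield K" and e: "laurent K e"
  shows "maximal_ideal (vring K e) = {f \<in> K. f = 0 \<or> sd (e f) > 0}"
  using laurent_more(8)[OF K e] laurent_simps(2)[OF e] K
  by (auto simp: maximal_ideal_def vring_def cf)

lemma uniformizer_vring:
  assumes K: "cfield K" and e: "laurent K e"
  shows "uniformizer (vring K e) t \<longleftrightarrow> t \<in> K \<and> sd (e t) = 1"
proof
  note M = laurent_more[OF K e]
  obtain s where s: "s \<in> K" "sd (e s) = 1" using e by (auto simp: laurent_def)
  then have s0: "s \<noteq> 0" using laurent_simps(2)[OF e] by auto
  {
    assume "uniformizer (vring K e) t"
    then have t: "t \<in> vring K e" "maximal_ideal (vring K e) = (\<lambda>g. t * g) ` vring K e"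
      by (auto simp: uniformizer_def)
    have tK: "t \<in> K" using t(1) by (auto simp: vring_def)
    have "s \<in> maximal_ideal (vring K e)" using s by (simp add: maximal_ideal_vring[OF K e])
    then obtain g where g: "g \<in> vring K e" "s = t * g" using t(2) by auto
    have t0: "t \<noteq> 0" "g \<noteq> 0" using g s0 by auto
    have "1 = sd (e t) + sd (e g)" using M(9)[OF tK t0(1) _ t0(2)] g s by (auto simp: vring_def)
    moreover have "1 \<in> vring K e" using K laurent_simps(3)[OF e] by (auto simp: vring_def cf)
    then have "t * 1 \<in> maximal_ideal (vring K e)" using t(2) by blast
    then have "sd (e t) > 0" using t0 by (simp add: maximal_ideal_vring[OF K e])
    ultimately show "t \<in> K \<and> sd (e t) = 1" using g tK by (auto simp: vring_def)
  }
  {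
    assume t: "t \<in> K \<and> sd (e t) = 1"
    then have t0: "t \<noteq> 0" using laurent_simps(2)[OF e] by auto
    have "maximal_ideal (vring K e) = (\<lambda>g. t * g) ` vring K e"
    proof
      show "(\<lambda>g. t * g) ` vring K e \<subseteq> maximal_ideal (vring K e)"
      proof clarify
        fix g assume "g \<in> vring K e"
        then show "t * g \<in> maximal_ideal (vring K e)"
          using t t0 K M(9)[of t g] unfolding maximal_ideal_vring[OF K e]
          by (cases "g = 0") (auto simp: vring_def cf)
      qed
      show "maximal_ideal (vring K e) \<subseteq> (\<lambda>g. t * g) ` vring K e"
      proof
        fix f assume f: "f \<in> maximal_ideal (vring K e)"
        then have fK: "f \<in> K" by (simp add: maximal_ideal_vring[OF K e])
        have "f / t \<in> vring K e"
        proof (cases "f = 0")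
          case False
          then have "sd (e (f * inverse t)) = sd (e f) - 1"
            using M(9)[OF fK, of "inverse t"] M(8)[of t] t t0 K by (auto simp: cf)
          then show ?thesis using f False fK t K unfolding maximal_ideal_vring[OF K e]
            by (auto simp: vring_def divide_inverse cf)
        qed (use K laurent_simps(2)[OF e] in \<open>auto simp: vring_def cf\<close>)
        then show "f \<in> (\<lambda>g. t * g) ` vring K e" using t0 by (intro image_eqI[of _ _ "f / t"]) auto
      qed
    qed
    then show "uniformizer (vring K e) t" using t by (auto simp: uniformizer_def vring_def)
  }
qed

lemma ord_at_vring:
  assumes K: "cfield K" and e: "laurent K e" and f: "f \<in> K" "f \<noteq> 0"
  shows "ord_at (vring K e) f = sd (e f)"
proof -
  note M = laurent_more[OF K e]
  have nm: "vring K e - maximal_ideal (vring K e) = {f \<in> K. f \<noteq> 0 \<and> sd (e f) = 0}"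
    using laurent_simps(2)[OF e] unfolding maximal_ideal_vring[OF K e] by (auto simp: vring_def)
  have ex: "(\<exists>t u. uniformizer (vring K e) t \<and> u \<in> vring K e - maximal_ideal (vring K e) \<and> f = u * t powi n)
    \<longleftrightarrow> n = sd (e f)" for n
  proof
    assume "\<exists>t u. uniformizer (vring K e) t \<and> u \<in> vring K e - maximal_ideal (vring K e) \<and> f = u * t powi n"
    then obtain t u where t: "t \<in> K" "sd (e t) = 1" and u: "u \<in> K" "u \<noteq> 0" "sd (e u) = 0" and fe: "f = u * t powi n"
      unfolding nm uniformizer_vring[OF K e] by blast
    have "t powi n \<in> K" "t powi n \<noteq> 0" using t K fe f by (auto simp: cf)
    then show "n = sd (e f)" unfolding fe using M(9)[OF u(1,2), of "t powi n"] u t M(10)[OF t(1)] by simp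
  next
    assume n: "n = sd (e f)"
    obtain t where t: "t \<in> K" "sd (e t) = 1" using e by (auto simp: laurent_def)
    then have t0: "t \<noteq> 0" using laurent_simps(2)[OF e] by auto
    define u where "u = f * t powi (- n)"
    have u: "u \<in> K" "u \<noteq> 0" using f t t0 K by (auto simp: u_def cf)
    have "sd (e u) = 0" using M(9)[OF f, of "t powi (- n)"] M(10)[OF t(1), of "- n"] t t0 K n
      by (auto simp: u_def cf)
    moreover have "f = u * t powi n" using t0 by (simp add: u_def power_int_minus)
    ultimately show "\<exists>t u. uniformizer (vring K e) t \<and> u \<in> vring K e - maximal_ideal (vring K e) \<and> f = u * t powi n"
      unfolding nm uniformizer_vring[OF K e] using t u by blast
  qed
  show ?thesis unfolding ord_at_def ex by simp
qed

text \<open>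
  An element \<open>f\<close> outside the valuation ring has negative order, so any \<open>g\<close> becomes integral after
  division by a high power of \<open>f\<close>; a ring that contains \<open>f\<close> and the valuation ring is everything.
  Points are therefore identified by proving a single inclusion.
\<close>

lemma vring_maximal:
  assumes K: "cfield K" and e: "laurent K e" and P: "P \<in> points K" and sub: "vring K e \<subseteq> P"
  shows "P = vring K e"
proof (rule ccontr)
  assume "P \<noteq> vring K e"
  note M = laurent_more[OF K e]
  have sr: "subring P Omega" and PK: "P \<subset> K" using P by (auto simp: points_def)
  have cl: "x \<in> P \<Longrightarrow> y \<in> P \<Longrightarrow> x * y \<in> P" for x y using sr by (auto simp: subring_Omega_iff)
  have pw: "x \<in> P \<Longrightarrow> x ^ n \<in> P" for x n
    using sr cl by (induction n) (auto simp: subring_Omega_iff)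
  obtain f where f: "f \<in> P" "f \<notin> vring K e" using sub \<open>P \<noteq> vring K e\<close> by auto
  then have fK: "f \<in> K" and neg: "sd (e f) < 0" using PK by (auto simp: vring_def)
  have f0: "f \<noteq> 0" using neg laurent_simps(2)[OF e] by auto
  have "K \<subseteq> P"
  proof
    fix g assume g: "g \<in> K"
    show "g \<in> P"
    proof (cases "g = 0")
      case True
      then show ?thesis using P const_simps(2) unfolding points_def by (metis (no_types, lifting) mem_Collect_eq rangeI subsetD)
    next
      case False
      define n where "n = nat (- sd (e g))"
      define h where "h = g * inverse f ^ n"
      have "sd (e h) = sd (e g) + int n * (- sd (e f))"
        using M(9)[OF g False, of "inverse f ^ n"] M(11)[of "inverse f" n] M(8)[OF fK] f0 fK K
        by (auto simp: h_def cf)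
      moreover have "int n * 1 \<le> int n * (- sd (e f))" using neg by (intro mult_left_mono) auto
      moreover have "- sd (e g) \<le> int n" by (simp add: n_def)
      ultimately have "sd (e h) \<ge> 0" by linarith
      then have "h \<in> P" using sub g fK K by (auto simp: vring_def h_def cf)
      then have "h * f ^ n \<in> P" using cl pw f(1) by blast
      moreover have "h * f ^ n = g" using f0 by (simp add: h_def power_inverse mult.assoc)
      ultimately show ?thesis by simp
    qed
  qed
  then show False using PK by auto
qed

text \<open>
  Fields all of whose points come from Laurent embeddings. The property holds for \<open>\<complex>(x)\<close> and passes
  to quadratic extensions, which covers all fields whose points are studied.
\<close>

definition laurent_field :: "func set \<Rightarrow> bool"
  where "laurent_field K \<longleftrightarrow> cfield K \<and> (\<forall>P\<in>points K. \<exists>e. laurent K e \<and> P = vring K e)"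

lemma laur_cfield: "laurent_field K \<Longrightarrow> cfield K"
  by (simp add: laurent_field_def)

lemma laurE:
  assumes "laurent_field K" "P \<in> points K"
  obtains e where "laurent K e" "P = vring K e"
  using assms by (auto simp: laurent_field_def)

text \<open>
  With an embedding at hand, \<open>ord_at\<close> is a discrete valuation with residue field \<open>\<complex>\<close>. These rules
  no longer mention the embedding. The order of zero is a default value, hence the assumptions that
  arguments do not vanish.
\<close>

lemma ord_rules:
  assumes "laurent_field K" "P \<in> points K" "x \<in> K" "x \<noteq> 0"
  shows ord_mult: "y \<in> K \<Longrightarrow> y \<noteq> 0 \<Longrightarrow> ord_at P (x * y) = ord_at P x + ord_at P y"
    and ord_inverse: "ord_at P (inverse x) = - ord_at P x"
    and ord_divide: "y \<in> K \<Longrightarrow> y \<noteq> 0 \<Longrightarrow> ord_at P (y / x) = ord_at P y - ord_at P x"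
    and ord_power: "ord_at P (x ^ n) = int n * ord_at P x"
    and ord_minus: "ord_at P (- x) = ord_at P x"
    and ord_add: "y \<in> K \<Longrightarrow> y \<noteq> 0 \<Longrightarrow> x + y \<noteq> 0 \<Longrightarrow> i \<le> ord_at P x \<Longrightarrow> i \<le> ord_at P y \<Longrightarrow> i \<le> ord_at P (x + y)"
    and ord_add_eq: "y \<in> K \<Longrightarrow> y \<noteq> 0 \<Longrightarrow> ord_at P x < ord_at P y \<Longrightarrow> x + y \<noteq> 0 \<and> ord_at P (x + y) = ord_at P x"
    and ord_mem: "x \<in> P \<longleftrightarrow> ord_at P x \<ge> 0"
    and ord_const: "c \<noteq> 0 \<Longrightarrow> ord_at P (const c) = 0"
    and ord_lead: "y \<in> K \<Longrightarrow> y \<noteq> 0 \<Longrightarrow> ord_at P x \<ge> ord_at P y \<Longrightarrow>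
          \<exists>c. x = const c * y \<or> ord_at P (x - const c * y) > ord_at P y"
    and ex_uniformizer: "\<exists>t\<in>K. t \<noteq> 0 \<and> uniformizer P t"
    and ord_uniformizer: "uniformizer P t \<longleftrightarrow> t \<in> K \<and> t \<noteq> 0 \<and> ord_at P t = 1"
proof -
  obtain e where e: "laurent K e" and P: "P = vring K e" using assms laurE by blast
  have K: "cfield K" using assms laur_cfield by blast
  note S = laurent_simps[OF e]
  note O = ord_at_vring[OF K e, folded P]
  note x = assms(3,4)
  note M = laurent_more[OF K e]
  have m: "ord_at P (x * y) = ord_at P x + ord_at P y" if "y \<in> K" "y \<noteq> 0" "x \<in> K" "x \<noteq> 0" for x y
    using O that K laurent_more(9)[OF K e that(3,4,1,2)] by (simp add: cf)
  show "ord_at P (x * y) = ord_at P x + ord_at P y" if "y \<in> K" "y \<noteq> 0"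
    using m that x by blast
  show "ord_at P (inverse x) = - ord_at P x" using O x K by (simp add: cf M)
  show "ord_at P (y / x) = ord_at P y - ord_at P x" if "y \<in> K" "y \<noteq> 0"
    using m[of "inverse x" y] O that x K by (simp add: divide_inverse cf M(8))
  show "ord_at P (x ^ n) = int n * ord_at P x" using O x K M(11)[OF x(1)] by (simp add: cf)
  show "ord_at P (- x) = ord_at P x" using O x K by (simp add: cf M)
  show "i \<le> ord_at P (x + y)" if "y \<in> K" "y \<noteq> 0" "x + y \<noteq> 0" "i \<le> ord_at P x" "i \<le> ord_at P y"
    using fls_subdegree_add_ge[of "e x" "e y" i] S(4)[OF x(1) that(1)] M(4)[of "x + y"] O that x K by (simp add: cf)
  show "x + y \<noteq> 0 \<and> ord_at P (x + y) = ord_at P x" if "y \<in> K" "y \<noteq> 0" "ord_at P x < ord_at P y"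
  proof -
    have "sd (e x) < sd (e y)" using that O x by simp
    then have "sd (e x + e y) = sd (e x)" using M(4)[of x] x by (intro fls_subdegree_add_eq1) auto
    moreover have "x + y \<noteq> 0"
    proof
      assume "x + y = 0"
      then have "y = - x" by (simp add: eq_neg_iff_add_eq_0 add.commute)
      then show False using \<open>sd (e x) < sd (e y)\<close> M(12)[OF x(1)] by simp
    qed
    ultimately show ?thesis using O S(4)[OF x(1) that(1)] x that K by (simp add: cf)
  qed
  show "x \<in> P \<longleftrightarrow> ord_at P x \<ge> 0" using O x P by (simp add: vring_def)
  show "ord_at P (const c) = 0" if "c \<noteq> 0" using O[of "const c"] K S(1) that by simp
  have R: "\<exists>c. x = const c \<or> ord_at P (x - const c) > 0" if x: "x \<in> K" "x \<noteq> 0" and "ord_at P x \<ge> 0" for x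
  proof -
    obtain c where c: "x = const c \<or> sd (e (x - const c)) > 0"
    proof (rule laurent_residue[OF K e x(1)])
      show "0 \<le> sd (e x)" using \<open>ord_at P x \<ge> 0\<close> O[OF x] by simp
    qed
    show ?thesis
    proof (cases "x = const c")
      case False
      then show ?thesis using c O[of "x - const c"] x K by (intro exI[of _ c]) (auto simp: cf)
    qed blast
  qed
  show "\<exists>c. x = const c * y \<or> ord_at P (x - const c * y) > ord_at P y"
    if y: "y \<in> K" "y \<noteq> 0" "ord_at P x \<ge> ord_at P y"
  proof -
    have xy: "x / y \<in> K" "x / y \<noteq> 0" using x y K by (auto simp: cf)
    have "ord_at P x = ord_at P (x / y) + ord_at P y" using m[OF y(1,2) xy] y by simp
    then obtain c where c: "x / y = const c \<or> ord_at P (x / y - const c) > 0" using R[OF xy] y by auto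
    show ?thesis
    proof (cases "x / y = const c")
      case True
      then show ?thesis using y by (intro exI[of _ c]) (auto simp: field_simps)
    next
      case False
      then have "x / y - const c \<in> K" "x / y - const c \<noteq> 0" using xy K by (auto simp: cf)
      then have "ord_at P ((x / y - const c) * y) > ord_at P y" using m[OF y(1,2)] c False by auto
      moreover have "(x / y - const c) * y = x - const c * y" using y by (simp add: left_diff_distrib)
      ultimately show ?thesis by metis
    qed
  qed
  show "uniformizer P t \<longleftrightarrow> t \<in> K \<and> t \<noteq> 0 \<and> ord_at P t = 1"
    unfolding P uniformizer_vring[OF K e] using O[of t] S(2) P by (cases "t = 0") auto
  obtain t where t: "t \<in> K" "sd (e t) = 1" using e by (auto simp: laurent_def)
  then have t0: "t \<noteq> 0" using S(2) by auto
  show "\<exists>t\<in>K. t \<noteq> 0 \<and> uniformizer P t"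
    using t t0 unfolding P uniformizer_vring[OF K e] by auto
qed

lemma point_mem_K: "P \<in> points K \<Longrightarrow> f \<in> P \<Longrightarrow> f \<in> K"
  by (auto simp: points_def)

lemma points_props:
  assumes "P \<in> points K"
  shows "1 \<in> P" "0 \<in> P" "const c \<in> P" "x \<in> P \<Longrightarrow> y \<in> P \<Longrightarrow> x + y \<in> P" "x \<in> P \<Longrightarrow> y \<in> P \<Longrightarrow> x * y \<in> P"
    "x \<in> P \<Longrightarrow> - x \<in> P" "x \<in> P \<Longrightarrow> y \<in> P \<Longrightarrow> x - y \<in> P" "x \<in> P \<Longrightarrow> x ^ n \<in> P"
proof -
  have sr: "subring P Omega" "constants \<subseteq> P" using assms by (auto simp: points_def)
  show c: "const c \<in> P" for c using sr by auto
  show "0 \<in> P" using c[of 0] by simp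
  show one: "1 \<in> P" and ad: "x \<in> P \<Longrightarrow> y \<in> P \<Longrightarrow> x + y \<in> P" and mu: "x \<in> P \<Longrightarrow> y \<in> P \<Longrightarrow> x * y \<in> P"
    and um: "x \<in> P \<Longrightarrow> - x \<in> P" for x y
    using sr(1) by (auto simp: subring_Omega_iff)
  show "x - y \<in> P" if "x \<in> P" "y \<in> P" using ad[OF that(1) um[OF that(2)]] by simp
  show "x ^ n \<in> P" if "x \<in> P" using one mu that by (induction n) auto
qed

lemma ord_pos_iff:
  assumes "laurent_field K" "P \<in> points K" "x \<in> K" "x \<noteq> 0"
  shows "ord_at P x > 0 \<longleftrightarrow> inverse x \<notin> P"
proof -
  have "inverse x \<in> K" "inverse x \<noteq> 0" using assms laur_cfield by (auto simp: cf)
  then show ?thesis using ord_mem[OF assms(1,2), of "inverse x"] ord_inverse[OF assms] by auto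
qed

section \<open>Points of a rational function field\<close>

text \<open>
  The homomorphism from \<open>\<complex>(z)\<close> that sends \<open>z\<close> to \<open>s\<close> and acts on constants as \<open>h\<close>. It is used with
  Laurent series as target (points of the line) and with \<open>func\<close> as target (coverings of the line).
\<close>

definition subst :: "(complex \<Rightarrow> 'a::field) \<Rightarrow> func \<Rightarrow> 'a \<Rightarrow> func \<Rightarrow> 'a"
  where "subst h z s f = (THE y. \<exists>p q. ev z q \<noteq> 0 \<and> f = ev z p / ev z q \<and> y = evh h s p / evh h s q)"

lemma subst_eq:
  assumes h: "field_hom h" and s: "s \<notin> range h" and z: "z \<notin> constants" and q: "q \<noteq> 0"
  shows "subst h z s (ev z p / ev z q) = evh h s p / evh h s q"
  unfolding subst_def
proof (rule the_equality)
  show "\<exists>p' q'. ev z q' \<noteq> 0 \<and> ev z p / ev z q = ev z p' / ev z q' \<and> evh h s p / evh h s q = evh h s p' / evh h s q'"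
    using q ev_nonzero[OF z] by blast
  fix y assume "\<exists>p' q'. ev z q' \<noteq> 0 \<and> ev z p / ev z q = ev z p' / ev z q' \<and> y = evh h s p' / evh h s q'"
  then obtain p' q' where y: "ev z q' \<noteq> 0" "ev z p / ev z q = ev z p' / ev z q'" "y = evh h s p' / evh h s q'"
    by blast
  have "ev z p * ev z q' = ev z p' * ev z q"
    using y(1,2) q ev_nonzero[OF z, of q] by (simp add: frac_eq_eq)
  then have "p * q' = p' * q" using ev_inj[OF z, of "p * q'" "p' * q"] by simp
  then have "evh h s p * evh h s q' = evh h s p' * evh h s q"
    by (metis evh_mult[OF h])
  moreover have "q' \<noteq> 0" using y(1) by auto
  moreover from this have "evh h s q \<noteq> 0" "evh h s q' \<noteq> 0" using evh_nonzero[OF h s] q by auto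
  ultimately show "y = evh h s p / evh h s q" using y(3) by (simp add: frac_eq_eq)
qed

lemma rat_cases:
  assumes "z \<notin> constants" "f \<in> rat z"
  obtains p q where "q \<noteq> 0" "f = ev z p / ev z q"
  using assms(2) ev_nonzero[OF assms(1)] by (auto simp: rat_def)

lemma rat_coprime:
  assumes "z \<notin> constants" "f \<in> rat z"
  obtains p q where "q \<noteq> 0" "f = ev z p / ev z q" "\<And>a. poly q a = 0 \<Longrightarrow> poly p a \<noteq> 0"
proof -
  obtain p q where pq: "q \<noteq> 0" "f = ev z p / ev z q" using rat_cases assms by metis
  have "gcd p q \<noteq> 0" using pq by simp
  then obtain p' q' where g: "p = p' * gcd p q" "q = q' * gcd p q" "coprime p' q'"
    using gcd_coprime_exists by blast
  have "q' \<noteq> 0" using g pq by auto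
  moreover have "ev z (gcd p q) \<noteq> 0" using ev_nonzero[OF assms(1)] pq by simp
  then have "f = ev z p' / ev z q'"
    unfolding pq(2) by (subst g(1), subst g(2)) simp
  moreover have "poly p' a \<noteq> 0" if "poly q' a = 0" for a
  proof
    assume "poly p' a = 0"
    then have "[:- a, 1:] dvd p'" "[:- a, 1:] dvd q'" using that by (auto simp: poly_eq_0_iff_dvd)
    then have "is_unit [:- a, 1:]" using g(3) coprime_common_divisor by blast
    then show False by (simp add: is_unit_pCons_iff)
  qed
  ultimately show thesis using that by blast
qed

lemma subst_simps:
  assumes h: "field_hom h" and s: "s \<notin> range h" and z: "z \<notin> constants"
  shows "subst h z s (const c) = h c" "subst h z s (ev z p) = evh h s p" "subst h z s z = s"
    "f \<in> rat z \<Longrightarrow> g \<in> rat z \<Longrightarrow> subst h z s (f + g) = subst h z s f + subst h z s g"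
    "f \<in> rat z \<Longrightarrow> g \<in> rat z \<Longrightarrow> subst h z s (f * g) = subst h z s f * subst h z s g"
proof -
  note E = subst_eq[OF h s z]
  show p: "subst h z s (ev z p) = evh h s p" for p
    using E[of 1 p] by (simp add: evh_1[OF h])
  show "subst h z s (const c) = h c" using p[of "[:c:]"] h by (simp add: evh_simps)
  show "subst h z s z = s" using p[of "[:0, 1:]"] h by (simp add: evh_simps field_hom_simps)
  assume fg: "f \<in> rat z" "g \<in> rat z"
  obtain p q where 1: "q \<noteq> 0" "f = ev z p / ev z q" by (rule rat_cases[OF z fg(1)])
  obtain p' q' where 2: "q' \<noteq> 0" "g = ev z p' / ev z q'" by (rule rat_cases[OF z fg(2)])
  have n: "ev z q \<noteq> 0" "ev z q' \<noteq> 0" "evh h s q \<noteq> 0" "evh h s q' \<noteq> 0" "q * q' \<noteq> 0"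
    using 1 2 ev_nonzero[OF z] evh_nonzero[OF h s] by auto
  have "f + g = ev z (p * q' + p' * q) / ev z (q * q')" using n 1 2 by (simp add: add_frac_eq)
  then have "subst h z s (f + g) = evh h s (p * q' + p' * q) / evh h s (q * q')" using E n(5) by metis
  also have "\<dots> = evh h s p / evh h s q + evh h s p' / evh h s q'"
    using n by (simp add: evh_mult[OF h] evh_add[OF h] add_frac_eq)
  finally show "subst h z s (f + g) = subst h z s f + subst h z s g"
    using E 1 2 by simp
  have "f * g = ev z (p * p') / ev z (q * q')" using n 1 2 by simp
  then have "subst h z s (f * g) = evh h s (p * p') / evh h s (q * q')" using E n(5) by metis
  also have "\<dots> = evh h s p / evh h s q * (evh h s p' / evh h s q')"
    by (simp add: evh_mult[OF h])
  finally show "subst h z s (f * g) = subst h z s f * subst h z s g"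
    using E 1 2 by simp
qed

abbreviation loc :: "complex \<Rightarrow> complex fls" where "loc a \<equiv> fls_const a + fls_X"

text \<open>
  The point \<open>z = a\<close>: expand in powers of \<open>z - a\<close>.
\<close>

definition pt :: "func \<Rightarrow> complex \<Rightarrow> func set"
  where "pt z a = vring (rat z) (subst fls_const z (loc a))"

text \<open>
  The point \<open>z = \<infinity>\<close>, seen through the coordinate \<open>1/z\<close>.
\<close>

definition pt_inf :: "func \<Rightarrow> func set"
  where "pt_inf z = pt (inverse z) 0"

lemma loc_nonconst: "loc a \<notin> range fls_const"
proof
  assume "loc a \<in> range fls_const"
  then obtain c where "loc a = fls_const c" by auto
  then have "fls_nth (loc a) 1 = fls_nth (fls_const c) 1" by simp
  then show False by simp
qed

lemma laurent_pt:
  assumes "z \<notin> constants"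
  shows "laurent (rat z) (subst fls_const z (loc a))"
proof -
  note S = subst_simps[OF field_hom_fls_const loc_nonconst assms]
  have "subst fls_const z (loc a) (z - const a) = fls_X"
    using S(2)[of a "[:- a, 1:]"] evh_linear[OF field_hom_fls_const, of "loc a" a]
      evh_linear[OF field_hom_const, of z a] by simp
  then show ?thesis unfolding laurent_def using S
    by (auto intro!: bexI[of _ "z - const a"] cf_diff)
qed

lemma pt_in_points [simp]: "z \<notin> constants \<Longrightarrow> pt z a \<in> points (rat z)"
  unfolding pt_def by (intro vring_in_points laurent_pt) auto

lemma inverse_nonconst: "z \<notin> constants \<Longrightarrow> inverse z \<notin> constants"
  using cf_inverse[OF cfield_constants, of "inverse z"] by auto

lemma rat_inverse [simp]: "rat (inverse z) = rat z"
proof (rule rat_eqI)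
  show "inverse z \<in> rat z" by (intro cf_inverse) auto
  show "z \<in> rat (inverse z)" using cf_inverse[OF cfield_rat gen_in_rat, of "inverse z"] by simp
qed

lemma pt_inf_in_points [simp]: "z \<notin> constants \<Longrightarrow> pt_inf z \<in> points (rat z)"
  using pt_in_points[OF inverse_nonconst, of z 0] by (simp add: pt_inf_def)

lemma sd_evh_loc:
  "sd (evh fls_const (loc a) p) \<ge> 0" "poly p a \<noteq> 0 \<Longrightarrow> sd (evh fls_const (loc a) p) = 0"
proof -
  have 0: "sd (loc a) \<ge> 0" by (rule fls_subdegree_add_ge0) auto
  show ge: "sd (evh fls_const (loc a) p) \<ge> 0" for p
    by (induction p)
      (auto simp: evh_pCons[OF field_hom_fls_const] intro!: fls_subdegree_add_ge0 fls_subdegree_mult_ge0 0)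
  assume pa: "poly p a \<noteq> 0"
  have "[:- a, 1:] dvd p - [:poly p a:]" by (simp flip: poly_eq_0_iff_dvd)
  then obtain q where "p - [:poly p a:] = [:- a, 1:] * q" by (rule dvdE)
  then have "p = [:poly p a:] + [:- a, 1:] * q" by (simp add: algebra_simps)
  then have "evh fls_const (loc a) p = evh fls_const (loc a) ([:poly p a:] + [:- a, 1:] * q)" by simp
  also have "\<dots> = fls_const (poly p a) + fls_X * evh fls_const (loc a) q"
    unfolding evh_add[OF field_hom_fls_const] evh_mult[OF field_hom_fls_const] evh_linear[OF field_hom_fls_const]
    by (simp add: evh_pCons[OF field_hom_fls_const])
  finally have "fls_nth (evh fls_const (loc a) p) 0 = poly p a + fls_nth (evh fls_const (loc a) q) (-1)"
    by (simp add: fls_X_times_conv_shift)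
  also have "fls_nth (evh fls_const (loc a) q) (-1) = 0"
    using ge[of q] by (intro fls_eq0_below_subdegree) linarith
  finally have "sd (evh fls_const (loc a) p) \<le> 0" using pa by (intro fls_subdegree_leI) simp
  then show "sd (evh fls_const (loc a) p) = 0" using ge[of p] by simp
qed

lemma ord_pt_ev:
  assumes z: "z \<notin> constants" and p: "p \<noteq> 0"
  shows "ord_at (pt z a) (ev z p) = int (order a p)"
proof -
  note S = subst_simps[OF field_hom_fls_const loc_nonconst z]
  note L = laurent_pt[OF z, of a]
  obtain q where q: "p = [:- a, 1:] ^ order a p * q" "\<not> [:- a, 1:] dvd q" using order_decomp[OF p] by blast
  have "q \<noteq> 0" "poly q a \<noteq> 0" using q p by (auto simp: poly_eq_0_iff_dvd)
  have "ord_at (pt z a) (ev z p) = sd (evh fls_const (loc a) p)"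
    unfolding pt_def using ord_at_vring[OF cfield_rat L ev_in_rat, of p] ev_nonzero[OF z] p S(2) by simp
  also have "evh fls_const (loc a) p = fls_X ^ order a p * evh fls_const (loc a) q"
    by (subst q(1)) (simp only: evh_mult[OF field_hom_fls_const] evh_power[OF field_hom_fls_const]
        evh_linear[OF field_hom_fls_const] add_diff_cancel_left')
  also have "sd \<dots> = int (order a p)"
    using sd_evh_loc(2)[OF \<open>poly q a \<noteq> 0\<close>] evh_nonzero[OF field_hom_fls_const loc_nonconst \<open>q \<noteq> 0\<close>] by simp
  finally show ?thesis .
qed

lemma inverse_ev_mem:
  assumes P: "P \<in> points (rat z)" and "q \<noteq> 0" "\<And>b. poly q b = 0 \<Longrightarrow> inverse (z - const b) \<in> P"
  shows "inverse (ev z q) \<in> P"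
  using assms(2,3)
proof (induction q rule: poly_linear_induct)
  case (const c)
  then show ?case using points_props(3)[OF P, of "inverse c"] by simp
next
  case (linear b q)
  then have "inverse (z - const b) * inverse (ev z q) \<in> P" using points_props(5)[OF P] by simp
  moreover have "ev z ([:- b, 1:] * q) = (z - const b) * ev z q"
    unfolding evh_mult[OF field_hom_const] evh_linear[OF field_hom_const] ..
  ultimately show ?case by (simp only: inverse_mult_distrib)
qed

text \<open>
  Since \<open>z - a\<close> is not a unit of \<open>P\<close>, all other \<open>z - b\<close> are, and so are all polynomials that do not
  vanish at \<open>a\<close>. Hence \<open>P\<close> contains the local ring of \<open>a\<close> and equals it by maximality.
\<close>

lemma pt_unique:
  assumes z: "z \<notin> constants" and P: "P \<in> points (rat z)" and zP: "z \<in> P" "inverse (z - const a) \<notin> P"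
  shows "P = pt z a"
proof -
  note V = points_props[OF P]
  have dich: "f \<in> P \<or> inverse f \<in> P" if "f \<in> rat z" for f using P that by (auto simp: points_def)
  have nz: "z - const b \<noteq> 0" for b using z by auto
  \<comment> \<open>one of the quotients of \<open>z - a\<close> and \<open>z - b\<close> lies in \<open>P\<close>, and their difference is a nonzero
      constant\<close>
  have lin: "inverse (z - const b) \<in> P" if "b \<noteq> a" for b
  proof (rule ccontr)
    assume nb: "inverse (z - const b) \<notin> P"
    have "(z - const a) / (z - const b) \<in> rat z" by (intro cf) auto
    then consider "(z - const a) / (z - const b) \<in> P" | "(z - const b) / (z - const a) \<in> P"
      using dich by fastforce
    then show False
    proof cases
      case 1
      have "inverse (z - const b) = const (inverse (b - a)) * ((z - const a) / (z - const b) - 1)"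
        using that nz[of b] by (simp add: field_simps del: const_inverse)
      then show False using nb V 1 by metis
    next
      case 2
      have "inverse (z - const a) = const (inverse (a - b)) * ((z - const b) / (z - const a) - 1)"
        using that nz[of a] by (simp add: field_simps del: const_inverse)
      then show False using zP(2) V 2 by metis
    qed
  qed
  have inv: "inverse (ev z q) \<in> P" if "poly q a \<noteq> 0" for q
    using inverse_ev_mem[OF P, of q] lin that by (metis poly_0)
  have evP: "ev z p \<in> P" for p by (induction p) (use V zP in auto)
  have "pt z a \<subseteq> P"
  proof
    fix f assume f: "f \<in> pt z a"
    then have fr: "f \<in> rat z" by (simp add: pt_def vring_def)
    obtain p q where pq: "q \<noteq> 0" "f = ev z p / ev z q" and cop: "\<And>a. poly q a = 0 \<Longrightarrow> poly p a \<noteq> 0"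
      by (rule rat_coprime[OF z fr]) blast
    show "f \<in> P"
    proof (cases "poly q a = 0")
      case False
      then have "ev z p * inverse (ev z q) \<in> P" using V(5) evP inv by blast
      then show ?thesis using pq by (simp add: divide_inverse)
    next
      case True
      then have p0: "poly p a \<noteq> 0" using cop by blast
      then have "p \<noteq> 0" by auto
      have "order a q \<noteq> 0" "order a p = 0" using True p0 pq(1) by (auto simp: order_root order_0I)
      have K: "cfield (rat z)" by simp
      note L = laurent_pt[OF z, of a]
      have n: "ev z p \<noteq> 0" "ev z q \<noteq> 0" using ev_nonzero[OF z] pq \<open>p \<noteq> 0\<close> by auto
      have "sd (subst fls_const z (loc a) f) = ord_at (pt z a) f"
        using ord_at_vring[OF K L fr] pq n by (simp add: pt_def)
      also have "\<dots> = ord_at (pt z a) (ev z p) - ord_at (pt z a) (ev z q)"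
      proof -
        have "sd (subst fls_const z (loc a) f) =
          sd (subst fls_const z (loc a) (ev z p)) + sd (subst fls_const z (loc a) (inverse (ev z q)))"
          unfolding pq(2) divide_inverse using n by (intro laurent_more(9)[OF K L]) (auto intro: cf)
        then show ?thesis using laurent_more(8)[OF K L ev_in_rat] ord_at_vring[OF K L fr]
            ord_at_vring[OF K L ev_in_rat] n pq by (simp add: pt_def)
      qed
      also have "\<dots> < 0" using \<open>order a q \<noteq> 0\<close> \<open>order a p = 0\<close> ord_pt_ev[OF z] pq(1) \<open>p \<noteq> 0\<close> by simp
      finally show ?thesis using f by (simp add: pt_def vring_def)
    qed
  qed
  then show ?thesis using vring_maximal[OF cfield_rat laurent_pt[OF z] P] unfolding pt_def by blast
qed

text \<open>
  If \<open>z\<close> lies in \<open>P\<close> but every \<open>z - a\<close> were a unit, \<open>P\<close> would contain all rational functions. If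
  \<open>z\<close> does not lie in \<open>P\<close>, then \<open>1/z\<close> is a non-unit and the same applies to the coordinate \<open>1/z\<close>.
\<close>

lemma points_rat_cases:
  assumes z: "z \<notin> constants" and P: "P \<in> points (rat z)"
  obtains a where "P = pt z a" "z \<in> P" | "P = pt_inf z" "z \<notin> P"
proof (cases "z \<in> P")
  case True
  note V = points_props[OF P]
  have "\<exists>a. inverse (z - const a) \<notin> P"
  proof (rule ccontr)
    assume "\<not> (\<exists>a. inverse (z - const a) \<notin> P)"
    then have lin: "inverse (z - const a) \<in> P" for a by blast
    have inv: "inverse (ev z q) \<in> P" for q
      using inverse_ev_mem[OF P, of q] lin V(2) by (cases "q = 0") auto
    have evP: "ev z p \<in> P" for p by (induction p) (use V True in auto)
    have "rat z \<subseteq> P" using V(5) evP inv by (auto simp: rat_def divide_inverse)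
    then show False using P by (auto simp: points_def)
  qed
  then obtain a where "inverse (z - const a) \<notin> P" by blast
  then show thesis using pt_unique[OF z P True] that(1) True by blast
next
  case False
  have z': "inverse z \<notin> constants" using inverse_nonconst[OF z] .
  have "inverse z \<in> P" using P False by (auto simp: points_def)
  then have "P = pt (inverse z) 0"
    using pt_unique[OF z', of P 0] P False by simp
  then show thesis using that(2) False by (simp add: pt_inf_def)
qed

lemma laur_rat [simp]:
  assumes "z \<notin> constants"
  shows "laurent_field (rat z)"
  unfolding laurent_field_def
proof (intro conjI ballI)
  fix P assume "P \<in> points (rat z)"
  then show "\<exists>e. laurent (rat z) e \<and> P = vring (rat z) e"
  proof (rule points_rat_cases[OF assms])
    fix a assume "P = pt z a"
    then show ?thesis using laurent_pt[OF assms] by (auto simp: pt_def)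
  next
    assume "P = pt_inf z"
    then show ?thesis using laurent_pt[OF inverse_nonconst[OF assms], of 0] by (auto simp: pt_inf_def pt_def)
  qed
qed simp

lemma ord_pt_linear:
  assumes "z \<notin> constants"
  shows "ord_at (pt z a) (z - const b) = (if a = b then 1 else 0)"
proof -
  have "order a [:- b, 1:] = (if a = b then 1 else 0)"
    using order_power_n_n[of b 1] order_0I[of "[:- b, 1:]" a] by auto
  then show ?thesis using ord_pt_ev[OF assms, of "[:- b, 1:]" a] evh_linear[OF field_hom_const, of z b] by auto
qed

lemma ord_pt_inf_linear:
  assumes z: "z \<notin> constants"
  shows "ord_at (pt_inf z) (z - const b) = -1"
proof -
  have nz: "z \<noteq> 0" "z - const b \<noteq> 0" using z const_simps(2) by (metis rangeI, auto)
  note L = laur_rat[OF z] and P = pt_inf_in_points[OF z]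
  have "ord_at (pt_inf z) (inverse z) = 1"
    using ord_pt_linear[OF inverse_nonconst[OF z], of 0 0] by (simp add: pt_inf_def)
  then have 1: "ord_at (pt_inf z) z = -1" using ord_inverse[OF L P _ nz(1)] by simp
  show ?thesis
  proof (cases "b = 0")
    case False
    have "- const b \<noteq> 0" "- const b \<in> rat z" using False by (auto intro: cf)
    moreover have "ord_at (pt_inf z) (- const b) = 0"
      using ord_const[OF L P _ nz(1), of "- b"] False by (simp)
    ultimately show ?thesis using ord_add_eq[OF L P _ nz(1), of "- const b"] 1 by simp
  qed (use 1 in simp)
qed

lemma ord_pt_inf_ev:
  assumes z: "z \<notin> constants" and p: "p \<noteq> 0"
  shows "ord_at (pt_inf z) (ev z p) = - int (degree p)"
  using p
proof (induction p rule: poly_linear_induct)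
  case (const c)
  moreover have "z \<noteq> 0" using z const_simps(2) by (metis rangeI)
  ultimately show ?case
    using ord_const[OF laur_rat[OF z] pt_inf_in_points[OF z] gen_in_rat, of c] by simp
next
  case (linear b q)
  have d: "degree ([:- b, 1:] * q) = Suc (degree q)" using linear(1) by (subst degree_mult_eq) auto
  have e: "ev z ([:- b, 1:] * q) = (z - const b) * ev z q"
    unfolding evh_mult[OF field_hom_const] evh_linear[OF field_hom_const] ..
  have "z - const b \<in> rat z" "z - const b \<noteq> 0" using z by (auto intro: cf_diff)
  then show ?case
    unfolding e d using ord_mult[OF laur_rat[OF z] pt_inf_in_points[OF z]] ev_nonzero[OF z] linear
      ord_pt_inf_linear[OF z] by simp
qed

lemma pt_inject: "z \<notin> constants \<Longrightarrow> pt z a = pt z b \<longleftrightarrow> a = b"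
  using ord_pt_linear[of z a b] ord_pt_linear[of z b b] by (auto split: if_splits)

lemma pt_neq_pt_inf: "z \<notin> constants \<Longrightarrow> pt z a \<noteq> pt_inf z"
  using ord_pt_linear[of z a a] ord_pt_inf_linear[of z a] by auto

text \<open>
  A root of the denominator of a reduced fraction is a pole.
\<close>

lemma regular_imp_polynomial:
  assumes z: "z \<notin> constants" and f: "f \<in> rat z" "f \<noteq> 0" and reg: "\<And>a. ord_at (pt z a) f \<ge> 0"
  obtains p where "f = ev z p" "p \<noteq> 0"
proof -
  obtain p q where pq: "q \<noteq> 0" "f = ev z p / ev z q" and cop: "\<And>a. poly q a = 0 \<Longrightarrow> poly p a \<noteq> 0"
    by (rule rat_coprime[OF z f(1)]) blast
  have p0: "p \<noteq> 0" using pq f by auto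
  have n: "ev z p \<noteq> 0" "ev z q \<noteq> 0" using ev_nonzero[OF z] pq p0 by auto
  have "degree q = 0"
  proof (rule ccontr)
    assume "degree q \<noteq> 0"
    then obtain a where a: "poly q a = 0" using alg_closed_imp_poly_has_root[of q] by auto
    have "ord_at (pt z a) f = int (order a p) - int (order a q)"
      unfolding pq(2) using ord_divide[OF laur_rat[OF z] pt_in_points[OF z] ev_in_rat n(2) ev_in_rat n(1)]
        ord_pt_ev[OF z] p0 pq(1) by simp
    moreover have "order a q \<noteq> 0" "order a p = 0" using a cop[OF a] pq(1) by (auto simp: order_root order_0I)
    ultimately show False using reg[of a] by simp
  qed
  then obtain c where c: "q = [:c:]" "c \<noteq> 0" using pq(1) by (metis degree_eq_zeroE pCons_eq_0_iff)
  then have "f = ev z (smult (inverse c) p)" using pq by (simp add: divide_inverse mult.commute)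
  moreover have "smult (inverse c) p \<noteq> 0" using c p0 by simp
  ultimately show thesis using that by blast
qed

section \<open>Points of a quadratic extension\<close>

text \<open>
  The extension of \<open>d\<close> to \<open>k(b)\<close> that sends \<open>b\<close> to \<open>r\<close>, where \<open>r\<^sup>2\<close> is the image of \<open>b\<^sup>2\<close>.
\<close>

definition ext_hom :: "func set \<Rightarrow> func \<Rightarrow> (func \<Rightarrow> complex fls) \<Rightarrow> complex fls \<Rightarrow> func \<Rightarrow> complex fls"
  where "ext_hom k b d r f = (THE y. \<exists>p\<in>k. \<exists>q\<in>k. f = p + q * b \<and> y = d p + d q * r)"

lemma ext_hom_eq:
  assumes "quad k b" "p \<in> k" "q \<in> k"
  shows "ext_hom k b d r (p + q * b) = d p + d q * r"
  unfolding ext_hom_def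
proof (rule the_equality)
  fix y assume "\<exists>p'\<in>k. \<exists>q'\<in>k. p + q * b = p' + q' * b \<and> y = d p' + d q' * r"
  then show "y = d p + d q * r" using quad_unique[OF assms] by blast
qed (use assms in blast)

text \<open>
  After splitting off an even power of the variable, a unit power series with a square root of its
  constant coefficient has a square root.
\<close>

lemma fls_sqrt:
  assumes "F \<noteq> 0" "even (sd F)"
  obtains R :: "complex fls" where "R\<^sup>2 = F" "2 * sd R = sd F"
proof -
  obtain m where m: "sd F = 2 * m" using assms(2) by blast
  define G where "G = fls_base_factor_to_fps F"
  have G0: "fps_nth G 0 \<noteq> 0" using assms(1) by (simp add: G_def)
  define S where "S = fps_radical (\<lambda>_ x. csqrt x) (Suc 1) G"
  have "S ^ Suc 1 = G" unfolding S_def using power_radical[OF G0, of "\<lambda>_ x. csqrt x" 1] by (simp add: numeral_2_eq_2[symmetric])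
  then have S2: "S\<^sup>2 = G" by (simp add: numeral_2_eq_2)
  define R where "R = fls_shift (- m) (fps_to_fls S)"
  have "R\<^sup>2 = fls_shift (- (2 * m)) (fps_to_fls G)"
    unfolding R_def S2[symmetric] power2_eq_square
    by (simp add: fls_shifted_times_simps fls_times_fps_to_fls)
  also have "\<dots> = F"
    unfolding G_def using m fls_conv_base_factor_to_fps_shift_subdegree[of F] by simp
  finally have R2: "R\<^sup>2 = F" .
  moreover have "2 * sd R = sd F" using R2 by (metis fls_subdegree_pow of_nat_numeral)
  ultimately show thesis using that by blast
qed

text \<open>
  Replacing the variable by its square doubles all orders; this makes the order of an odd radicand
  even.
\<close>

lemma sd_compose_square: "sd (fls_compose_power f 2) = 2 * sd f"
proof (cases "f = 0")
  case False
  show ?thesis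
  proof (rule fls_subdegree_eqI)
    show "fls_nth (fls_compose_power f 2) (2 * sd f) \<noteq> 0"
      using False by (simp add: fls_nth_compose_power)
    show "fls_nth (fls_compose_power f 2) n = 0" if "n < 2 * sd f" for n
      using that by (auto simp: fls_nth_compose_power intro!: fls_eq0_below_subdegree)
  qed
qed simp

lemma laurent_ext_hom:
  assumes q: "quad k b" and d: "\<And>c. d (const c) = fls_const c"
    "\<And>x y. x \<in> k \<Longrightarrow> y \<in> k \<Longrightarrow> d (x + y) = d x + d y \<and> d (x * y) = d x * d y"
    and r: "r\<^sup>2 = d (b\<^sup>2)" and t: "t \<in> adj k b" "sd (ext_hom k b d r t) = 1"
  shows "laurent (adj k b) (ext_hom k b d r)" "f \<in> k \<Longrightarrow> ext_hom k b d r f = d f" "ext_hom k b d r b = r"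
proof -
  have k: "cfield k" and B: "b\<^sup>2 \<in> k" using q by (auto simp: quad_def)
  note E = ext_hom_eq[OF q, of _ _ d r]
  have d01: "d 0 = 0" "d 1 = 1" using d(1)[of 0] d(1)[of 1] by auto
  show base: "ext_hom k b d r f = d f" if "f \<in> k" for f using E[OF that cf_0[OF k]] d01 by simp
  show "ext_hom k b d r b = r" using E[OF cf_0[OF k] cf_1[OF k]] d01 by simp
  have "ext_hom k b d r (f + g) = ext_hom k b d r f + ext_hom k b d r g \<and>
        ext_hom k b d r (f * g) = ext_hom k b d r f * ext_hom k b d r g"
    if fg: "f \<in> adj k b" "g \<in> adj k b" for f g
  proof -
    obtain p s where f: "p \<in> k" "s \<in> k" "f = p + s * b" by (rule adjE[OF fg(1)])
    obtain p' s' where g: "p' \<in> k" "s' \<in> k" "g = p' + s' * b" by (rule adjE[OF fg(2)])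
    have e: "f + g = (p + p') + (s + s') * b" "f * g = (p * p' + s * s' * b\<^sup>2) + (p * s' + s * p') * b"
      using f g by (auto simp: algebra_simps power2_eq_square)
    have i: "p * p' + s * s' * b\<^sup>2 \<in> k" "p * s' + s * p' \<in> k" "p + p' \<in> k" "s + s' \<in> k"
      "p * p' \<in> k" "s * s' * b\<^sup>2 \<in> k" "s * s' \<in> k" "p * s' \<in> k" "s * p' \<in> k"
      using f g k B by (auto intro!: cf_add cf_mult)
    have "ext_hom k b d r (f + g) = d p + d p' + (d s + d s') * r"
      unfolding e(1) using E[OF i(3,4)] d(2) f g by simp
    moreover have "ext_hom k b d r (f * g) = (d p * d p' + d s * d s' * r\<^sup>2) + (d p * d s' + d s * d p') * r"
      unfolding e(2) using E[OF i(1,2)] d(2) f g i B r by simp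
    moreover have "ext_hom k b d r f = d p + d s * r" "ext_hom k b d r g = d p' + d s' * r"
      using E f g by auto
    ultimately show ?thesis by (simp add: algebra_simps power2_eq_square)
  qed
  then show "laurent (adj k b) (ext_hom k b d r)"
    unfolding laurent_def using base d(1) k t by auto
qed

text \<open>
  If the radicand has even order, its image has a square root and the embedding extends as it is
  (\<open>m = 1\<close>). If the order is odd, the variable is first replaced by its square (\<open>m = 2\<close>); then the
  square root has odd order, so a multiple of \<open>b\<close> has order one.
\<close>

lemma laurent_extend:
  assumes q: "quad k b" and e0: "laurent k e0"
  defines "m \<equiv> (if even (sd (e0 (b\<^sup>2))) then 1 else 2)"
  obtains e where "laurent (adj k b) e" "\<And>f. f \<in> k \<Longrightarrow> sd (e f) = m * sd (e0 f)"
proof -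
  have k: "cfield k" and B: "b\<^sup>2 \<in> k" using q by (auto simp: quad_def)
  have b0: "b\<^sup>2 \<noteq> 0" using quad_nonzero[OF q] by simp
  note S = laurent_simps[OF e0] and M = laurent_more[OF k e0]
  obtain t where t: "t \<in> k" "sd (e0 t) = 1" using e0 by (auto simp: laurent_def)
  have F0: "e0 (b\<^sup>2) \<noteq> 0" using M(4)[OF B] b0 by simp
  show thesis
  proof (cases "even (sd (e0 (b\<^sup>2)))")
    case True
    obtain r where r: "r\<^sup>2 = e0 (b\<^sup>2)" using fls_sqrt[OF F0 True] by blast
    have "ext_hom k b e0 r t = e0 t" using ext_hom_eq[OF q t(1) cf_0[OF k], of e0 r] S(2) by simp
    then have "sd (ext_hom k b e0 r t) = 1" using t(2) by simp
    note L = laurent_ext_hom[OF q _ _ r base_in_adj[OF k t(1)] this]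
    have "laurent (adj k b) (ext_hom k b e0 r)" by (rule L(1)) (use S in auto)
    moreover have "ext_hom k b e0 r f = e0 f" if "f \<in> k" for f by (rule L(2)) (use S that in auto)
    ultimately show thesis using that True by (simp add: m_def)
  next
    case False
    define d where "d = (\<lambda>f. fls_compose_power (e0 f) 2)"
    have d: "d (const c) = fls_const c" for c by (simp add: d_def S)
    have d': "d (x + y) = d x + d y \<and> d (x * y) = d x * d y" if "x \<in> k" "y \<in> k" for x y
      using that by (simp add: d_def S)
    have d0: "d 0 = 0" using d[of 0] by simp
    have sdd: "sd (d f) = 2 * sd (e0 f)" for f by (simp add: d_def sd_compose_square)
    have "d (b\<^sup>2) \<noteq> 0"
    proof
      assume "d (b\<^sup>2) = 0"
      then have "sd (e0 (b\<^sup>2)) = 0" using sdd[of "b\<^sup>2"] by simp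
      then show False using False by simp
    qed
    then obtain r where r: "r\<^sup>2 = d (b\<^sup>2)" "2 * sd r = sd (d (b\<^sup>2))"
      using fls_sqrt[of "d (b\<^sup>2)"] sdd by (metis dvd_triv_left)
    have r0: "r \<noteq> 0" using r(1) \<open>d (b\<^sup>2) \<noteq> 0\<close> by auto
    have sr: "sd r = sd (e0 (b\<^sup>2))" using r(2) sdd by simp
    obtain j where j: "sd r = 2 * j + 1" using False sr oddE by metis
    define u where "u = t powi (- j)"
    have u: "u \<in> k" "u * b \<in> adj k b" using t(1) k adjI[of 0 k u b] by (auto simp: u_def cf)
    have su: "sd (e0 u) = - j" using M(10)[OF t(1), of "- j"] t(2) by (simp add: u_def)
    have "t \<noteq> 0" using t S(2) by auto
    then have "e0 u \<noteq> 0" using M(4)[OF u(1)] by (simp add: u_def)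
    have du: "d u \<noteq> 0"
    proof
      assume "d u = 0"
      then have "fls_nth (fls_compose_power (e0 u) 2) (2 * sd (e0 u)) = 0" by (simp add: d_def)
      then show False using \<open>e0 u \<noteq> 0\<close> by (simp add: fls_nth_compose_power)
    qed
    have "ext_hom k b d r (u * b) = d u * r"
      using ext_hom_eq[OF q cf_0[OF k] u(1), of d r] d0 by simp
    then have "sd (ext_hom k b d r (u * b)) = 1" using du r0 sdd[of u] su j by simp
    note L = laurent_ext_hom[OF q d d' r(1) u(2) this]
    show thesis using that[OF L(1)] L(2) sdd False by (simp add: m_def)
  qed
qed

text \<open>
  Automorphisms permute the points; membership in the image is tested by moving the function back.
\<close>

lemma auto_on_point:
  assumes K: "cfield K" and s: "auto_on K s" and P: "P \<in> points K"
  shows "s ` P \<in> points K" "s ` s ` P = P" "f \<in> K \<Longrightarrow> f \<in> s ` P \<longleftrightarrow> s f \<in> P"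
proof -
  have PK: "f \<in> P \<Longrightarrow> f \<in> K" for f using point_mem_K[OF P] .
  note A = auto_on_simps[OF s] and M = auto_on_more[OF K s] and V = points_props[OF P]
  show mem: "f \<in> s ` P \<longleftrightarrow> s f \<in> P" if "f \<in> K" for f
  proof
    assume "s f \<in> P"
    then show "f \<in> s ` P" using A(2)[OF that] by (metis image_eqI)
  qed (use A(2) PK in auto)
  show ss: "s ` s ` P = P" using A(2) PK by (force simp: image_image)
  have sK: "s ` P \<subseteq> K" using A(1) PK by auto
  have "subring (s ` P) Omega"
    unfolding subring_Omega_iff
  proof (intro conjI ballI)
    show "1 \<in> s ` P" using V(1) auto_on_const(3)[OF s] by (metis image_eqI)
  next
    fix x y assume "x \<in> s ` P" "y \<in> s ` P"
    then obtain x' y' where "x = s x'" "y = s y'" "x' \<in> P" "y' \<in> P" by auto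
    then show "x + y \<in> s ` P" "x * y \<in> s ` P"
      using A(3,4)[of x' y'] PK V(4,5) by (metis image_eqI)+
  next
    fix x assume "x \<in> s ` P"
    then show "- x \<in> s ` P" using M(1) PK V(6) by (auto simp flip: M(1))
  qed
  moreover have "constants \<subseteq> s ` P" using V(3) auto_on_const(1)[OF s] by (metis image_eqI image_subsetI)
  moreover have "s ` P \<noteq> K"
  proof
    assume e: "s ` P = K"
    have "K \<subseteq> P"
    proof
      fix f assume "f \<in> K"
      then have "s f \<in> s ` P" using e A(1) by simp
      then show "f \<in> P" using mem[OF A(1)] A(2) \<open>f \<in> K\<close> by simp
    qed
    then show False using P by (auto simp: points_def)
  qed
  moreover have "f \<in> s ` P \<or> inverse f \<in> s ` P" if "f \<in> K" for f
    using mem[OF that] mem[OF cf_inverse[OF K that]] M(3)[OF that] A(1)[OF that] P by (auto simp: points_def)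
  ultimately show "s ` P \<in> points K" using sK unfolding points_def by blast
qed

lemma laurent_auto:
  assumes K: "cfield K" and s: "auto_on K s" and e: "laurent K e"
  shows "laurent K (e \<circ> s)" "s ` vring K e = vring K (e \<circ> s)"
proof -
  note A = auto_on_simps[OF s]
  have V: "vring K e \<in> points K" using vring_in_points[OF K e] .
  show "laurent K (e \<circ> s)"
    unfolding laurent_def
  proof (intro conjI allI ballI)
    obtain t where "t \<in> K" "sd (e t) = 1" using e by (auto simp: laurent_def)
    then show "\<exists>t\<in>K. sd ((e \<circ> s) t) = 1" using A by (intro bexI[of _ "s t"]) auto
  qed (use laurent_simps[OF e] A auto_on_const[OF s] in auto)
  show "s ` vring K e = vring K (e \<circ> s)"
  proof (intro Set.set_eqI)
    fix f show "f \<in> s ` vring K e \<longleftrightarrow> f \<in> vring K (e \<circ> s)"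
      using auto_on_point(3)[OF K s V, of f] A(1)[of f] point_mem_K[OF auto_on_point(1)[OF K s V], of f]
      by (cases "f \<in> K") (auto simp: vring_def)
  qed
qed

lemma ord_at_auto:
  assumes L: "laurent_field K" and s: "auto_on K s" and P: "P \<in> points K" and f: "f \<in> K" "f \<noteq> 0"
  shows "ord_at (s ` P) f = ord_at P (s f)"
proof -
  obtain e where e: "laurent K e" "P = vring K e" using laurE[OF L P] .
  have K: "cfield K" using laur_cfield[OF L] .
  note A = auto_on_simps[OF s] and M = auto_on_more[OF K s] and e' = laurent_auto[OF K s e(1)]
  show ?thesis
    using ord_at_vring[OF K e'(1) f] e'(2) ord_at_vring[OF K e(1) A(1)[OF f(1)]] M(6)[OF f(1)] f(2) e(2) by simp
qed

text \<open>
  The non-units form an ideal: of two elements one divides the other, so a unit sum would make one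
  of them a unit.
\<close>

lemma nonunit_add:
  assumes "cfield K" "P \<in> points K" "x \<in> K" "y \<in> K"
    and x: "x = 0 \<or> inverse x \<notin> P" and y: "y = 0 \<or> inverse y \<notin> P"
  shows "x + y = 0 \<or> inverse (x + y) \<notin> P"
proof (cases "x = 0 \<or> y = 0 \<or> x + y = 0")
  case False
  note V = points_props[OF assms(2)]
  have d: "f \<in> P \<or> inverse f \<in> P" if "f \<in> K" for f using assms(2) that by (auto simp: points_def)
  show ?thesis
  proof (rule ccontr)
    assume "\<not> ?thesis"
    then have i: "inverse (x + y) \<in> P" using False by simp
    have "x / y \<in> K" using assms by (auto intro: cf)
    then consider "x / y \<in> P" | "y / x \<in> P" using d[of "x / y"] by auto
    then show False
    proof cases
      case 1
      have "inverse y = (x / y + 1) * inverse (x + y)" using False by (simp add: field_simps)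
      then show False using y False i 1 V by metis
    next
      case 2
      have "inverse x = (1 + y / x) * inverse (x + y)" using False by (simp add: field_simps)
      then show False using x False i 2 V by metis
    qed
  qed
qed (use x y in auto)

lemma nonunit_add_const:
  assumes "cfield K" "P \<in> points K" "x \<in> K" and x: "x = 0 \<or> inverse x \<notin> P" and c: "c \<noteq> 0"
  shows "x + const c \<noteq> 0 \<and> inverse (x + const c) \<in> P"
proof (rule ccontr)
  assume "\<not> ?thesis"
  then have n: "x + const c = 0 \<or> inverse (x + const c) \<notin> P" by blast
  have m: "- x = 0 \<or> inverse (- x) \<notin> P"
    using x points_props(6)[OF assms(2), of "inverse (- x)"] by auto
  have "x + const c + (- x) = 0 \<or> inverse (x + const c + (- x)) \<notin> P"
    by (rule nonunit_add[OF assms(1,2) _ _ n m]) (use assms in \<open>auto intro: cf\<close>)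
  then show False using c points_props(3)[OF assms(2), of "inverse c"] by simp
qed

lemma quad_sq_mem:
  assumes "cfield M" "Q \<in> points M" "b \<in> M" "b\<^sup>2 \<in> Q"
  shows "b \<in> Q"
proof (rule ccontr)
  assume n: "b \<notin> Q"
  then have "inverse b \<in> Q" using assms by (auto simp: points_def)
  then have "b\<^sup>2 * inverse b \<in> Q" using assms points_props(5) by blast
  moreover have "b \<noteq> 0" using n points_props(2)[OF assms(2)] by auto
  moreover from this have "b\<^sup>2 * inverse b = b" by (simp add: power2_eq_square mult.assoc)
  ultimately show False using n by simp
qed

text \<open>
  The restriction cannot be all of \<open>k\<close>: the point would contain \<open>b\<^sup>2\<close>, hence \<open>b\<close>, hence everything.
\<close>

lemma quad_restrict_point:
  assumes q: "quad k b" and Q: "Q \<in> points (adj k b)"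
  shows "Q \<inter> k \<in> points k"
proof -
  have k: "cfield k" using q by (simp add: quad_def)
  note V = points_props[OF Q] and M = quad_cfield_adj[OF q]
  have "\<not> k \<subseteq> Q"
  proof
    assume s: "k \<subseteq> Q"
    then have "b \<in> Q" using quad_sq_mem[OF M Q gen_in_adj[OF k]] q by (auto simp: quad_def)
    then have "p + r * b \<in> Q" if "p \<in> k" "r \<in> k" for p r using s V(4,5) that by blast
    then have "adj k b \<subseteq> Q" by (auto simp: adj_def)
    then show False using Q by (auto simp: points_def)
  qed
  moreover have "subring (Q \<inter> k) Omega"
    using V k by (auto simp: subring_Omega_iff intro: cf)
  moreover have "f \<in> Q \<or> inverse f \<in> Q" if "f \<in> k" for f
    using Q base_in_adj[OF k that, of b] by (auto simp: points_def)
  moreover have "constants \<subseteq> Q \<inter> k" using V(3) k by auto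
  ultimately show ?thesis using cf_inverse[OF k] unfolding points_def by auto
qed

lemma scale_to_order:
  assumes L: "laurent k e0" and q: "quad k b"
  obtains l where "l \<in> k" "l \<noteq> 0" "sd (e0 ((l * b)\<^sup>2)) = (if even (sd (e0 (b\<^sup>2))) then 0 else 1)"
proof -
  have k: "cfield k" and B: "b\<^sup>2 \<in> k" using q by (auto simp: quad_def)
  obtain t where t: "t \<in> k" "sd (e0 t) = 1" using L by (auto simp: laurent_def)
  have t0: "t \<noteq> 0" using t laurent_simps(2)[OF L] by auto
  define j where "j = sd (e0 (b\<^sup>2)) div 2"
  have j: "sd (e0 (b\<^sup>2)) = 2 * j + (if even (sd (e0 (b\<^sup>2))) then 0 else 1)"
    using div_mult_mod_eq[of "sd (e0 (b\<^sup>2))" 2] unfolding j_def mod2_eq_if by (simp add: mult.commute)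
  define l where "l = t powi (- j)"
  have l: "l \<in> k" "l \<noteq> 0" "sd (e0 l) = - j"
    using t t0 k laurent_more(10)[OF k L t(1), of "- j"] by (auto simp: l_def cf)
  have "sd (e0 (l\<^sup>2 * b\<^sup>2)) = sd (e0 (l\<^sup>2)) + sd (e0 (b\<^sup>2))"
    using laurent_more(9)[OF k L, of "l\<^sup>2" "b\<^sup>2"] l B k quad_nonzero[OF q] by (auto intro: cf)
  also have "sd (e0 (l\<^sup>2)) = - 2 * j" using laurent_more(11)[OF k L l(1), of 2] l(3) by simp
  finally have "sd (e0 ((l * b)\<^sup>2)) = (if even (sd (e0 (b\<^sup>2))) then 0 else 1)"
    using j by (simp add: power_mult_distrib)
  then show thesis using that l by blast
qed

text \<open>
  Odd case: for a generator \<open>c\<close> of value one, the summands of \<open>x + y c\<close> have values of different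
  parity. There is no cancellation, so a combination is integral only if both coefficients are, and
  every point above contains \<open>c\<close>.
\<close>

lemma fibre_odd:
  assumes q: "quad k b" and e: "laurent (adj k b) e" and e0: "laurent k e0"
    and ee: "\<And>f. f \<in> k \<Longrightarrow> sd (e f) = 2 * sd (e0 f)" and odd: "odd (sd (e0 (b\<^sup>2)))"
    and Q: "Q \<in> points (adj k b)" "Q \<inter> k = vring k e0"
  shows "Q = vring (adj k b) e"
proof -
  obtain l where l: "l \<in> k" "l \<noteq> 0" "sd (e0 ((l * b)\<^sup>2)) = 1" using scale_to_order[OF e0 q] odd by auto
  define c where "c = l * b"
  have qc: "quad k c" and M: "adj k c = adj k b" using adj_scale[OF q l(1,2)] by (auto simp: c_def)
  have k: "cfield k" and C: "c\<^sup>2 \<in> k" using qc by (auto simp: quad_def)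
  have KM: "cfield (adj k b)" using quad_cfield_adj[OF q] .
  have cM: "c \<in> adj k b" using gen_in_adj[OF k, of c] M by simp
  have c0: "c \<noteq> 0" using quad_nonzero[OF qc] .
  have "c\<^sup>2 \<in> vring k e0" using C l(3) by (simp add: vring_def c_def)
  then have cQ: "c \<in> Q" using quad_sq_mem[OF KM Q(1) cM] Q(2) by blast
  have "2 * sd (e c) = 2" using laurent_more(11)[OF KM e cM, of 2] ee[OF C] l(3) by (simp add: c_def)
  then have sc: "sd (e c) = 1" by simp
  note Vm = points_props[OF Q(1)]
  have "vring (adj k b) e \<subseteq> Q"
  proof
    fix f assume f: "f \<in> vring (adj k b) e"
    then have "f \<in> adj k c" "sd (e f) \<ge> 0" using M by (auto simp: vring_def)
    then obtain x y where xy: "x \<in> k" "y \<in> k" "f = x + y * c" using adjE by metis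
    have xM: "x \<in> adj k b" "y \<in> adj k b" using base_in_adj[OF k] xy by auto
    have yM: "y * c \<in> adj k b" using cf_mult[OF KM xM(2) cM] .
    have ef: "e f = e x + e (y * c)" using laurent_simps(4)[OF e xM(1) yM] xy by simp
    show "f \<in> Q"
    proof (cases "y = 0")
      case True
      then have "f \<in> vring k e0" using \<open>sd (e f) \<ge> 0\<close> ee[OF xy(1)] xy by (simp add: vring_def)
      then show ?thesis using Q by auto
    next
      case False
      have sy: "sd (e (y * c)) = 2 * sd (e0 y) + 1"
        using laurent_more(9)[OF KM e xM(2) False cM c0] ee[OF xy(2)] sc by simp
      have "sd (e0 x) \<ge> 0 \<and> sd (e0 y) \<ge> 0"
      proof (cases "x = 0")
        case True
        then show ?thesis using ef sy \<open>sd (e f) \<ge> 0\<close> xy laurent_simps(2)[OF e0] laurent_simps(2)[OF e] by simp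
      next
        case x0: False
        have n: "e x \<noteq> 0" "e (y * c) \<noteq> 0" using laurent_more(4)[OF KM e] xM yM x0 False c0 by auto
        have "sd (e x) \<noteq> sd (e (y * c))" using ee[OF xy(1)] sy by presburger
        then consider "sd (e x) < sd (e (y * c))" "sd (e f) = sd (e x)" | "sd (e (y * c)) < sd (e x)" "sd (e f) = sd (e (y * c))"
          unfolding ef using fls_subdegree_add_eq1[OF n(1)] fls_subdegree_add_eq2[OF n(2)] by (metis linorder_neqE)
        then show ?thesis using \<open>sd (e f) \<ge> 0\<close> ee[OF xy(1)] sy by cases auto
      qed
      then have "x \<in> Q" "y \<in> Q" using Q(2) xy by (auto simp: vring_def)
      then show ?thesis using xy cQ Vm by simp
    qed
  qed
  then show ?thesis using vring_maximal[OF KM e Q(1)] by blast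
qed

text \<open>
  Even case: the radicand is a nonzero constant modulo the maximal ideal, so \<open>b\<close> is congruent to
  one of the two square roots \<open>c\<close> of that constant, and the choice of the root determines the
  point. An integral \<open>x + y b\<close> with integral \<open>y\<close> is no problem. Otherwise it is \<open>y (h + b)\<close> with
  \<open>h\<close> congruent to \<open>-c\<close>, and multiplying by \<open>h - b\<close>, a unit congruent to \<open>-2 c\<close>, moves it into \<open>k\<close>.
\<close>

lemma fibre_even_aux:
  assumes q: "quad k b" and e: "laurent (adj k b) e" and e0: "laurent k e0"
    and ee: "\<And>f. f \<in> k \<Longrightarrow> sd (e f) = sd (e0 f)"
    and c: "c \<noteq> 0" "sd (e (b - const c)) > 0"
    and Q: "Q \<in> points (adj k b)" "Q \<inter> k = vring k e0" and n: "inverse (b - const c) \<notin> Q"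
    and B: "sd (e0 (b\<^sup>2)) = 0"
  shows "Q = vring (adj k b) e"
proof -
  have k: "cfield k" and b: "b\<^sup>2 \<in> k" using q by (auto simp: quad_def)
  have KM: "cfield (adj k b)" using quad_cfield_adj[OF q] .
  have bM: "b \<in> adj k b" using gen_in_adj[OF k] .
  note Vm = points_props[OF Q(1)]
  have "b\<^sup>2 \<in> vring k e0" using b B by (simp add: vring_def)
  then have bQ: "b \<in> Q" using quad_sq_mem[OF KM Q(1) bM] Q(2) by blast
  have "2 * sd (e b) = 0" using laurent_more(11)[OF KM e bM, of 2] ee[OF b] B by simp
  then have sb: "sd (e b) = 0" by simp
  have "vring (adj k b) e \<subseteq> Q"
  proof
    fix f assume f: "f \<in> vring (adj k b) e"
    then have fM: "f \<in> adj k b" and root_prod: "sd (e f) \<ge> 0" by (auto simp: vring_def)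
    obtain x y where xy: "x \<in> k" "y \<in> k" "f = x + y * b" by (rule adjE[OF fM])
    have xM: "x \<in> adj k b" "y \<in> adj k b" using base_in_adj[OF k] xy by auto
    note cfM = cf_add[OF KM] cf_diff[OF KM] cf_mult[OF KM] cf_inverse[OF KM] cf_const[OF KM] cf_power[OF KM]
    have PQ: "g \<in> Q \<longleftrightarrow> sd (e g) \<ge> 0" if "g \<in> k" for g using Q(2) ee that by (auto simp: vring_def)
    show "f \<in> Q"
    proof (cases "sd (e y) \<ge> 0")
      case True
      have "e x = e f - e (y * b)" using laurent_more(2)[OF KM e fM, of "y * b"] xy xM bM cfM by simp
      moreover have "sd (e (y * b)) \<ge> 0"
        using laurent_simps(5)[OF e xM(2) bM] True sb fls_subdegree_mult_ge0[of "e y" "e b"] by simp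
      ultimately have "sd (e x) \<ge> 0" using fls_subdegree_add_ge0[OF root_prod, of "- e (y * b)"] by simp
      then show ?thesis using PQ xy True bQ Vm by simp
    next
      case False
      then have y0: "y \<noteq> 0" using laurent_simps(2)[OF e] by auto
      define h where "h = x / y"
      have h: "h \<in> k" "h \<in> adj k b" using xy k base_in_adj[OF k] by (auto simp: h_def cf)
      define g where "g = h + b"
      have gM: "g \<in> adj k b" using h bM cfM by (simp add: g_def)
      have "y * g = x + y * b" using y0 by (simp add: g_def h_def distrib_left)
      then have fg: "f = y * g" using xy by simp
      have sg: "sd (e g) > 0 \<or> g = 0"
      proof (cases "g = 0")
        case False
        then show ?thesis using laurent_more(9)[OF KM e xM(2) y0 gM False] fg root_prod \<open>\<not> 0 \<le> sd (e y)\<close> by simp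
      qed simp
      have sg0: "sd (e g) \<ge> 0" using sg laurent_simps(2)[OF e] by auto
      have hb: "e h = e g + - e b" using laurent_more(2)[OF KM e gM bM] by (simp add: g_def)
      have sh: "sd (e h) \<ge> 0" unfolding hb using sg0 sb by (intro fls_subdegree_add_ge0) auto
      have hc: "h + const c = g - (b - const c)" by (simp add: g_def)
      have hck: "h + const c \<in> k" using h k by (auto intro: cf)
      have "h + const c = 0 \<or> sd (e (h + const c)) > 0"
      proof (cases "h + const c = 0")
        case nz: False
        have bc: "b - const c \<in> adj k b" using bM cfM by simp
        have eq: "e (h + const c) = e g + - e (b - const c)" unfolding hc using laurent_more(2)[OF KM e gM bc] by simp
        have "e (h + const c) \<noteq> 0" using laurent_more(4)[OF KM e, of "h + const c"] nz base_in_adj[OF k hck] by simp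
        show ?thesis
        proof (cases "g = 0")
          case True
          then show ?thesis using eq c(2) laurent_simps(2)[OF e] by simp
        next
          case False
          then have "1 \<le> sd (e g)" "1 \<le> sd (- e (b - const c))" using sg c(2) by auto
          then show ?thesis using fls_subdegree_add_ge[of "e g" "- e (b - const c)" 1] eq \<open>e (h + const c) \<noteq> 0\<close> by simp
        qed
      qed simp
      moreover have "inverse (h + const c) \<in> Q \<longleftrightarrow> sd (e (h + const c)) \<le> 0"
        using PQ[OF cf_inverse[OF k hck]] laurent_more(8)[OF KM e base_in_adj[OF k hck]] by simp
      ultimately have n1: "h + const c = 0 \<or> inverse (h + const c) \<notin> Q" by auto
      have n2: "- (b - const c) = 0 \<or> inverse (- (b - const c)) \<notin> Q"
        using n Vm(6)[of "inverse (- (b - const c))"] by (metis inverse_minus_eq minus_minus)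
      have "h + const c + (- (b - const c)) = 0 \<or> inverse (h + const c + (- (b - const c))) \<notin> Q"
        by (rule nonunit_add[OF KM Q(1) _ _ n1 n2]) (use h bM KM in \<open>auto intro: cf\<close>)
      from nonunit_add_const[OF KM Q(1) _ this, of "- 2 * c"]
      have hbQ: "h - b \<noteq> 0 \<and> inverse (h - b) \<in> Q" using c(1) h bM KM by (simp add: cf algebra_simps)
      define w where "w = y * (h\<^sup>2 - b\<^sup>2)"
      have wk: "w \<in> k" using xy h b k by (auto simp: w_def intro!: cf_mult cf_diff cf_power)
      have hmM: "h - b \<in> adj k b" using h bM cfM by simp
      have wf: "w = f * (h - b)" by (simp add: w_def fg g_def power2_eq_square algebra_simps)
      have "e (h - b) = e h + - e b" using laurent_more(2)[OF KM e h(2) bM] by simp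
      then have "sd (e (h - b)) \<ge> 0" using fls_subdegree_add_ge0[of "e h" "- e b"] sh sb by simp
      then have "sd (e w) \<ge> 0"
        unfolding wf using laurent_simps(5)[OF e fM hmM] fls_subdegree_mult_ge0[OF root_prod, of "e (h - b)"] by simp
      then have "w * inverse (h - b) \<in> Q" using PQ[OF wk] hbQ Vm(5) by blast
      moreover have "w * inverse (h - b) = f" using hbQ unfolding wf by (simp add: mult.assoc)
      ultimately show ?thesis by simp
    qed
  qed
  then show ?thesis using vring_maximal[OF KM e Q(1)] by blast
qed

text \<open>
  The complete description of the points of \<open>k(b)\<close> above a point of \<open>k\<close>: a single one of
  ramification index two if the radicand has odd order, otherwise two conjugate ones of index one.
\<close>

lemma quad_points:
  assumes L: "laurent_field k" and q: "quad k b"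
  defines "M \<equiv> adj k b" and "s \<equiv> conj k b"
  shows quad_laur: "laurent_field M"
    and quad_point_above: "P \<in> points k \<Longrightarrow> \<exists>Q\<in>points M. Q \<inter> k = P"
    and quad_fibre: "Q \<in> points M \<Longrightarrow> Q' \<in> points M \<Longrightarrow> Q' \<inter> k = Q \<inter> k \<Longrightarrow> Q' = Q \<or> Q' = s ` Q"
    and quad_ord: "Q \<in> points M \<Longrightarrow> f \<in> k \<Longrightarrow> f \<noteq> 0 \<Longrightarrow>
        ord_at Q f = (if s ` Q = Q then 2 else 1) * ord_at (Q \<inter> k) f"
    and quad_ramified: "Q \<in> points M \<Longrightarrow> s ` Q = Q \<longleftrightarrow> odd (ord_at (Q \<inter> k) (b\<^sup>2))"
    and quad_conj_restrict: "Q \<in> points M \<Longrightarrow> s ` Q \<inter> k = Q \<inter> k"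
proof -
  have k: "cfield k" and B: "b\<^sup>2 \<in> k" using q by (auto simp: quad_def)
  have KM: "cfield M" using quad_cfield_adj[OF q] by (simp add: M_def)
  have A: "auto_on M s" using auto_on_conj[OF q] by (simp add: M_def s_def)
  have kM: "f \<in> M" if "f \<in> k" for f using base_in_adj[OF k that] by (simp add: M_def)
  have b0: "b\<^sup>2 \<noteq> 0" using quad_nonzero[OF q] by simp
  have restr: "s ` Q \<inter> k = Q \<inter> k" if Q: "Q \<in> points M" for Q
  proof (intro Set.set_eqI)
    fix f show "f \<in> s ` Q \<inter> k \<longleftrightarrow> f \<in> Q \<inter> k"
      using auto_on_point(3)[OF KM A Q kM] conj_base[OF q] by (auto simp: s_def)
  qed
  then show "Q \<in> points M \<Longrightarrow> s ` Q \<inter> k = Q \<inter> k" .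
  \<comment> \<open>each claim concerns the fibre over one point \<open>P\<close>, which is described by one extended
      embedding\<close>
  have main: "\<exists>e. laurent M e \<and> vring M e \<inter> k = P \<and>
      (\<forall>Q\<in>points M. Q \<inter> k = P \<longrightarrow> Q = vring M e \<or> Q = s ` vring M e) \<and>
      (s ` vring M e = vring M e \<longleftrightarrow> odd (ord_at P (b\<^sup>2))) \<and>
      (\<forall>f\<in>k. f \<noteq> 0 \<longrightarrow> sd (e f) = (if s ` vring M e = vring M e then 2 else 1) * ord_at P f)"
    if P: "P \<in> points k" for P
  proof -
    obtain e0 where e0: "laurent k e0" "P = vring k e0" using laurE[OF L P] .
    note O = ord_at_vring[OF k e0(1), folded e0(2)]
    define m :: int where "m = (if even (sd (e0 (b\<^sup>2))) then 1 else 2)"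
    obtain e where e: "laurent M e" "\<And>f. f \<in> k \<Longrightarrow> sd (e f) = m * sd (e0 f)"
      using laurent_extend[OF q e0(1)] unfolding M_def m_def by blast
    have VP: "vring M e \<in> points M" using vring_in_points[OF KM e(1)] .
    have m0: "m > 0" by (simp add: m_def)
    have over: "vring M e \<inter> k = P"
      unfolding e0(2) vring_def using e(2) kM m0 by (auto simp: zero_le_mult_iff)
    have "(\<forall>Q\<in>points M. Q \<inter> k = P \<longrightarrow> Q = vring M e \<or> Q = s ` vring M e) \<and>
      (s ` vring M e = vring M e \<longleftrightarrow> odd (ord_at P (b\<^sup>2)))"
    proof (cases "even (sd (e0 (b\<^sup>2)))")
      case False
      then have "\<And>f. f \<in> k \<Longrightarrow> sd (e f) = 2 * sd (e0 f)" using e(2) by (simp add: m_def)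
      note F = fibre_odd[OF q e(1)[unfolded M_def] e0(1) this False, folded M_def e0(2)]
      have "s ` vring M e = vring M e"
        using F[OF _ auto_on_point(1)[OF KM A VP]] restr[OF VP] over by simp
      then show ?thesis using F False O[OF B b0] by auto
    next
      case True
      then have ee: "\<And>f. f \<in> k \<Longrightarrow> sd (e f) = sd (e0 f)" using e(2) by (simp add: m_def)
      obtain l where l: "l \<in> k" "l \<noteq> 0" "sd (e0 ((l * b)\<^sup>2)) = 0"
        using scale_to_order[OF e0(1) q] True by auto
      define d where "d = l * b"
      have qd: "quad k d" and Md: "adj k d = M" using adj_scale[OF q l(1,2)] by (auto simp: d_def M_def)
      have sd: "conj k d f = s f" if "f \<in> M" for f
        using adj_scale(3)[OF q l(1,2), of f] that by (simp add: d_def M_def s_def)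
      have D: "d\<^sup>2 \<in> k" "d \<notin> k" using qd by (auto simp: quad_def)
      have dM: "d \<in> M" using gen_in_adj[OF k, of d] Md by simp
      have d2: "sd (e0 (d\<^sup>2)) = 0" using l(3) by (simp add: d_def)
      have "2 * sd (e d) = 0" using laurent_more(11)[OF KM e(1) dM, of 2] ee[OF D(1)] d2 by simp
      then have sed: "sd (e d) = 0" by simp
      then obtain c where "d = const c \<or> sd (e (d - const c)) > 0"
        using laurent_residue[OF KM e(1) dM] by auto
      then have c: "sd (e (d - const c)) > 0" using D(2) k by auto
      have c0: "c \<noteq> 0" using c sed by auto
      have dc: "d - const c \<in> M" "d + const c \<in> M" "d - const c \<noteq> 0" "d + const c \<noteq> 0"
      proof -
        show "d - const c \<in> M" "d + const c \<in> M" using dM KM by (auto intro: cf)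
        show "d - const c \<noteq> 0" using D(2) k by auto
        show "d + const c \<noteq> 0"
        proof
          assume "d + const c = 0"
          then have "d = const (- c)" by (simp add: eq_neg_iff_add_eq_0)
          then show False using D(2) cf_const[OF k] by metis
        qed
      qed
      have s1: "s (inverse (d + const c)) = - inverse (d - const c)"
        "s (inverse (d - const c)) = - inverse (d + const c)"
      proof -
        have sdm: "s d = - d" using conj_gen[OF qd] sd[OF dM] by simp
        have "s (d + const c) = - (d - const c)" "s (d - const c) = - (d + const c)"
          using auto_on_simps(3)[OF A dM, of "const c"] auto_on_more(2)[OF KM A dM, of "const c"] sdm
            auto_on_const(1)[OF A] KM by auto
        then show "s (inverse (d + const c)) = - inverse (d - const c)"
          "s (inverse (d - const c)) = - inverse (d + const c)"
          using auto_on_more(3)[OF KM A dc(1)] auto_on_more(3)[OF KM A dc(2)] by (simp_all only: inverse_minus_eq)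
      qed
      note F = fibre_even_aux[OF qd _ e0(1) ee c0 c, unfolded Md, OF e(1), folded e0(2)]
      have neg: "- f \<in> Q \<longleftrightarrow> f \<in> Q" if "Q \<in> points M" for f Q
        using points_props(6)[OF that, of f] points_props(6)[OF that, of "- f"] by auto
      \<comment> \<open>\<open>d - c\<close> and \<open>d + c\<close> have a non-unit as product, so one of them is a non-unit at \<open>Q\<close>; \<open>s\<close>
          exchanges the cases\<close>
      have one: "Q = vring M e \<or> Q = s ` vring M e" if Q: "Q \<in> points M" "Q \<inter> k = P" for Q
      proof (cases "inverse (d - const c) \<in> Q")
        case False
        then show ?thesis using F[OF _ Q False] d2 by simp
      next
        case True
        have "inverse (d + const c) \<notin> Q"
        proof
          assume "inverse (d + const c) \<in> Q"
          then have "inverse (d - const c) * inverse (d + const c) \<in> Q"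
            using points_props(5)[OF Q(1) True] by blast
          moreover have "inverse (d - const c) * inverse (d + const c) = inverse (d\<^sup>2 - (const c)\<^sup>2)"
            by (simp add: power2_eq_square algebra_simps flip: inverse_mult_distrib)
          moreover have dk: "d\<^sup>2 - (const c)\<^sup>2 \<in> k" using D(1) k by (auto intro: cf)
          ultimately have "inverse (d\<^sup>2 - (const c)\<^sup>2) \<in> P" using Q(2) k by (auto intro: cf)
          then have "sd (e0 (d\<^sup>2 - (const c)\<^sup>2)) \<le> 0"
            unfolding e0(2) vring_def using laurent_more(8)[OF k e0(1) dk] by simp
          moreover have "sd (e (d\<^sup>2 - (const c)\<^sup>2)) = sd (e (d - const c)) + sd (e (d + const c))"
            using laurent_more(9)[OF KM e(1) dc(1,3,2,4)] by (simp add: power2_eq_square algebra_simps)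
          moreover have "sd (e (d + const c)) \<ge> 0"
            using laurent_simps(1,4)[OF e(1)] dM KM sed fls_subdegree_add_ge0[of "e d" "fls_const c"] by simp
          ultimately show False using ee[OF dk] c by simp
        qed
        then have "inverse (d - const c) \<notin> s ` Q"
          using auto_on_point(3)[OF KM A Q(1) cf_inverse[OF KM dc(1)]] s1(2) neg[OF Q(1)] by simp
        then have "s ` Q = vring M e"
          using F[OF _ auto_on_point(1)[OF KM A Q(1)]] restr[OF Q(1)] Q(2) d2 by simp
        then show ?thesis using auto_on_point(2)[OF KM A Q(1)] by metis
      qed
      \<comment> \<open>otherwise \<open>d - c\<close> and \<open>d + c\<close> are both non-units, and so is their difference \<open>2 c\<close>\<close>
      have "s ` vring M e \<noteq> vring M e"
      proof
        assume a: "s ` vring M e = vring M e"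
        have n1: "inverse (d - const c) \<notin> vring M e"
          unfolding vring_def using laurent_more(8)[OF KM e(1) dc(1)] c by simp
        then have n2: "inverse (d + const c) \<notin> vring M e"
          using auto_on_point(3)[OF KM A VP cf_inverse[OF KM dc(2)]] s1(1) neg[OF VP] a by simp
        have "inverse (- (d - const c)) \<notin> vring M e" using n1 neg[OF VP] by (simp only: inverse_minus_eq) simp
        then have "d + const c + (- (d - const c)) = 0 \<or> inverse (d + const c + (- (d - const c))) \<notin> vring M e"
          using nonunit_add[OF KM VP dc(2) cf_uminus[OF KM dc(1)]] n2 by blast
        moreover have "d + const c + (- (d - const c)) = const (2 * c)" by simp
        ultimately show False
          using points_props(3)[OF VP, of "inverse (2 * c)"] c0 by (metis const_inverse const_simps(7) mult_eq_0_iff zero_neq_numeral)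
      qed
      then show ?thesis using one True O[OF B b0] by simp
    qed
    moreover from this have "sd (e f) = (if s ` vring M e = vring M e then 2 else 1) * ord_at P f" if "f \<in> k" "f \<noteq> 0" for f
      using e(2)[OF that(1)] O[OF that] O[OF B b0] by (auto simp: m_def)
    ultimately show ?thesis using e(1) over by blast
  qed
  show "\<exists>Q\<in>points M. Q \<inter> k = P" if "P \<in> points k"
    using main[OF that] vring_in_points[OF KM] by blast
  have sinv: "s ` s ` Q = Q" if "Q \<in> points M" for Q using auto_on_point(2)[OF KM A that] .
  have gen: "\<exists>e. laurent M e \<and> (Q = vring M e \<or> Q = s ` vring M e) \<and> vring M e \<in> points M"
    if "Q \<in> points M" for Q
    using main[OF quad_restrict_point[OF q that[unfolded M_def]]] that vring_in_points[OF KM] by (metis (no_types, lifting))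
  show LM: "laurent_field M"
    unfolding laurent_field_def
  proof (intro conjI ballI KM)
    fix Q assume Q: "Q \<in> points M"
    obtain e where e: "laurent M e" "Q = vring M e \<or> Q = s ` vring M e" "vring M e \<in> points M"
      using gen[OF Q] by blast
    then show "\<exists>e. laurent M e \<and> Q = vring M e" using laurent_auto[OF KM A] by metis
  qed
  show "Q' = Q \<or> Q' = s ` Q" if Q: "Q \<in> points M" "Q' \<in> points M" "Q' \<inter> k = Q \<inter> k"
  proof -
    obtain e where "Q = vring M e \<or> Q = s ` vring M e" "Q' = vring M e \<or> Q' = s ` vring M e" "vring M e \<in> points M"
      using main[OF quad_restrict_point[OF q Q(1)[unfolded M_def]]] Q vring_in_points[OF KM] by (metis (no_types, lifting))
    then show ?thesis using sinv by metis
  qed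
  have both: "(s ` Q = Q \<longleftrightarrow> odd (ord_at (Q \<inter> k) (b\<^sup>2))) \<and>
    (\<forall>f\<in>k. f \<noteq> 0 \<longrightarrow> ord_at Q f = (if s ` Q = Q then 2 else 1) * ord_at (Q \<inter> k) f)"
    if Q: "Q \<in> points M" for Q
  proof -
    obtain e where e: "laurent M e" "Q = vring M e \<or> Q = s ` vring M e"
      "s ` vring M e = vring M e \<longleftrightarrow> odd (ord_at (Q \<inter> k) (b\<^sup>2))"
      "\<And>f. f \<in> k \<Longrightarrow> f \<noteq> 0 \<Longrightarrow> sd (e f) = (if s ` vring M e = vring M e then 2 else 1) * ord_at (Q \<inter> k) f"
      using main[OF quad_restrict_point[OF q Q[unfolded M_def]]] Q by (metis (no_types, lifting))
    have VP: "vring M e \<in> points M" using vring_in_points[OF KM e(1)] .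
    have i: "s ` Q = Q \<longleftrightarrow> s ` vring M e = vring M e" using e(2) sinv[OF VP] by metis
    have "ord_at Q f = sd (e f)" if "f \<in> k" "f \<noteq> 0" for f
    proof -
      have "ord_at (vring M e) f = sd (e f)" using ord_at_vring[OF KM e(1) kM] that by simp
      moreover have "ord_at (s ` vring M e) f = ord_at (vring M e) f"
        using ord_at_auto[OF LM A VP kM] that conj_base[OF q] by (simp add: s_def)
      ultimately show ?thesis using e(2) by auto
    qed
    then show ?thesis using e(3,4) i by simp
  qed
  show "Q \<in> points M \<Longrightarrow> f \<in> k \<Longrightarrow> f \<noteq> 0 \<Longrightarrow>
        ord_at Q f = (if s ` Q = Q then 2 else 1) * ord_at (Q \<inter> k) f" using both by blast
  show "Q \<in> points M \<Longrightarrow> s ` Q = Q \<longleftrightarrow> odd (ord_at (Q \<inter> k) (b\<^sup>2))" using both by blast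
qed

section \<open>Torsion classes of divisors and their behaviour in quadratic extensions\<close>

text \<open>
  Some positive multiple of \<open>D\<close> is principal; only the values of \<open>D\<close> on the points of \<open>M\<close> count.
\<close>

definition tors :: "func set \<Rightarrow> (func set \<Rightarrow> int) \<Rightarrow> bool"
  where "tors M D \<longleftrightarrow> (\<exists>n>0. \<exists>f\<in>M. f \<noteq> 0 \<and> (\<forall>P\<in>points M. int n * D P = ord_at P f))"

abbreviation pdiff :: "func set \<Rightarrow> func set \<Rightarrow> func set \<Rightarrow> int"
  where "pdiff P Q \<equiv> \<lambda>R. point_div P R - point_div Q R"

lemma torsion_difference_iff_tors:
  assumes "P \<in> points K" "Q \<in> points K"
  shows "torsion_difference K P Q \<longleftrightarrow> tors K (pdiff P Q)"
proof -
  have "divisor K (\<lambda>R. int n * (point_div P R - point_div Q R))" for n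
  proof -
    have "{R. int n * (point_div P R - point_div Q R) \<noteq> 0} \<subseteq> {P, Q}"
      by (auto simp: point_div_def)
    then show ?thesis using assms unfolding divisor_def by (meson finite.intros finite_subset insert_subset empty_subsetI order_trans)
  qed
  then show ?thesis unfolding torsion_difference_def principal_def tors_def by auto
qed

lemma tors_cong: "(\<And>P. P \<in> points M \<Longrightarrow> D P = D' P) \<Longrightarrow> tors M D \<longleftrightarrow> tors M D'"
  by (simp add: tors_def)

lemma tors_add:
  assumes L: "laurent_field M" and "tors M D" "tors M D'"
  shows "tors M (\<lambda>P. D P + D' P)"
proof -
  have K: "cfield M" using L laur_cfield by blast
  obtain n f where f: "n > 0" "f \<in> M" "f \<noteq> 0" "\<And>P. P \<in> points M \<Longrightarrow> int n * D P = ord_at P f"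
    using assms(2) unfolding tors_def by blast
  obtain m g where g: "m > 0" "g \<in> M" "g \<noteq> 0" "\<And>P. P \<in> points M \<Longrightarrow> int m * D' P = ord_at P g"
    using assms(3) unfolding tors_def by blast
  have "ord_at P (f ^ m * g ^ n) = int (n * m) * (D P + D' P)" if P: "P \<in> points M" for P
  proof -
    have "ord_at P (f ^ m * g ^ n) = int m * ord_at P f + int n * ord_at P g"
      using ord_mult[OF L P cf_power[OF K f(2)]] ord_power[OF L P f(2,3)] ord_power[OF L P g(2,3)] f g K
      by (simp add: cf_power)
    then show ?thesis using f(4)[OF P] g(4)[OF P] by (simp add: algebra_simps)
  qed
  moreover have "f ^ m * g ^ n \<in> M" "f ^ m * g ^ n \<noteq> 0" "n * m > 0" using f g K by (auto simp: cf)
  ultimately show ?thesis unfolding tors_def by metis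
qed

lemma tors_uminus:
  assumes L: "laurent_field M" and "tors M D"
  shows "tors M (\<lambda>P. - D P)"
proof -
  have K: "cfield M" using L laur_cfield by blast
  obtain n f where f: "n > 0" "f \<in> M" "f \<noteq> 0" "\<And>P. P \<in> points M \<Longrightarrow> int n * D P = ord_at P f"
    using assms(2) unfolding tors_def by blast
  then have "inverse f \<in> M" "inverse f \<noteq> 0" "\<And>P. P \<in> points M \<Longrightarrow> int n * - D P = ord_at P (inverse f)"
    using ord_inverse[OF L] K by (auto intro: cf)
  then show ?thesis unfolding tors_def using f(1) by blast
qed

lemma tors_div:
  assumes "tors M (\<lambda>P. int c * D P)" "c > 0"
  shows "tors M D"
proof -
  obtain n f where f: "n > 0" "f \<in> M" "f \<noteq> 0" "\<And>P. P \<in> points M \<Longrightarrow> int n * (int c * D P) = ord_at P f"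
    using assms(1) unfolding tors_def by blast
  then have "n * c > 0" "\<And>P. P \<in> points M \<Longrightarrow> int (n * c) * D P = ord_at P f" using assms(2) by (auto simp: mult.assoc)
  then show ?thesis unfolding tors_def using f by blast
qed

lemma tors_auto:
  assumes L: "laurent_field M" and s: "auto_on M s" and "tors M D"
  shows "tors M (\<lambda>P. D (s ` P))"
proof -
  have K: "cfield M" using L laur_cfield by blast
  obtain n f where f: "n > 0" "f \<in> M" "f \<noteq> 0" "\<And>P. P \<in> points M \<Longrightarrow> int n * D P = ord_at P f"
    using assms(3) unfolding tors_def by blast
  have "s f \<in> M" "s f \<noteq> 0" using auto_on_simps(1)[OF s f(2)] auto_on_more(6)[OF K s f(2)] f(3) by auto
  moreover have "int n * D (s ` P) = ord_at P (s f)" if "P \<in> points M" for P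
    using f(4)[OF auto_on_point(1)[OF K s that]] ord_at_auto[OF L s that f(2,3)] by simp
  ultimately show ?thesis unfolding tors_def using f(1) by blast
qed

lemma tors_refl: "laurent_field M \<Longrightarrow> tors M (\<lambda>P. 0)"
  unfolding tors_def
proof (intro exI[of _ 1] conjI bexI[of _ 1] ballI)
  assume L: "laurent_field M"
  show "1 \<in> M" using laur_cfield[OF L] by (auto intro: cf)
  show "int 1 * 0 = ord_at P 1" if "P \<in> points M" for P
    using ord_const[OF L that cf_1[OF laur_cfield[OF L]] one_neq_zero, of 1] by simp
qed auto

lemma torsion_difference_equiv:
  assumes L: "laurent_field M"
  shows "P \<in> points M \<Longrightarrow> torsion_difference M P P"
    and "P \<in> points M \<Longrightarrow> Q \<in> points M \<Longrightarrow> torsion_difference M P Q \<Longrightarrow> torsion_difference M Q P"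
    and "P \<in> points M \<Longrightarrow> Q \<in> points M \<Longrightarrow> R \<in> points M \<Longrightarrow>
      torsion_difference M P Q \<Longrightarrow> torsion_difference M Q R \<Longrightarrow> torsion_difference M P R"
proof -
  show "P \<in> points M \<Longrightarrow> torsion_difference M P P"
    using tors_refl[OF L] by (simp add: torsion_difference_iff_tors)
  show "P \<in> points M \<Longrightarrow> Q \<in> points M \<Longrightarrow> torsion_difference M P Q \<Longrightarrow> torsion_difference M Q P"
    using tors_uminus[OF L, of "pdiff P Q"] by (simp add: torsion_difference_iff_tors)
  show "P \<in> points M \<Longrightarrow> Q \<in> points M \<Longrightarrow> R \<in> points M \<Longrightarrow>
      torsion_difference M P Q \<Longrightarrow> torsion_difference M Q R \<Longrightarrow> torsion_difference M P R"
    using tors_add[OF L, of "pdiff P Q" "pdiff Q R"] by (simp add: torsion_difference_iff_tors)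
qed

lemma point_div_auto:
  assumes "cfield M" "auto_on M s" "P \<in> points M" "R \<in> points M"
  shows "point_div P (s ` R) = point_div (s ` P) R"
proof -
  have "s ` R = P \<longleftrightarrow> R = s ` P" using auto_on_point(2)[OF assms(1,2)] assms(3,4) by metis
  then show ?thesis by (simp add: point_div_def)
qed

text \<open>The pullback of a point along a quadratic extension is the sum of the two conjugate points
  above it, counted with multiplicity.\<close>

lemma fibre_count:
  assumes "laurent_field k" "quad k b" "Q \<in> points (adj k b)" "R \<in> points (adj k b)"
  shows "(if conj k b ` R = R then 2 else 1) * point_div (Q \<inter> k) (R \<inter> k) =
    point_div Q R + point_div (conj k b ` Q) R"
proof (cases "R \<inter> k = Q \<inter> k")
  case True
  have "conj k b ` conj k b ` Q = Q"
    using auto_on_point(2)[OF quad_cfield_adj[OF assms(2)] auto_on_conj[OF assms(2)] assms(3)] .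
  then have "R = Q \<or> R = conj k b ` Q" "conj k b ` R = R \<longleftrightarrow> conj k b ` Q = Q"
    using quad_fibre[OF assms True] by metis+
  then show ?thesis using True by (auto simp: point_div_def)
next
  case False
  then have "R \<noteq> Q" "R \<noteq> conj k b ` Q" using quad_conj_restrict[OF assms(1-3)] by auto
  then show ?thesis using False by (auto simp: point_div_def)
qed

text \<open>
  A function on the base has the pulled back divisor on the extension. Conversely, the norm of a
  function \<open>h\<close> with divisor a multiple of the conjugation-invariant divisor on the right has twice
  that divisor and lives on the base.
\<close>

lemma quad_torsion_iff:
  assumes L: "laurent_field k" and q: "quad k b" and Q: "Q \<in> points (adj k b)" "Q0 \<in> points (adj k b)"
  defines "s \<equiv> conj k b"
  shows "torsion_difference k (Q \<inter> k) (Q0 \<inter> k) \<longleftrightarrow>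
    tors (adj k b) (\<lambda>R. pdiff Q Q0 R + pdiff (s ` Q) (s ` Q0) R)"
proof -
  define M where "M = adj k b"
  have k: "cfield k" using L laur_cfield by blast
  have LM: "laurent_field M" using quad_laur[OF L q] by (simp add: M_def)
  have KM: "cfield M" using LM laur_cfield by blast
  have A: "auto_on M s" using auto_on_conj[OF q] by (simp add: M_def s_def)
  define e where "e R = (if s ` R = R then 2 else 1 :: int)" for R
  have e0: "e R \<noteq> 0" for R by (simp add: e_def)
  define P P0 where "P = Q \<inter> k" and "P0 = Q0 \<inter> k"
  have Pk: "P \<in> points k" "P0 \<in> points k"
    using quad_restrict_point[OF q] Q by (auto simp: P_def P0_def)
  define D where "D R = pdiff Q Q0 R + pdiff (s ` Q) (s ` Q0) R" for R
  have count: "D R = e R * pdiff P P0 (R \<inter> k)" if "R \<in> points M" for R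
    using fibre_count[OF L q Q(1), of R] fibre_count[OF L q Q(2), of R] that
    unfolding D_def e_def P_def P0_def s_def M_def by (simp add: algebra_simps)
  have ordk: "ord_at R f = e R * ord_at (R \<inter> k) f" if "R \<in> points M" "f \<in> k" "f \<noteq> 0" for R f
    using quad_ord[OF L q] that by (simp add: e_def s_def M_def)
  have "tors k (pdiff P P0) \<longleftrightarrow> tors M D"
  proof
    assume "tors k (pdiff P P0)"
    then obtain n f where f: "n > 0" "f \<in> k" "f \<noteq> 0" "\<And>R. R \<in> points k \<Longrightarrow> int n * pdiff P P0 R = ord_at R f"
      unfolding tors_def by blast
    have "int n * D R = ord_at R f" if R: "R \<in> points M" for R
    proof -
      have "R \<inter> k \<in> points k" using quad_restrict_point[OF q] R by (simp add: M_def)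
      then have "e R * (int n * pdiff P P0 (R \<inter> k)) = ord_at R f" using f(4) ordk[OF R f(2,3)] by simp
      then show ?thesis using count[OF R] by (simp add: mult.left_commute)
    qed
    moreover have "f \<in> M" using base_in_adj[OF k f(2)] by (simp add: M_def)
    ultimately show "tors M D" unfolding tors_def using f(1,3) by blast
  next
    assume "tors M D"
    then obtain n h where h: "n > 0" "h \<in> M" "h \<noteq> 0" "\<And>R. R \<in> points M \<Longrightarrow> int n * D R = ord_at R h"
      unfolding tors_def by blast
    define f where "f = h * s h"
    have sh: "s h \<in> M" "s h \<noteq> 0" using auto_on_simps(1)[OF A h(2)] auto_on_more(6)[OF KM A h(2)] h(3) by auto
    have f: "f \<in> k" "f \<noteq> 0" using conj_norm[OF q, of h] h sh by (auto simp: f_def s_def M_def)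
    have "int (2 * n) * pdiff P P0 R = ord_at R f" if R: "R \<in> points k" for R
    proof -
      obtain R' where R': "R' \<in> points M" "R' \<inter> k = R"
        using quad_point_above[OF L q R] by (auto simp: M_def)
      have sR: "s ` R' \<in> points M" using auto_on_point(1)[OF KM A R'(1)] .
      have "D (s ` R') = D R'"
        using count[OF sR] count[OF R'(1)] quad_conj_restrict[OF L q, of R'] R'(1) auto_on_point(2)[OF KM A R'(1)]
        by (auto simp: s_def M_def e_def)
      then have "ord_at R' f = int (2 * n) * D R'"
        using ord_mult[OF LM R'(1) h(2,3) sh] h(4)[OF R'(1)] h(4)[OF sR] ord_at_auto[OF LM A R'(1) h(2,3)]
        by (simp add: f_def)
      then have "e R' * ord_at R f = e R' * (int (2 * n) * pdiff P P0 R)"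
        using count[OF R'(1)] ordk[OF R'(1) f] R'(2) by (simp add: mult.assoc mult.left_commute)
      then show ?thesis using e0[of R'] mult_left_cancel by metis
    qed
    then show "tors k (pdiff P P0)" unfolding tors_def using f h(1) by (metis nat_0_less_mult_iff zero_less_numeral)
  qed
  then show ?thesis
    using torsion_difference_iff_tors[OF Pk] unfolding P_def P0_def D_def M_def by simp
qed

section \<open>Biquadratic extensions\<close>

text \<open>
  The extension \<open>M = k(a, b)\<close> with its three quadratic subfields and the automorphisms fixing them.
\<close>

locale biquad =
  fixes k :: "func set" and a b :: func
  assumes laur_k: "laurent_field k" and qa: "quad k a" and qab: "quad (adj k a) b" and b2: "b\<^sup>2 \<in> k"
begin

definition "M = adj (adj k a) b"
definition "K1 = adj k a"
definition "K2 = adj k b"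
definition "K3 = adj k (a * b)"

lemma cf_k: "cfield k" using laur_k laur_cfield by blast
lemma cf_K1: "cfield K1" using quad_cfield_adj[OF qa] by (simp add: K1_def)
lemma cf_M: "cfield M" using quad_cfield_adj[OF qab] by (simp add: M_def)

lemma b_notin: "b \<notin> K1" using qab by (simp add: quad_def K1_def)
lemma k_K1: "x \<in> k \<Longrightarrow> x \<in> K1" using base_in_adj[OF cf_k] by (simp add: K1_def)
lemma K1_M: "x \<in> K1 \<Longrightarrow> x \<in> M" using base_in_adj[of K1 x b] cf_K1 by (simp add: M_def K1_def)
lemma a_K1: "a \<in> K1" using gen_in_adj[OF cf_k] by (simp add: K1_def)
lemma b_M: "b \<in> M" using gen_in_adj[OF cf_K1] by (simp add: M_def K1_def)

lemma qb: "quad k b"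
  using cf_k b2 b_notin k_K1 by (auto simp: quad_def)

lemma qc: "quad k (a * b)"
proof -
  have "(a * b) / a \<in> K1" if "a * b \<in> k" using cf_divide[OF cf_K1 k_K1[OF that] a_K1] .
  then have "a * b \<notin> k" using b_notin quad_nonzero[OF qa] by auto
  then show ?thesis using cf_k b2 qa by (auto simp: quad_def power_mult_distrib intro: cf)
qed

lemma cf_K2: "cfield K2" using quad_cfield_adj[OF qb] by (simp add: K2_def)
lemma cf_K3: "cfield K3" using quad_cfield_adj[OF qc] by (simp add: K3_def)
lemma k_K2: "x \<in> k \<Longrightarrow> x \<in> K2" using base_in_adj[OF cf_k] by (simp add: K2_def)
lemma k_K3: "x \<in> k \<Longrightarrow> x \<in> K3" using base_in_adj[OF cf_k] by (simp add: K3_def)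

lemma a2: "a\<^sup>2 \<in> k" using qa by (simp add: quad_def)

lemma qba: "quad K2 a"
proof -
  have "a \<notin> K2"
  proof
    assume "a \<in> K2"
    then obtain p q where pq: "p \<in> k" "q \<in> k" "a = p + q * b" by (auto simp: K2_def elim: adjE)
    have "q \<noteq> 0" using pq qa by (auto simp: quad_def)
    then have "b = (a - p) / q" using pq by simp
    then show False using b_notin cf_diff[OF cf_K1 a_K1 k_K1[OF pq(1)]] cf_divide[OF cf_K1 _ k_K1[OF pq(2)]] by metis
  qed
  then show ?thesis using cf_K2 a2 k_K2 by (simp add: quad_def)
qed

lemma qca: "quad K3 a"
proof -
  have "a \<notin> K3"
  proof
    assume "a \<in> K3"
    then obtain p q where pq: "p \<in> k" "q \<in> k" "a = p + q * (a * b)" by (auto simp: K3_def elim: adjE)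
    have "q \<noteq> 0" using pq qa by (auto simp: quad_def)
    moreover have "a \<noteq> 0" using quad_nonzero[OF qa] .
    ultimately have "b = (a - p) / (q * a)" using pq(3) by (simp add: eq_divide_eq algebra_simps)
    moreover have "q * a \<in> K1" "a - p \<in> K1" using pq k_K1 a_K1 cf_K1 by (auto intro: cf)
    ultimately show False using b_notin cf_divide[OF cf_K1, of "a - p" "q * a"] by simp
  qed
  then show ?thesis using cf_K3 a2 k_K3 by (simp add: quad_def)
qed

lemma M_eq2: "M = adj K2 a"
proof
  have c: "cfield (adj K2 a)" using quad_cfield_adj[OF qba] .
  have i: "x \<in> adj K2 a" if "x \<in> K2" for x using base_in_adj[OF cf_K2 that] .
  have "adj k a \<subseteq> adj K2 a" using adj_least[OF c] i k_K2 gen_in_adj[OF cf_K2] by blast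
  then show "M \<subseteq> adj K2 a"
    unfolding M_def using adj_least[OF c] i gen_in_adj[OF cf_k, of b] by (simp add: K2_def)
  have "K2 \<subseteq> M" unfolding K2_def using adj_least[OF cf_M _ b_M] k_K1 K1_M by blast
  then show "adj K2 a \<subseteq> M" using adj_least[OF cf_M] K1_M a_K1 by blast
qed

lemma M_eq3: "M = adj K3 a"
proof
  have c: "cfield (adj K3 a)" using quad_cfield_adj[OF qca] .
  have i: "x \<in> adj K3 a" if "x \<in> K3" for x using base_in_adj[OF cf_K3 that] .
  have a: "a \<in> adj K3 a" using gen_in_adj[OF cf_K3] .
  have "a * b \<in> adj K3 a" using i gen_in_adj[OF cf_k, of "a * b"] by (simp add: K3_def)
  then have "(a * b) / a \<in> adj K3 a" using a c by (intro cf_divide)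
  then have b: "b \<in> adj K3 a" using quad_nonzero[OF qa] by simp
  have "adj k a \<subseteq> adj K3 a" using adj_least[OF c] i k_K3 a by blast
  then show "M \<subseteq> adj K3 a" unfolding M_def using adj_least[OF c] b by simp
  have "a * b \<in> M" using cf_mult[OF cf_M] K1_M a_K1 b_M by blast
  then have "K3 \<subseteq> M" unfolding K3_def using adj_least[OF cf_M] k_K1 K1_M by blast
  then show "adj K3 a \<subseteq> M" using adj_least[OF cf_M] K1_M a_K1 by blast
qed

definition "s1 = conj K1 b"
definition "s2 = conj K2 a"
definition "s3 = conj K3 a"

lemma laur_K1: "laurent_field K1" using quad_laur[OF laur_k qa] by (simp add: K1_def)
lemma laur_K2: "laurent_field K2" using quad_laur[OF laur_k qb] by (simp add: K2_def)
lemma laur_K3: "laurent_field K3" using quad_laur[OF laur_k qc] by (simp add: K3_def)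
lemma laur_M: "laurent_field M" using quad_laur[OF laur_K1] qab by (simp add: K1_def M_def)

lemma q1: "quad K1 b" using qab by (simp add: K1_def)
lemma M_eq1: "M = adj K1 b" by (simp add: K1_def M_def)

lemma auto1: "auto_on M s1" using auto_on_conj[OF q1] by (simp add: s1_def M_eq1)
lemma auto2: "auto_on M s2" using auto_on_conj[OF qba] by (simp add: s2_def M_eq2)
lemma auto3: "auto_on M s3" using auto_on_conj[OF qca] by (simp add: s3_def M_eq3)

text \<open>
  Both sides fix \<open>a b\<close> and change the signs of \<open>a\<close> and \<open>b\<close>.
\<close>

lemma s3_eq:
  assumes "f \<in> M"
  shows "s3 f = s1 (s2 f)"
proof -
  obtain x y where xy: "x \<in> K1" "y \<in> K1" "f = x + y * b" using assms unfolding M_eq1 by (rule adjE)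
  obtain p q where x: "p \<in> k" "q \<in> k" "x = p + q * a" using xy(1) unfolding K1_def by (rule adjE)
  obtain r t where y: "r \<in> k" "t \<in> k" "y = r + t * a" using xy(2) unfolding K1_def by (rule adjE)
  note ad = adjI[of _ k _ a, folded K1_def] adjI[of _ k _ b, folded K2_def] adjI[of _ k _ "a * b", folded K3_def]
  have a0: "a \<noteq> 0" using quad_nonzero[OF qa] .
  have m: "- q \<in> k" "- t \<in> k" "- r \<in> k" "r / a\<^sup>2 \<in> k" using x y a2 cf_k by (auto intro: cf)
  have "f = (p + r * b) + (q + t * b) * a" using xy x y by (simp add: algebra_simps)
  then have "s2 f = (p + r * b) - (q + t * b) * a"
    unfolding s2_def using conj_eq[OF qba ad(2)[OF x(1) y(1)] ad(2)[OF x(2) y(2)]] by simp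
  then have "s2 f = (p + (- q) * a) + (r + (- t) * a) * b" by (simp add: algebra_simps)
  then have 1: "s1 (s2 f) = (p + (- q) * a) - (r + (- t) * a) * b"
    unfolding s1_def using conj_eq[OF q1 ad(1)[OF x(1) m(1)] ad(1)[OF y(1) m(2)]] by simp
  have ra: "r / a\<^sup>2 * (a * b) * a = r * b" using a0 by (simp add: power2_eq_square)
  have "f = (p + t * (a * b)) + (q + r / a\<^sup>2 * (a * b)) * a"
    unfolding distrib_right[of q] ra using xy x y by (simp add: algebra_simps)
  then have "s3 f = (p + t * (a * b)) - (q + r / a\<^sup>2 * (a * b)) * a"
    unfolding s3_def using conj_eq[OF qca ad(3)[OF x(1) y(2)] ad(3)[OF x(2) m(4)]] by simp
  also have "\<dots> = (p + (- q) * a) - (r + (- t) * a) * b"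
    unfolding distrib_right[of q] ra by (simp add: algebra_simps)
  finally show ?thesis using 1 by simp
qed

lemma s3_points: "Q \<in> points M \<Longrightarrow> s3 ` Q = s1 ` s2 ` Q"
  using s3_eq point_mem_K by (force simp: image_image)

lemma M_point: "Q \<in> points M \<Longrightarrow> Q \<inter> K1 \<in> points K1" "Q \<in> points M \<Longrightarrow> Q \<inter> K2 \<in> points K2"
  "Q \<in> points M \<Longrightarrow> Q \<inter> K3 \<in> points K3"
  using quad_restrict_point[OF q1] quad_restrict_point[OF qba] quad_restrict_point[OF qca]
    M_eq1 M_eq2 M_eq3 by auto

text \<open>
  By \<open>quad_torsion_iff\<close> the three conditions say that \<open>(1 + s1) D\<close>, \<open>(1 + s2) D\<close> and \<open>(1 + s3) D\<close>
  are torsion for the divisor \<open>D = Q - Q0\<close>. Since \<open>s3 = s1 s2\<close>, the group ring identity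
  \<open>(1 + s1) + (1 + s2) - s1 (1 + s3) = 2\<close> recovers \<open>2 D\<close>.
\<close>

theorem torsion_iff:
  assumes Q: "Q \<in> points M" "Q0 \<in> points M"
  shows "torsion_difference M Q Q0 \<longleftrightarrow> torsion_difference K1 (Q \<inter> K1) (Q0 \<inter> K1) \<and>
    torsion_difference K2 (Q \<inter> K2) (Q0 \<inter> K2) \<and> torsion_difference K3 (Q \<inter> K3) (Q0 \<inter> K3)"
proof -
  define D where "D = pdiff Q Q0"
  define E where "E s = pdiff (s ` Q) (s ` Q0)" for s :: "func \<Rightarrow> func"
  have E: "E s R = D (s ` R)" if "auto_on M s" "R \<in> points M" for s R
    using point_div_auto[OF cf_M that(1) _ that(2)] Q by (simp add: E_def D_def)
  have t0: "torsion_difference M Q Q0 \<longleftrightarrow> tors M D"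
    using torsion_difference_iff_tors[OF Q] by (simp add: D_def)
  have t1: "torsion_difference K1 (Q \<inter> K1) (Q0 \<inter> K1) \<longleftrightarrow> tors M (\<lambda>R. D R + E s1 R)"
    using quad_torsion_iff[OF laur_K1 q1, of Q Q0] Q by (simp add: D_def E_def s1_def M_eq1)
  have t2: "torsion_difference K2 (Q \<inter> K2) (Q0 \<inter> K2) \<longleftrightarrow> tors M (\<lambda>R. D R + E s2 R)"
    using quad_torsion_iff[OF laur_K2 qba, of Q Q0] Q by (simp add: D_def E_def s2_def M_eq2)
  have t3: "torsion_difference K3 (Q \<inter> K3) (Q0 \<inter> K3) \<longleftrightarrow> tors M (\<lambda>R. D R + E s3 R)"
    using quad_torsion_iff[OF laur_K3 qca, of Q Q0] Q by (simp add: D_def E_def s3_def M_eq3)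
  have "tors M (\<lambda>R. D R + E s R)" if "tors M D" "auto_on M s" for s
  proof -
    have "tors M (\<lambda>R. D R + D (s ` R))"
      using tors_add[OF laur_M that(1) tors_auto[OF laur_M that(2,1)]] .
    then show ?thesis using tors_cong[of M "\<lambda>R. D R + D (s ` R)" "\<lambda>R. D R + E s R"] E[OF that(2)] by simp
  qed
  moreover have "tors M D"
    if h: "tors M (\<lambda>R. D R + E s1 R)" "tors M (\<lambda>R. D R + E s2 R)" "tors M (\<lambda>R. D R + E s3 R)"
  proof -
    have "tors M (\<lambda>R. D (s1 ` R) + E s3 (s1 ` R))" using tors_auto[OF laur_M auto1 h(3)] .
    moreover have "D (s1 ` R) + E s3 (s1 ` R) = E s1 R + E s2 R" if R: "R \<in> points M" for R
    proof -
      have R1: "s1 ` R \<in> points M" using auto_on_point(1)[OF cf_M auto1 R] .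
      have "E s3 (s1 ` R) = pdiff (s1 ` s2 ` Q) (s1 ` s2 ` Q0) (s1 ` R)"
        using s3_points Q by (simp add: E_def)
      also have "\<dots> = pdiff (s1 ` s1 ` s2 ` Q) (s1 ` s1 ` s2 ` Q0) R"
        using point_div_auto[OF cf_M auto1 _ R] auto_on_point(1)[OF cf_M] auto1 auto2 Q by simp
      also have "\<dots> = E s2 R"
        using auto_on_point(2)[OF cf_M auto1] auto_on_point(1)[OF cf_M auto2] Q by (simp add: E_def)
      finally show ?thesis using E[OF auto1 R] by simp
    qed
    ultimately have m: "tors M (\<lambda>R. E s1 R + E s2 R)"
      using tors_cong[of M "\<lambda>R. D (s1 ` R) + E s3 (s1 ` R)" "\<lambda>R. E s1 R + E s2 R"] by simp
    have "tors M (\<lambda>R. (D R + E s1 R) + (D R + E s2 R) + - (E s1 R + E s2 R))"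
      by (intro tors_add[OF laur_M] tors_uminus[OF laur_M] h(1,2) m)
    then have "tors M (\<lambda>R. int 2 * D R)" by (simp add: algebra_simps)
    then show ?thesis by (rule tors_div) simp
  qed
  ultimately show ?thesis using t0 t1 t2 t3 auto1 auto2 auto3 by blast
qed

end

text \<open>
  For a finite point the function \<open>z - a\<close> does it, even without passing to a multiple.
\<close>

lemma point_div_rat_tors:
  assumes z: "z \<notin> constants" and P: "P \<in> points (rat z)"
  shows "tors (rat z) (pdiff P (pt_inf z))"
proof (rule points_rat_cases[OF z P])
  fix a assume Pa: "P = pt z a" "z \<in> P"
  have nz: "z - const a \<in> rat z" "z - const a \<noteq> 0" using z by (auto intro: cf)
  have inf: "z \<notin> pt_inf z"
  proof -
    have "z \<noteq> 0" using nz z const_simps(2) by (metis rangeI)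
    then show ?thesis
      using ord_mem[OF laur_rat[OF z] pt_inf_in_points[OF z] gen_in_rat] ord_pt_inf_linear[OF z, of 0] by simp
  qed
  have ptmem: "z \<in> pt z b" for b
  proof -
    have "z \<noteq> 0" using nz z const_simps(2) by (metis rangeI)
    then show ?thesis
      using ord_mem[OF laur_rat[OF z] pt_in_points[OF z] gen_in_rat] ord_pt_linear[OF z, of b 0] by simp
  qed
  have "int 1 * pdiff P (pt_inf z) R = ord_at R (z - const a)" if R: "R \<in> points (rat z)" for R
  proof (rule points_rat_cases[OF z R])
    fix b assume "R = pt z b" "z \<in> R"
    then show ?thesis using pt_inject[OF z] inf Pa by (auto simp: point_div_def ord_pt_linear[OF z])
  next
    assume "R = pt_inf z" "z \<notin> R"
    then show ?thesis using Pa by (auto simp: point_div_def ord_pt_inf_linear[OF z])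
  qed
  then show ?thesis unfolding tors_def using nz by blast
next
  assume "P = pt_inf z"
  then show ?thesis using tors_refl[OF laur_rat[OF z]] by simp
qed

lemma rational_torsion:
  assumes z: "z \<notin> constants" and P: "P \<in> points (rat z)" "Q \<in> points (rat z)"
  shows "torsion_difference (rat z) P Q"
  using tors_add[OF laur_rat[OF z] point_div_rat_tors[OF z P(1)]
    tors_uminus[OF laur_rat[OF z] point_div_rat_tors[OF z P(2)]]] P
  by (simp add: torsion_difference_iff_tors)

section \<open>Riemann-Roch spaces\<close>

abbreviation hd_const :: "func set \<Rightarrow> nat \<Rightarrow> bool"
  where "hd_const \<equiv> has_dim_over constants"

lemma has_dim_line:
  assumes "hd_const V n" "v \<notin> V"
  shows "hd_const {const c * v + w | c w. w \<in> V} (Suc n)"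
proof -
  have "Om.dimension (Suc n) constants (Om.line_extension constants v V)"
    using assms by (intro Om.Suc_dim) (auto simp: has_dim_over_def)
  moreover have "Om.line_extension constants v V = {const c * v + w | c w. w \<in> V}"
    unfolding line_extension_Omega by auto
  ultimately show ?thesis by (simp add: has_dim_over_def)
qed

lemma has_dim_zero: "hd_const {0} 0"
  using Om.zero_dim[of constants] by (simp add: has_dim_over_def)

lemma subfield_constants: "subfield constants Omega"
  using cfield_constants cfield_iff by blast

lemma has_dim_unique: "hd_const V n \<Longrightarrow> hd_const V m \<Longrightarrow> n = m"
  unfolding has_dim_over_def using Om.dimension_is_inj[OF subfield_constants] by blast

lemma has_dim_image:
  assumes "hd_const V n" "h \<noteq> 0"
  shows "hd_const ((\<lambda>f. h * f) ` V) n"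
proof -
  have "Om.dimension n constants V" using assms by (simp add: has_dim_over_def)
  then have "Om.dimension n constants ((\<lambda>f. h * f) ` V)"
  proof (induction rule: Om.dimension.induct)
    case (zero_dim k)
    then show ?case using Om.zero_dim[of k] by simp
  next
    case (Suc_dim v E n k)
    have "h * v \<notin> (\<lambda>f. h * f) ` E" using Suc_dim(2) assms(2) by auto
    then have "Om.dimension (Suc n) k (Om.line_extension k (h * v) ((\<lambda>f. h * f) ` E))"
      using Suc_dim by (intro Om.Suc_dim) auto
    moreover have "Om.line_extension k (h * v) ((\<lambda>f. h * f) ` E) = (\<lambda>f. h * f) ` Om.line_extension k v E"
    proof
      show "(\<lambda>f. h * f) ` Om.line_extension k v E \<subseteq> Om.line_extension k (h * v) ((\<lambda>f. h * f) ` E)"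
      proof clarify
        fix f assume "f \<in> Om.line_extension k v E"
        then obtain c w where "c \<in> k" "w \<in> E" "f = c * v + w" unfolding line_extension_Omega by blast
        moreover from this have "h * f = c * (h * v) + h * w" by (simp add: algebra_simps)
        ultimately show "h * f \<in> Om.line_extension k (h * v) ((\<lambda>f. h * f) ` E)"
          unfolding line_extension_Omega by blast
      qed
      show "Om.line_extension k (h * v) ((\<lambda>f. h * f) ` E) \<subseteq> (\<lambda>f. h * f) ` Om.line_extension k v E"
      proof
        fix f assume "f \<in> Om.line_extension k (h * v) ((\<lambda>f. h * f) ` E)"
        then obtain c w where cw: "c \<in> k" "w \<in> E" "f = c * (h * v) + h * w" unfolding line_extension_Omega by blast
        then have "f = h * (c * v + w)" by (simp add: algebra_simps)
        moreover have "c * v + w \<in> Om.line_extension k v E" using cw unfolding line_extension_Omega by blast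
        ultimately show "f \<in> (\<lambda>f. h * f) ` Om.line_extension k v E" by blast
      qed
    qed
    ultimately show ?case by simp
  qed
  then show ?thesis by (simp add: has_dim_over_def)
qed

text \<open>
  Allowing one more pole at \<open>P\<close> adds at most one dimension: two functions with the maximal pole
  differ, up to a constant factor, by a function in the smaller space.
\<close>

lemma RR_add_point:
  assumes L: "laurent_field K" and P: "P \<in> points K" and d: "hd_const (riemann_roch_space K D) l"
  obtains l' where "l' \<le> l + 1" "hd_const (riemann_roch_space K (\<lambda>R. D R + point_div P R)) l'"
proof -
  define V W where "V = riemann_roch_space K D" and "W = riemann_roch_space K (\<lambda>R. D R + point_div P R)"
  have K: "cfield K" using L laur_cfield by blast
  have sub: "V \<subseteq> W" unfolding V_def W_def riemann_roch_space_def point_div_def by force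
  show thesis
  proof (cases "W = V")
    case True
    then show ?thesis using that[of l] d unfolding V_def W_def by simp
  next
    case False
    then obtain v where v: "v \<in> W" "v \<notin> V" using sub by blast
    then have vK: "v \<in> K" "v \<noteq> 0" by (auto simp: V_def W_def riemann_roch_space_def)
    have vo: "ord_at R v \<ge> - D R - point_div P R" if "R \<in> points K" for R
      using v(1) vK that by (auto simp: W_def riemann_roch_space_def)
    have vP: "ord_at P v = - D P - 1"
    proof -
      obtain R where R: "R \<in> points K" "\<not> ord_at R v \<ge> - D R"
        using v(2) vK by (auto simp: V_def riemann_roch_space_def)
      then have "R = P" using vo[OF R(1)] by (auto simp: point_div_def split: if_splits)
      then show ?thesis using R vo[OF P] by (simp add: point_div_def)
    qed
    have "W = {const c * v + w | c w. w \<in> V}"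
    proof
      show "W \<subseteq> {const c * v + w | c w. w \<in> V}"
      proof
        fix f assume f: "f \<in> W"
        show "f \<in> {const c * v + w | c w. w \<in> V}"
        proof (cases "f = 0")
          case True
          have "0 \<in> V" using K by (simp add: V_def riemann_roch_space_def cf)
          then show ?thesis using True const_simps(2) by (metis (mono_tags, lifting) add.left_neutral mem_Collect_eq mult_zero_left)
        next
          case False
          then have fK: "f \<in> K" "f \<noteq> 0" and fo: "\<And>R. R \<in> points K \<Longrightarrow> ord_at R f \<ge> - D R - point_div P R"
            using f by (auto simp: W_def riemann_roch_space_def)
          have "ord_at P f \<ge> ord_at P v" using fo[OF P] vP by (simp add: point_div_def)
          then obtain c where c: "f = const c * v \<or> ord_at P (f - const c * v) > ord_at P v"
            using ord_lead[OF L P fK vK] by blast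
          define w where "w = f - const c * v"
          have wK: "w \<in> K" using fK vK K by (auto simp: w_def intro: cf)
          have "w \<in> V"
          proof (cases "w = 0")
            case False
            have "ord_at R w \<ge> - D R" if R: "R \<in> points K" for R
            proof (cases "R = P")
              case True
              then show ?thesis using c False vP by (auto simp: w_def)
            next
              case RP: False
              have fR: "ord_at R f \<ge> - D R" and vR: "ord_at R v \<ge> - D R"
                using fo[OF R] vo[OF R] RP by (auto simp: point_div_def)
              show ?thesis
              proof (cases "c = 0")
                case c0: False
                have m: "- const c * v \<in> K" "- const c * v \<noteq> 0" using vK c0 K by (auto intro: cf)
                have "ord_at R (- const c * v) = ord_at R v"
                  using ord_mult[OF L R vK, of "- const c"] ord_const[OF L R vK, of "- c"] c0 K
                  by (simp add: cf mult.commute)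
                then show ?thesis using ord_add[OF L R fK m _ fR] vR False by (simp add: w_def)
              qed (use fR in \<open>simp add: w_def\<close>)
            qed
            then show ?thesis using wK by (simp add: V_def riemann_roch_space_def)
          qed (use wK in \<open>simp add: V_def riemann_roch_space_def\<close>)
          then have "f = const c * v + w \<and> w \<in> V" by (simp add: w_def)
          then show ?thesis by blast
        qed
      qed
      show "{const c * v + w | c w. w \<in> V} \<subseteq> W"
      proof clarify
        fix c w assume "w \<in> V"
        then have w: "w \<in> W" using sub by blast
        then have wK: "w \<in> K" by (auto simp: W_def riemann_roch_space_def)
        show "const c * v + w \<in> W"
        proof (cases "c = 0 \<or> w = 0 \<or> const c * v + w = 0")
          case True
          then show ?thesis
          proof (elim disjE)
            assume "w = 0"
            then show ?thesis using vK K ord_mult[OF L _ vK, of _ "const c"] ord_const[OF L _ vK, of _ c] vo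
              by (cases "c = 0") (auto simp: W_def riemann_roch_space_def cf mult.commute)
          qed (use w K in \<open>auto simp: W_def riemann_roch_space_def cf\<close>)
        next
          case False
          have "ord_at R (const c * v + w) \<ge> - (D R + point_div P R)" if R: "R \<in> points K" for R
          proof -
            have "ord_at R (const c * v) = ord_at R v"
              using ord_mult[OF L R vK, of "const c"] ord_const[OF L R vK, of c] False K
              by (simp add: cf mult.commute)
            moreover have "const c * v \<in> K" "const c * v \<noteq> 0" using vK False K by (auto intro: cf)
            ultimately show ?thesis
              using ord_add[OF L R, of "const c * v" w "- (D R + point_div P R)"] vo[OF R] w wK False R
              by (auto simp: W_def riemann_roch_space_def)
          qed
          then show ?thesis using vK wK K by (simp add: W_def riemann_roch_space_def cf)
        qed
      qed
    qed
    then have "hd_const W (Suc l)" using has_dim_line[OF d[folded V_def] v(2)] by simp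
    then show ?thesis using that[of "Suc l"] by (simp add: W_def)
  qed
qed

lemma RR_shift:
  assumes L: "laurent_field K" and h: "h \<in> K" "h \<noteq> 0" and D': "\<And>R. R \<in> points K \<Longrightarrow> D' R = D R - ord_at R h"
  shows "riemann_roch_space K D' = (\<lambda>f. h * f) ` riemann_roch_space K D"
proof
  have K: "cfield K" using L laur_cfield by blast
  show "(\<lambda>f. h * f) ` riemann_roch_space K D \<subseteq> riemann_roch_space K D'"
  proof clarify
    fix f assume "f \<in> riemann_roch_space K D"
    then show "h * f \<in> riemann_roch_space K D'"
      using h K ord_mult[OF L _ h, of _ f] D' by (cases "f = 0") (auto simp: riemann_roch_space_def cf)
  qed
  show "riemann_roch_space K D' \<subseteq> (\<lambda>f. h * f) ` riemann_roch_space K D"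
  proof
    fix f assume f: "f \<in> riemann_roch_space K D'"
    have "f / h \<in> riemann_roch_space K D"
      using f h K ord_divide[OF L _ h, of _ f] D' by (cases "f = 0") (auto simp: riemann_roch_space_def cf)
    then show "f \<in> (\<lambda>f. h * f) ` riemann_roch_space K D"
      using h by (intro image_eqI[of _ _ "f / h"]) auto
  qed
qed

lemma deg_div_eq: "finite A \<Longrightarrow> {P. D P \<noteq> 0} \<subseteq> A \<Longrightarrow> deg_div D = (\<Sum>P\<in>A. D P)"
  unfolding deg_div_def by (intro sum.mono_neutral_left) auto

lemma deg_div_add:
  assumes "finite {P. D P \<noteq> 0}" "finite {P. D' P \<noteq> 0}"
  shows "deg_div (\<lambda>P. D P + D' P) = deg_div D + deg_div D'"
proof -
  define A where "A = {P. D P \<noteq> 0} \<union> {P. D' P \<noteq> 0}"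
  have A: "finite A" using assms by (simp add: A_def)
  have "deg_div (\<lambda>P. D P + D' P) = (\<Sum>P\<in>A. D P + D' P)" "deg_div D = sum D A" "deg_div D' = sum D' A"
    by (rule deg_div_eq[OF A]; force simp: A_def)+
  then show ?thesis by (simp add: sum.distrib)
qed

lemma deg_div_cmult: "deg_div (\<lambda>P. c * D P) = c * deg_div D"
proof (cases "c = 0")
  case False
  then have "{P. c * D P \<noteq> 0} = {P. D P \<noteq> 0}" by auto
  then show ?thesis by (simp add: deg_div_def sum_distrib_left)
qed (simp add: deg_div_def)

lemma finite_supp_point_div [simp]: "finite {P. point_div Q P \<noteq> 0}"
  by (rule finite_subset[of _ "{Q}"]) (auto simp: point_div_def)

lemma deg_point_div [simp]: "deg_div (point_div Q) = 1"
  using deg_div_eq[of "{Q}" "point_div Q"] by (auto simp: point_div_def split: if_splits)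

lemma finite_supp_add:
  assumes "finite {P. D P \<noteq> (0::int)}" "finite {P. D' P \<noteq> 0}"
  shows "finite {P. D P + D' P \<noteq> 0}"
  by (rule finite_subset[OF _ finite_UnI[OF assms]]) auto

lemma finite_supp_cmult:
  assumes "finite {P. D P \<noteq> (0::int)}"
  shows "finite {P. c * D P \<noteq> 0}"
  by (rule finite_subset[OF _ assms]) auto

lemma deg_div_mono:
  assumes "finite {P. D P \<noteq> 0}" "finite {P. D' P \<noteq> 0}" "\<And>P. D P \<le> D' P"
  shows "deg_div D \<le> deg_div D'"
proof -
  define A where "A = {P. D P \<noteq> 0} \<union> {P. D' P \<noteq> 0}"
  have "finite A" using assms by (simp add: A_def)
  then have "deg_div D = sum D A" "deg_div D' = sum D' A"
    by (auto intro!: deg_div_eq simp: A_def)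
  then show ?thesis using assms(3) by (simp add: sum_mono)
qed

section \<open>Hyperelliptic function fields\<close>

text \<open>
  The separable polynomial in \<open>x\<close> with the given set of roots, as a function.
\<close>

definition root_prod :: "func \<Rightarrow> complex set \<Rightarrow> func"
  where "root_prod x S = (\<Prod>a\<in>S. x - const a)"

lemma root_prod_in: "cfield K \<Longrightarrow> x \<in> K \<Longrightarrow> root_prod x S \<in> K"
  by (auto simp: root_prod_def intro!: cf_prod cf_diff)

lemma root_prod_nonzero: "x \<notin> constants \<Longrightarrow> root_prod x S \<noteq> 0"
  by (cases "finite S") (auto simp: root_prod_def)

lemma ord_pt_root_prod:
  assumes x: "x \<notin> constants" and "finite S"
  shows "ord_at (pt x a) (root_prod x S) = (if a \<in> S then 1 else 0)"
  using assms(2)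
proof (induction S rule: finite_induct)
  case empty
  have "x \<noteq> 0" using x const_simps(2) by (metis rangeI)
  then show ?case using ord_const[OF laur_rat[OF x] pt_in_points[OF x] gen_in_rat, of 1] by (simp add: root_prod_def)
next
  case (insert b S)
  have "x - const b \<noteq> 0" "x - const b \<in> rat x" using x by (auto intro: cf)
  then have "ord_at (pt x a) ((x - const b) * root_prod x S) = ord_at (pt x a) (x - const b) + ord_at (pt x a) (root_prod x S)"
    using ord_mult[OF laur_rat[OF x] pt_in_points[OF x]] root_prod_in[of "rat x" x S] root_prod_nonzero[OF x] by simp
  then show ?case using insert ord_pt_linear[OF x, of a b] by (auto simp: root_prod_def)
qed

lemma ord_pt_inf_root_prod:
  assumes x: "x \<notin> constants" and "finite S"
  shows "ord_at (pt_inf x) (root_prod x S) = - int (card S)"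
  using assms(2)
proof (induction S rule: finite_induct)
  case empty
  have "x \<noteq> 0" using x const_simps(2) by (metis rangeI)
  then show ?case using ord_const[OF laur_rat[OF x] pt_inf_in_points[OF x] gen_in_rat, of 1] by (simp add: root_prod_def)
next
  case (insert b S)
  have "x - const b \<noteq> 0" "x - const b \<in> rat x" using x by (auto intro: cf)
  then have "ord_at (pt_inf x) ((x - const b) * root_prod x S) = ord_at (pt_inf x) (x - const b) + ord_at (pt_inf x) (root_prod x S)"
    using ord_mult[OF laur_rat[OF x] pt_inf_in_points[OF x]] root_prod_in[of "rat x" x S] root_prod_nonzero[OF x] by simp
  then show ?case using insert ord_pt_inf_linear[OF x, of b] by (auto simp: root_prod_def)
qed

text \<open>
  Squares have even order at every point, so an odd order anywhere yields a proper extension.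
\<close>

lemma quad_of_odd:
  assumes L: "laurent_field k" and P: "P \<in> points k" and b: "b\<^sup>2 \<in> k" "b \<noteq> 0" and odd: "odd (ord_at P (b\<^sup>2))"
  shows "quad k b"
proof -
  have K: "cfield k" using L laur_cfield by blast
  have "b \<notin> k"
  proof
    assume bk: "b \<in> k"
    show False using ord_power[OF L P bk b(2), of 2] odd by simp
  qed
  then show ?thesis using K b by (simp add: quad_def)
qed

text \<open>
  The curve \<open>y\<^sup>2 = \<Prod>(x - a)\<close>. The even number of roots means that \<open>\<infinity>\<close> is not a branch point, so
  that there are two points at infinity.
\<close>

locale hyperelliptic =
  fixes x y :: func and S :: "complex set" and g :: nat
  assumes x: "x \<notin> constants" and S: "finite S" "card S = 2 * g + 2" and y2: "y\<^sup>2 = root_prod x S"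
begin

definition "K = adj (rat x) y"
definition "iota = conj (rat x) y"

lemma laur_k: "laurent_field (rat x)" using x by simp

lemmas pt_neq_inf = pt_neq_pt_inf[OF x] and pt_inj = pt_inject[OF x]

lemma y0: "y \<noteq> 0" using y2 root_prod_nonzero[OF x, of S] by auto

lemma ex_root: "\<exists>a. a \<in> S" using S by (metis card.empty add_is_0 ex_in_conv zero_neq_numeral)

lemma quad_y: "quad (rat x) y"
proof -
  obtain a where "a \<in> S" using ex_root by blast
  then show ?thesis
    using quad_of_odd[OF laur_k pt_in_points[OF x, of a], of y] y2 y0 ord_pt_root_prod[OF x S(1), of a] root_prod_in[of "rat x" x S]
    by auto
qed

lemma cf_K: "cfield K" using quad_cfield_adj[OF quad_y] by (simp add: K_def)
lemma laur_K: "laurent_field K" using quad_laur[OF laur_k quad_y] by (simp add: K_def)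
lemma auto_iota: "auto_on K iota" using auto_on_conj[OF quad_y] by (simp add: K_def iota_def)
lemma rat_K: "f \<in> rat x \<Longrightarrow> f \<in> K" using base_in_adj[of "rat x" f y] by (simp add: K_def)
lemma y_K: "y \<in> K" using gen_in_adj[of "rat x" y] by (simp add: K_def)
lemma K_restrict: "Q \<in> points K \<Longrightarrow> Q \<inter> rat x \<in> points (rat x)"
  using quad_restrict_point[OF quad_y] by (simp add: K_def)

definition "ram Q = (if iota ` Q = Q then 2 else 1 :: int)"

lemma ord_K: "Q \<in> points K \<Longrightarrow> f \<in> rat x \<Longrightarrow> f \<noteq> 0 \<Longrightarrow> ord_at Q f = ram Q * ord_at (Q \<inter> rat x) f"
  using quad_ord[OF laur_k quad_y] by (simp add: K_def iota_def ram_def)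

lemma ram_pos: "ram Q > 0" "ram Q \<noteq> 0" by (auto simp: ram_def)

lemma iota_restrict: "Q \<in> points K \<Longrightarrow> iota ` Q \<inter> rat x = Q \<inter> rat x"
  using quad_conj_restrict[OF laur_k quad_y] by (simp add: K_def iota_def)

lemma above: "P \<in> points (rat x) \<Longrightarrow> \<exists>Q\<in>points K. Q \<inter> rat x = P"
  using quad_point_above[OF laur_k quad_y] by (simp add: K_def)

definition "Q_inf = (SOME Q. Q \<in> points K \<and> Q \<inter> rat x = pt_inf x)"

lemma Q_inf: "Q_inf \<in> points K" "Q_inf \<inter> rat x = pt_inf x"
proof -
  have "\<exists>Q. Q \<in> points K \<and> Q \<inter> rat x = pt_inf x" using above[of "pt_inf x"] x by auto
  from someI_ex[OF this] show "Q_inf \<in> points K" "Q_inf \<inter> rat x = pt_inf x" by (auto simp: Q_inf_def)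
qed

lemma unram_inf: "Q \<in> points K \<Longrightarrow> Q \<inter> rat x = pt_inf x \<Longrightarrow> ram Q = 1"
  using quad_ramified[OF laur_k quad_y, of Q] y2 ord_pt_inf_root_prod[OF x S(1)] S(2)
  by (simp add: K_def iota_def ram_def)

text \<open>
  The pullback to \<open>K\<close> of the point of the line below \<open>Q\<close>, a divisor of degree two.
\<close>

definition "fibre_div Q = (\<lambda>R. point_div Q R + point_div (iota ` Q) R)"

lemma fibre_div_eq: "Q \<in> points K \<Longrightarrow> R \<in> points K \<Longrightarrow> fibre_div Q R = (if R \<inter> rat x = Q \<inter> rat x then ram R else 0)"
  using fibre_count[OF laur_k quad_y, of Q R] by (auto simp: K_def iota_def ram_def fibre_div_def point_div_def split: if_splits)

lemma fibre_div_supp: "Q \<in> points K \<Longrightarrow> R \<notin> points K \<Longrightarrow> fibre_div Q R = 0"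
  using auto_on_point(1)[OF cf_K auto_iota, of Q] by (auto simp: fibre_div_def point_div_def)

lemma fibre_div_finite: "finite {R. fibre_div Q R \<noteq> 0}"
  unfolding fibre_div_def by (intro finite_supp_add) auto

lemma fibre_div_deg: "deg_div (fibre_div Q) = 2"
  unfolding fibre_div_def by (simp add: deg_div_add)

abbreviation inf_div :: "func set \<Rightarrow> int" where "inf_div \<equiv> fibre_div Q_inf"

lemma inf_div_eq: "R \<in> points K \<Longrightarrow> inf_div R = (if R \<inter> rat x = pt_inf x then 1 else 0)"
  using fibre_div_eq[OF Q_inf(1)] Q_inf(2) unram_inf by simp

definition polys :: "nat \<Rightarrow> complex poly set" where "polys i = {p. \<forall>m\<ge>i. coeff p m = 0}"

lemma polys_Suc: "p \<in> polys (Suc i) \<longleftrightarrow> (\<exists>c. \<exists>q\<in>polys i. p = monom c i + q)"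
proof
  assume p: "p \<in> polys (Suc i)"
  define q where "q = p - monom (coeff p i) i"
  have "q \<in> polys i" using p by (auto simp: q_def polys_def)
  then show "\<exists>c. \<exists>q\<in>polys i. p = monom c i + q" by (intro exI[of _ "coeff p i"] bexI[of _ q]) (auto simp: q_def)
qed (auto simp: polys_def)

lemma polys_deg: "p \<noteq> 0 \<Longrightarrow> p \<in> polys i \<longleftrightarrow> degree p < i"
proof
  assume "p \<noteq> 0" "p \<in> polys i"
  then show "degree p < i" using leading_coeff_neq_0[of p] by (auto simp: polys_def not_le[symmetric])
qed (auto simp: polys_def coeff_eq_0)

lemma polys_0 [simp]: "polys 0 = {0}"
  by (auto simp: polys_def poly_eq_iff)

lemma zero_in_polys [simp]: "0 \<in> polys i" by (simp add: polys_def)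

lemma ev_monom: "ev x (monom c n) = const c * x ^ n"
  by (induction n) (auto simp: monom_0 monom_Suc algebra_simps)

definition V :: "nat \<Rightarrow> nat \<Rightarrow> func set"
  where "V i j = {ev x p + ev x q * y | p q. p \<in> polys i \<and> q \<in> polys j}"

lemma V_unique: "ev x p + ev x q * y = ev x p' + ev x q' * y \<Longrightarrow> p = p' \<and> q = q'"
  using quad_unique[OF quad_y, of "ev x p" "ev x q" "ev x p'" "ev x q'"] ev_inj[OF x] by simp

lemma dim_V: "hd_const (V i j) (i + j)"
proof (induction j)
  case 0
  show ?case
  proof (induction i)
    case 0
    show ?case using has_dim_zero by (simp add: V_def)
  next
    case (Suc i)
    have n: "x ^ i \<notin> V i 0"
    proof
      assume "x ^ i \<in> V i 0"
      then obtain p where p: "p \<in> polys i" "x ^ i = ev x p" by (auto simp: V_def)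
      then have "ev x (monom 1 i) = ev x p" by (simp add: ev_monom)
      then have "monom 1 i = p" using ev_inj[OF x] by blast
      then show False using p(1) by (auto simp: polys_def)
    qed
    have "V (Suc i) 0 = {const c * x ^ i + w | c w. w \<in> V i 0}"
    proof
      show "V (Suc i) 0 \<subseteq> {const c * x ^ i + w | c w. w \<in> V i 0}"
      proof
        fix f assume "f \<in> V (Suc i) 0"
        then obtain c p where "p \<in> polys i" "f = ev x (monom c i + p)"
          unfolding V_def polys_Suc by auto
        then have "f = const c * x ^ i + ev x p" "ev x p \<in> V i 0" by (auto simp: ev_monom V_def)
        then show "f \<in> {const c * x ^ i + w | c w. w \<in> V i 0}" by blast
      qed
      show "{const c * x ^ i + w | c w. w \<in> V i 0} \<subseteq> V (Suc i) 0"
      proof clarify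
        fix c w assume "w \<in> V i 0"
        then obtain p where p: "p \<in> polys i" "w = ev x p" by (auto simp: V_def)
        then have "const c * x ^ i + w = ev x (monom c i + p) + ev x 0 * y" by (simp add: ev_monom)
        moreover have "monom c i + p \<in> polys (Suc i)" using p polys_Suc by blast
        ultimately show "const c * x ^ i + w \<in> V (Suc i) 0" unfolding V_def using zero_in_polys by blast
      qed
    qed
    then show ?case using has_dim_line[OF _ n, of i] Suc by simp
  qed
next
  case (Suc j)
  have n: "x ^ j * y \<notin> V i j"
  proof
    assume "x ^ j * y \<in> V i j"
    then obtain p q where pq: "p \<in> polys i" "q \<in> polys j" "x ^ j * y = ev x p + ev x q * y" by (auto simp: V_def)
    then have "ev x 0 + ev x (monom 1 j) * y = ev x p + ev x q * y" by (simp add: ev_monom)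
    then have "monom 1 j = q" using V_unique by blast
    then show False using pq(2) by (auto simp: polys_def)
  qed
  have "V i (Suc j) = {const c * (x ^ j * y) + w | c w. w \<in> V i j}"
  proof
    show "V i (Suc j) \<subseteq> {const c * (x ^ j * y) + w | c w. w \<in> V i j}"
    proof
      fix f assume "f \<in> V i (Suc j)"
      then obtain p c q where "p \<in> polys i" "q \<in> polys j" "f = ev x p + ev x (monom c j + q) * y"
        unfolding V_def polys_Suc by blast
      then have "f = const c * (x ^ j * y) + (ev x p + ev x q * y)" "ev x p + ev x q * y \<in> V i j"
        by (auto simp: ev_monom algebra_simps V_def)
      then show "f \<in> {const c * (x ^ j * y) + w | c w. w \<in> V i j}" by blast
    qed
    show "{const c * (x ^ j * y) + w | c w. w \<in> V i j} \<subseteq> V i (Suc j)"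
    proof clarify
      fix c w assume "w \<in> V i j"
      then obtain p q where pq: "p \<in> polys i" "q \<in> polys j" "w = ev x p + ev x q * y" by (auto simp: V_def)
      then have "const c * (x ^ j * y) + w = ev x p + ev x (monom c j + q) * y"
        by (simp add: ev_monom algebra_simps)
      moreover have "monom c j + q \<in> polys (Suc j)" using pq polys_Suc by blast
      ultimately show "const c * (x ^ j * y) + w \<in> V i (Suc j)" using pq(1) unfolding V_def by blast
    qed
  qed
  then show ?case using has_dim_line[OF Suc n] by simp
qed

lemma bounded_half:
  assumes f: "f \<in> K" "f \<noteq> 0" and b: "\<And>R. R \<in> points K \<Longrightarrow> ord_at R f \<ge> - int n * inf_div R"
    and c: "c = 1 \<or> c = - 1" and h: "f + c * iota f \<noteq> 0" and R: "R \<in> points K"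
  shows "ord_at R (f + c * iota f) \<ge> - int n * inf_div R"
proof -
  have i: "iota f \<in> K" "iota f \<noteq> 0"
    using auto_on_simps(1)[OF auto_iota f(1)] auto_on_more(6)[OF cf_K auto_iota f(1)] f(2) by auto
  have iR: "iota ` R \<in> points K" using auto_on_point(1)[OF cf_K auto_iota R] .
  have "ord_at R (iota f) = ord_at (iota ` R) f" using ord_at_auto[OF laur_K auto_iota R f] by simp
  also have "\<dots> \<ge> - int n * inf_div (iota ` R)" using b[OF iR] .
  also have "inf_div (iota ` R) = inf_div R" using inf_div_eq[OF R] inf_div_eq[OF iR] iota_restrict[OF R] by simp
  finally have 1: "ord_at R (iota f) \<ge> - int n * inf_div R" by simp
  have "ord_at R (c * iota f) = ord_at R (iota f)" using c ord_minus[OF laur_K R i] by auto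
  moreover have "c * iota f \<in> K" "c * iota f \<noteq> 0" using i c cf_K by (auto intro: cf)
  ultimately show ?thesis using ord_add[OF laur_K R f] h b[OF R] 1 by simp
qed

text \<open>
  Split \<open>f = u + v y\<close>. Since the divisor at infinity is invariant under the hyperelliptic
  involution, \<open>u\<close> and \<open>v y\<close> obey the same bounds as \<open>f\<close> (\<open>bounded_half\<close>). So \<open>u\<close> is a polynomial of
  degree at most \<open>n\<close>. The square of \<open>v y\<close> is \<open>v\<^sup>2 \<Prod>(x - a)\<close>; as the product has only simple roots,
  \<open>v\<close> has no finite pole, and counting degrees at infinity gives \<open>deg v + g + 1 \<le> n\<close>.
\<close>

lemma RR_space: "riemann_roch_space K (\<lambda>R. int n * inf_div R) = V (n + 1) (n - g)"
proof
  show "riemann_roch_space K (\<lambda>R. int n * inf_div R) \<subseteq> V (n + 1) (n - g)"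
  proof
    fix f assume f': "f \<in> riemann_roch_space K (\<lambda>R. int n * inf_div R)"
    show "f \<in> V (n + 1) (n - g)"
    proof (cases "f = 0")
      case True
      have "ev x 0 + ev x 0 * y \<in> V (n + 1) (n - g)" unfolding V_def using zero_in_polys by blast
      then show ?thesis using True by simp
    next
      case f0: False
      then have f: "f \<in> K" and b: "\<And>R. R \<in> points K \<Longrightarrow> ord_at R f \<ge> - int n * inf_div R"
        using f' by (auto simp: riemann_roch_space_def)
      obtain u v where uv: "u \<in> rat x" "v \<in> rat x" "f = u + v * y" using f unfolding K_def by (rule adjE)
      have fi: "iota f = u - v * y" using conj_eq[OF quad_y uv(1,2)] uv(3) by (simp add: iota_def)
      have two: "ord_at R (2 :: func) = 0" if "R \<in> points K" for R
        using ord_const[OF laur_K that f f0, of 2] by simp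
      have c2: "(2::func) \<in> K" using cf_K by (intro cf)
      have "\<exists>p\<in>polys (n + 1). u = ev x p"
      proof (cases "u = 0")
        case True
        then show ?thesis by (intro bexI[of _ 0]) auto
      next
        case u0: False
        have o: "ord_at R u \<ge> - int n * inf_div R" if R: "R \<in> points K" for R
        proof -
          have e: "f + 1 * iota f = 2 * u" using fi uv by simp
          have "ord_at R (2 * u) \<ge> - int n * inf_div R"
            using bounded_half[OF f f0 b _ _ R, of 1] e u0 by simp
          then show ?thesis using ord_mult[OF laur_K R c2 two_neq_zero rat_K[OF uv(1)] u0] two[OF R] by simp
        qed
        have fin: "ord_at (pt x a) u \<ge> 0" for a
        proof -
          obtain R where R: "R \<in> points K" "R \<inter> rat x = pt x a" using above[OF pt_in_points[OF x]] by blast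
          show ?thesis using pt_neq_inf o[OF R(1)] inf_div_eq[OF R(1)] R(2) ord_K[OF R(1) uv(1) u0] ram_pos[of R]
            by (simp add: zero_le_mult_iff)
        qed
        obtain p where p: "u = ev x p" "p \<noteq> 0" using regular_imp_polynomial[OF x uv(1) u0 fin] by blast
        have "ord_at Q_inf u = - int (degree p)"
          using ord_K[OF Q_inf(1) uv(1) u0] unram_inf[OF Q_inf] Q_inf(2) ord_pt_inf_ev[OF x p(2)] p(1) by simp
        then have "degree p \<le> n" using o[OF Q_inf(1)] inf_div_eq[OF Q_inf(1)] Q_inf(2) by simp
        then show ?thesis using p polys_deg[OF p(2)] by auto
      qed
      moreover have "\<exists>q\<in>polys (n - g). v = ev x q"
      proof (cases "v = 0")
        case True
        then show ?thesis by (intro bexI[of _ 0]) auto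
      next
        case v0: False
        have vy: "v * y \<in> K" "v * y \<noteq> 0" using v0 y0 y_K rat_K[OF uv(2)] cf_K by (auto intro: cf)
        have o: "2 * ord_at R v + 2 * ord_at R y \<ge> - 2 * int n * inf_div R" if R: "R \<in> points K" for R
        proof -
          have e: "f + (- 1) * iota f = 2 * (v * y)" using fi uv by simp
          have "f + (- 1) * iota f \<noteq> 0" unfolding e using v0 y0 by simp
          then have "ord_at R (2 * (v * y)) \<ge> - int n * inf_div R"
            using bounded_half[OF f f0 b _ _ R, of "- 1"] unfolding e by blast
          then show ?thesis using ord_mult[OF laur_K R c2 two_neq_zero vy] two[OF R]
              ord_mult[OF laur_K R rat_K[OF uv(2)] v0 y_K y0] by simp
        qed
        have oy: "2 * ord_at R y = ram R * ord_at (R \<inter> rat x) (root_prod x S)" if R: "R \<in> points K" for R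
          using ord_power[OF laur_K R y_K y0, of 2] ord_K[OF R root_prod_in[of "rat x" x S] root_prod_nonzero[OF x]] y2 by simp
        have o': "ram R * (2 * ord_at (R \<inter> rat x) v + ord_at (R \<inter> rat x) (root_prod x S)) \<ge> - 2 * int n * inf_div R"
          if R: "R \<in> points K" for R
          using o[OF R] oy[OF R] ord_K[OF R uv(2) v0] by (simp add: algebra_simps)
        have fin: "ord_at (pt x a) v \<ge> 0" for a
        proof -
          obtain R where R: "R \<in> points K" "R \<inter> rat x = pt x a" using above[OF pt_in_points[OF x]] by blast
          have "0 \<le> 2 * ord_at (pt x a) v + ord_at (pt x a) (root_prod x S)"
            using o'[OF R(1)] inf_div_eq[OF R(1)] R(2) ram_pos[of R] pt_neq_inf by (simp add: zero_le_mult_iff)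
          then show ?thesis using ord_pt_root_prod[OF x S(1), of a] by (simp split: if_splits)
        qed
        obtain q where q: "v = ev x q" "q \<noteq> 0" using regular_imp_polynomial[OF x uv(2) v0 fin] by blast
        have "- 2 * int n \<le> - 2 * int (degree q) - (2 * int g + 2)"
          using o'[OF Q_inf(1)] inf_div_eq[OF Q_inf(1)] Q_inf(2) unram_inf[OF Q_inf] ord_pt_inf_root_prod[OF x S(1)]
            ord_pt_inf_ev[OF x q(2)] q(1) S(2) by simp
        then have "degree q < n - g" by linarith
        then show ?thesis using q polys_deg[OF q(2)] by auto
      qed
      ultimately show ?thesis using uv(3) unfolding V_def by blast
    qed
  qed
  show "V (n + 1) (n - g) \<subseteq> riemann_roch_space K (\<lambda>R. int n * inf_div R)"
  proof
    fix f assume "f \<in> V (n + 1) (n - g)"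
    then obtain p q where pq: "p \<in> polys (n + 1)" "q \<in> polys (n - g)" "f = ev x p + ev x q * y"
      by (auto simp: V_def)
    have 1: "ord_at R (ev x p) \<ge> - int n * inf_div R" if R: "R \<in> points K" and "p \<noteq> 0" for R
    proof (rule points_rat_cases[OF x K_restrict[OF R]])
      fix a assume a: "R \<inter> rat x = pt x a"
      show ?thesis using pt_neq_inf ord_K[OF R ev_in_rat, of p] ev_nonzero[OF x, of p] ord_pt_ev[OF x \<open>p \<noteq> 0\<close>, of a] \<open>p \<noteq> 0\<close> ram_pos[of R] a
          inf_div_eq[OF R] by simp
    next
      assume a: "R \<inter> rat x = pt_inf x"
      then show ?thesis using ord_K[OF R ev_in_rat, of p] ev_nonzero[OF x, of p] ord_pt_inf_ev[OF x \<open>p \<noteq> 0\<close>] \<open>p \<noteq> 0\<close>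
          unram_inf[OF R a] inf_div_eq[OF R] polys_deg[OF \<open>p \<noteq> 0\<close>, of "n + 1"] pq(1) by simp
    qed
    have 2: "ord_at R (ev x q * y) \<ge> - int n * inf_div R" if R: "R \<in> points K" and q0: "q \<noteq> 0" for R
    proof -
      have oy: "2 * ord_at R y = ram R * ord_at (R \<inter> rat x) (root_prod x S)"
        using ord_power[OF laur_K R y_K y0, of 2] ord_K[OF R root_prod_in[of "rat x" x S] root_prod_nonzero[OF x]] y2 by simp
      have m: "ord_at R (ev x q * y) = ord_at R (ev x q) + ord_at R y"
        using ord_mult[OF laur_K R rat_K[OF ev_in_rat] _ y_K y0] ev_nonzero[OF x, of q] q0 by simp
      show ?thesis
      proof (rule points_rat_cases[OF x K_restrict[OF R]])
        fix a assume a: "R \<inter> rat x = pt x a"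
        have "ord_at R y \<ge> 0" using oy a ord_pt_root_prod[OF x S(1), of a] ram_pos[of R] by (auto split: if_splits)
        then show ?thesis using pt_neq_inf m ord_K[OF R ev_in_rat, of q] ev_nonzero[OF x, of q] ord_pt_ev[OF x q0, of a] q0 ram_pos[of R] a
          inf_div_eq[OF R] by simp
      next
        assume a: "R \<inter> rat x = pt_inf x"
        then show ?thesis using m oy ord_K[OF R ev_in_rat, of q] ev_nonzero[OF x, of q] ord_pt_inf_ev[OF x q0] q0
          unram_inf[OF R a] inf_div_eq[OF R] polys_deg[OF q0, of "n - g"] pq(2) ord_pt_inf_root_prod[OF x S(1)] S(2) by simp
      qed
    qed
    have fK: "f \<in> K" using pq(3) rat_K[OF ev_in_rat] y_K cf_K by (auto intro: cf)
    have "ord_at R f \<ge> - int n * inf_div R" if R: "R \<in> points K" and f0: "f \<noteq> 0" for R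
    proof (cases "p = 0 \<or> q = 0")
      case True
      then show ?thesis
      proof
        assume "p = 0"
        then show ?thesis using 2[OF R] f0 pq(3) by (cases "q = 0") simp_all
      next
        assume "q = 0"
        then show ?thesis using 1[OF R] f0 pq(3) by (cases "p = 0") simp_all
      qed
    next
      case False
      then have "ev x p \<noteq> 0" "ev x q * y \<noteq> 0" using ev_nonzero[OF x] y0 by auto
      moreover have "ev x p \<in> K" "ev x q * y \<in> K" using rat_K[OF ev_in_rat] y_K cf_K by (auto intro: cf)
      ultimately show ?thesis using ord_add[OF laur_K R] 1[OF R] 2[OF R] False f0 pq(3) by simp
    qed
    then show "f \<in> riemann_roch_space K (\<lambda>R. int n * inf_div R)" using fK by (auto simp: riemann_roch_space_def)
  qed
qed

text \<open>
  For \<open>n \<le> g\<close> there is no room for a multiple of \<open>y\<close> in \<open>RR_space\<close>.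
\<close>

lemma small_poles_in_rat:
  assumes "f \<in> K" "\<And>R. R \<in> points K \<Longrightarrow> f \<noteq> 0 \<Longrightarrow> ord_at R f \<ge> - int n * inf_div R" "n \<le> g"
  shows "f \<in> rat x"
proof -
  have "f \<in> riemann_roch_space K (\<lambda>R. int n * inf_div R)"
    using assms by (auto simp: riemann_roch_space_def)
  then have "f \<in> V (n + 1) 0" using RR_space[of n] assms(3) by simp
  then show ?thesis by (auto simp: V_def)
qed

lemma fibre_div_principal_finite:
  assumes Qa: "Qa \<in> points K" "Qa \<inter> rat x = pt x a"
  obtains h where "h \<in> rat x" "h \<noteq> 0" "\<And>R. R \<in> points K \<Longrightarrow> ord_at R h = fibre_div Qa R - inf_div R"
proof -
  define h where "h = x - const a"
  have h: "h \<in> rat x" "h \<noteq> 0" using x by (auto simp: h_def intro!: cf_diff)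
  have "ord_at R h = fibre_div Qa R - inf_div R" if R: "R \<in> points K" for R
  proof (rule points_rat_cases[OF x K_restrict[OF R]])
    fix b assume b: "R \<inter> rat x = pt x b"
    show ?thesis using pt_inj b ord_K[OF R h(1,2)] ord_pt_linear[OF x, of b a] fibre_div_eq[OF Qa(1) R] Qa(2) inf_div_eq[OF R] pt_neq_inf
      by (auto simp: h_def)
  next
    assume i: "R \<inter> rat x = pt_inf x"
    then show ?thesis using ord_K[OF R h(1,2)] ord_pt_inf_linear[OF x, of a] fibre_div_eq[OF Qa(1) R] Qa(2) inf_div_eq[OF R] pt_neq_inf[of a]
      unram_inf[OF R i] by (auto simp: h_def)
  qed
  then show thesis using that h by blast
qed

text \<open>
  All fibres over the line are linearly equivalent, since all points of the line are. The function
  is even taken from the line, so it is invariant under the hyperelliptic involution.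
\<close>

lemma fibre_div_principal:
  assumes Q: "Q \<in> points K"
  obtains h where "h \<in> rat x" "h \<noteq> 0" "\<And>R. R \<in> points K \<Longrightarrow> ord_at R h = fibre_div Q R - inf_div R"
proof (rule points_rat_cases[OF x K_restrict[OF Q]])
  fix a assume "Q \<inter> rat x = pt x a"
  then show thesis using fibre_div_principal_finite[OF Q] that by blast
next
  assume i: "Q \<inter> rat x = pt_inf x"
  have "ord_at R 1 = fibre_div Q R - inf_div R" if R: "R \<in> points K" for R
    using ord_const[OF laur_K R y_K y0, of 1] fibre_div_eq[OF Q R] fibre_div_eq[OF Q_inf(1) R] i Q_inf(2) by simp
  then show thesis by (rule that[OF cf_1[OF cfield_rat] one_neq_zero])
qed

text \<open>
  Riemann's inequality for one divisor. It passes from \<open>D + P\<close> to \<open>D\<close> (\<open>bound_add_point\<close>) and is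
  unchanged under linear equivalence, so it suffices to know it for large multiples of the divisor
  at infinity, where it is an equality by \<open>RR_space\<close>.
\<close>

definition genus_bound :: "(func set \<Rightarrow> int) \<Rightarrow> bool"
  where "genus_bound D \<longleftrightarrow> (\<forall>l. hd_const (riemann_roch_space K D) l \<longrightarrow> deg_div D - int l + 1 \<le> int g)"

lemma bound_inf_div: "n \<ge> g \<Longrightarrow> genus_bound (\<lambda>R. int n * inf_div R)"
  using has_dim_unique[OF dim_V[of "n + 1" "n - g"]] unfolding genus_bound_def RR_space deg_div_cmult fibre_div_deg by force

lemma bound_add_point:
  assumes "finite {P. D P \<noteq> 0}" "P \<in> points K" "genus_bound (\<lambda>R. D R + point_div P R)"
  shows "genus_bound D"
  unfolding genus_bound_def
proof (intro allI impI)
  fix l assume l: "hd_const (riemann_roch_space K D) l"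
  obtain l' where l': "l' \<le> l + 1" "hd_const (riemann_roch_space K (\<lambda>R. D R + point_div P R)) l'"
    using RR_add_point[OF laur_K assms(2) l] .
  then have "deg_div (\<lambda>R. D R + point_div P R) - int l' + 1 \<le> int g" using assms(3) by (simp add: genus_bound_def)
  then show "deg_div D - int l + 1 \<le> int g" using l'(1) deg_div_add[OF assms(1), of "point_div P"] by simp
qed

lemma bound_below:
  assumes m: "m \<ge> g" and D: "divisor K D" and le: "\<And>R. R \<in> points K \<Longrightarrow> D R \<le> int m * inf_div R"
  shows "genus_bound D"
  using D le
proof (induction "nat (2 * int m - deg_div D)" arbitrary: D rule: less_induct)
  case less
  have fin: "finite {P. D P \<noteq> 0}" and supp: "\<And>R. R \<notin> points K \<Longrightarrow> D R = 0"
    using less(2) by (auto simp: divisor_def)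
  show ?case
  proof (cases "\<forall>R\<in>points K. D R = int m * inf_div R")
    case True
    then have "D R = int m * inf_div R" for R using supp fibre_div_supp[OF Q_inf(1)] by (cases "R \<in> points K") auto
    then have "D = (\<lambda>R. int m * inf_div R)" by blast
    then show ?thesis using bound_inf_div[OF m] by simp
  next
    case False
    then obtain P where P: "P \<in> points K" "D P < int m * inf_div P" using less(3) by fastforce
    define D' where "D' = (\<lambda>R. D R + point_div P R)"
    have fin': "finite {R. D' R \<noteq> 0}" unfolding D'_def by (intro finite_supp_add fin) simp
    have d': "divisor K D'" using fin' supp P(1) by (auto simp: divisor_def D'_def point_div_def split: if_splits)
    have le': "D' R \<le> int m * inf_div R" if "R \<in> points K" for R
      using less(3)[OF that] P by (auto simp: D'_def point_div_def)
    have "D' R \<le> int m * inf_div R" for R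
    proof (cases "R \<in> points K")
      case False
      then have "D' R = 0" using d' unfolding divisor_def by blast
      then show ?thesis using fibre_div_supp[OF Q_inf(1) False] by simp
    qed (rule le')
    then have "deg_div D' \<le> deg_div (\<lambda>R. int m * inf_div R)"
      by (intro deg_div_mono fin' finite_supp_cmult fibre_div_finite)
    then have a: "deg_div D' \<le> 2 * int m" by (simp add: deg_div_cmult fibre_div_deg)
    have "deg_div D' = deg_div D + 1" unfolding D'_def using deg_div_add[OF fin] by simp
    then have "genus_bound D'" using less(1)[of D'] a d' le' by simp
    then show ?thesis using bound_add_point[OF fin P(1)] by (simp add: D'_def)
  qed
qed

text \<open>
  Induction on the set of coordinates of the finite points with positive coefficient: subtracting a
  large multiple of the divisor of \<open>x - a\<close> makes the coefficients above \<open>a\<close> non-positive and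
  changes no other finite coefficient.
\<close>

lemma bound_all:
  assumes "finite A" and "divisor K D" and "\<And>R a. R \<in> points K \<Longrightarrow> R \<inter> rat x = pt x a \<Longrightarrow> D R > 0 \<Longrightarrow> a \<in> A"
  shows "genus_bound D"
  using assms
proof (induction A arbitrary: D rule: finite_induct)
  case empty
  have fin: "finite {P. D P \<noteq> 0}" using empty(1) by (simp add: divisor_def)
  define m where "m = g + nat (\<Sum>P | D P \<noteq> 0. \<bar>D P\<bar>)"
  have ge: "D R \<le> int m" for R
  proof (cases "D R = 0")
    case False
    then have "\<bar>D R\<bar> \<le> (\<Sum>P | D P \<noteq> 0. \<bar>D P\<bar>)"
      using member_le_sum[of R "{P. D P \<noteq> 0}" "\<lambda>P. \<bar>D P\<bar>"] fin by auto
    then show ?thesis by (simp add: m_def)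
  qed simp
  have "D R \<le> int m * inf_div R" if R: "R \<in> points K" for R
  proof (rule points_rat_cases[OF x K_restrict[OF R]])
    fix a assume "R \<inter> rat x = pt x a"
    then show ?thesis using empty(2)[OF R] inf_div_eq[OF R] pt_neq_inf by fastforce
  next
    assume "R \<inter> rat x = pt_inf x"
    then show ?thesis using ge inf_div_eq[OF R] by simp
  qed
  then show ?case using bound_below[of m D] empty(1) by (simp add: m_def)
next
  case (insert a A)
  have fin: "finite {P. D P \<noteq> 0}" using insert(4) by (simp add: divisor_def)
  \<comment> \<open>any number that bounds all coefficients will do\<close>
  define n where "n = nat (\<Sum>P | D P \<noteq> 0. \<bar>D P\<bar>)"
  have ge: "D R \<le> int n" for R
  proof (cases "D R = 0")
    case False
    then have "\<bar>D R\<bar> \<le> (\<Sum>P | D P \<noteq> 0. \<bar>D P\<bar>)"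
      using member_le_sum[of R "{P. D P \<noteq> 0}" "\<lambda>P. \<bar>D P\<bar>"] fin by auto
    then show ?thesis by (simp add: n_def)
  qed simp
  obtain Qa where Qa: "Qa \<in> points K" "Qa \<inter> rat x = pt x a" using above[OF pt_in_points[OF x]] by blast
  obtain h where h: "h \<in> rat x" "h \<noteq> 0" and ordh: "\<And>R. R \<in> points K \<Longrightarrow> ord_at R h = fibre_div Qa R - inf_div R"
    by (rule fibre_div_principal_finite[OF Qa]) blast
  have hK: "h \<in> K" using rat_K h by blast
  define D' where "D' = (\<lambda>R. D R + (- int n) * (fibre_div Qa R + (- 1) * inf_div R))"
  have finh: "finite {R. fibre_div Qa R + (- 1) * inf_div R \<noteq> 0}"
    by (intro finite_supp_add finite_supp_cmult fibre_div_finite)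
  have fin': "finite {R. D' R \<noteq> 0}" unfolding D'_def by (intro finite_supp_add finite_supp_cmult fin finh)
  have d': "divisor K D'"
    using fin' insert(4) fibre_div_supp[OF Q_inf(1)] fibre_div_supp[OF Qa(1)] by (auto simp: divisor_def D'_def)
  have deg': "deg_div D' = deg_div D"
    unfolding D'_def using deg_div_add[OF fin finite_supp_cmult[OF finh]]
      deg_div_add[OF fibre_div_finite finite_supp_cmult[OF fibre_div_finite], of Qa "- 1" Q_inf]
    by (simp add: deg_div_cmult fibre_div_deg del: mult_minus1 mult_minus_left)
  have "genus_bound D'"
  proof (rule insert(3)[OF d'])
    fix R b assume R: "R \<in> points K" "R \<inter> rat x = pt x b" "D' R > 0"
    have i: "inf_div R = 0" using inf_div_eq[OF R(1)] R(2) pt_neq_inf by simp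
    show "b \<in> A"
    proof (cases "b = a")
      case True
      then have "fibre_div Qa R \<ge> 1" using fibre_div_eq[OF Qa(1) R(1)] R(2) Qa(2) ram_pos[of R] by simp
      then have "int n * 1 \<le> int n * fibre_div Qa R" by (intro mult_left_mono) auto
      then have "D' R \<le> 0" using ge[of R] i by (simp add: D'_def)
      then show ?thesis using R(3) by simp
    next
      case False
      then have "fibre_div Qa R = 0" using pt_inj fibre_div_eq[OF Qa(1) R(1)] R(2) Qa(2) by simp
      then have "D R > 0" using R(3) i by (simp add: D'_def)
      then show ?thesis using insert(5)[OF R(1,2)] False by simp
    qed
  qed
  moreover have "riemann_roch_space K D' = (\<lambda>f. h ^ n * f) ` riemann_roch_space K D"
  proof (rule RR_shift[OF laur_K])
    show "h ^ n \<in> K" "h ^ n \<noteq> 0" using hK h(2) cf_K by (auto intro: cf)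
    fix R assume R: "R \<in> points K"
    have "ord_at R (h ^ n) = int n * (fibre_div Qa R - inf_div R)"
      using ord_power[OF laur_K R hK h(2), of n] ordh[OF R] by simp
    then show "D' R = D R - ord_at R (h ^ n)" by (simp add: D'_def algebra_simps)
  qed
  ultimately show ?case
    unfolding genus_bound_def deg' using has_dim_image[of _ _ "h ^ n"] h(2) by simp
qed

text \<open>
  The bound is attained by \<open>g\<close> times the divisor at infinity.
\<close>

theorem genus: "has_genus K g"
  unfolding has_genus_def
proof (intro conjI allI impI)
  fix D l assume D: "divisor K D \<and> hd_const (riemann_roch_space K D) l"
  then have fin: "finite {P. D P \<noteq> 0}" by (simp add: divisor_def)
  define A where "A = (\<lambda>R. THE a. R \<inter> rat x = pt x a) ` {P. D P \<noteq> 0}"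
  have "genus_bound D"
  proof (rule bound_all)
    show "finite A" using fin by (simp add: A_def)
    show "divisor K D" using D by blast
    fix R a assume R: "R \<in> points K" "R \<inter> rat x = pt x a" "D R > 0"
    have "(THE a. R \<inter> rat x = pt x a) = a" using R(2) pt_inj by (intro the_equality) auto
    then show "a \<in> A" using R(3) unfolding A_def by force
  qed
  then show "deg_div D - int l + 1 \<le> int g" using D by (simp add: genus_bound_def)
next
  have "hd_const (riemann_roch_space K (\<lambda>R. int g * inf_div R)) (g + 1)"
    using dim_V[of "g + 1" 0] RR_space[of g] by simp
  moreover have "divisor K (\<lambda>R. int g * inf_div R)"
    unfolding divisor_def
  proof
    show "finite {R. int g * inf_div R \<noteq> 0}" by (intro finite_supp_cmult fibre_div_finite)
    show "{R. int g * inf_div R \<noteq> 0} \<subseteq> points K" using fibre_div_supp[OF Q_inf(1)] by auto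
  qed
  moreover have "deg_div (\<lambda>R. int g * inf_div R) - int (g + 1) + 1 = int g"
    by (simp add: deg_div_cmult fibre_div_deg)
  ultimately show "\<exists>D l. divisor K D \<and> hd_const (riemann_roch_space K D) l \<and> deg_div D - int l + 1 = int g"
    by blast
qed

end

lemma has_genus_unique:
  assumes "has_genus K g" "has_genus K g'"
  shows "g = g'"
proof -
  have le: "a \<le> b" if a: "has_genus K a" and b: "has_genus K b" for a b
  proof -
    obtain D l where D: "divisor K D \<and> hd_const (riemann_roch_space K D) l" "deg_div D - int l + 1 = int a"
      using a unfolding has_genus_def by blast
    have "deg_div D - int l + 1 \<le> int b" using b D(1) unfolding has_genus_def by blast
    then show ?thesis using D(2) by simp
  qed
  show ?thesis using le[OF assms] le[OF assms(2,1)] by simp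
qed

section \<open>Square classes\<close>

text \<open>
  Pair up equal roots.
\<close>

lemma poly_square_class:
  fixes p :: "complex poly"
  assumes "p \<noteq> 0"
  shows "\<exists>r S. finite S \<and> r \<noteq> 0 \<and> p = r\<^sup>2 * (\<Prod>a\<in>S. [:- a, 1:])"
  using assms
proof (induction p rule: poly_linear_induct)
  case (const c)
  have "[:c:] = [:csqrt c:]\<^sup>2 * (\<Prod>a\<in>{}. [:- a, 1:])"
    using power2_csqrt[of c] by (simp add: power2_eq_square)
  then show ?case using const by (intro exI[of _ "[:csqrt c:]"] exI[of _ "{}"]) auto
next
  case (linear b q)
  then obtain r S where rS: "finite S" "r \<noteq> 0" "q = r\<^sup>2 * (\<Prod>a\<in>S. [:- a, 1:])" by blast
  show ?case
  proof (cases "b \<in> S")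
    case True
    have "(\<Prod>a\<in>S. [:- a, 1:]) = [:- b, 1:] * (\<Prod>a\<in>S - {b}. [:- a, 1:])"
      using rS(1) True by (simp add: prod.remove)
    then have "[:- b, 1:] * q = (r * [:- b, 1:])\<^sup>2 * (\<Prod>a\<in>S - {b}. [:- a, 1:])"
      unfolding rS(3) by (simp only: power2_eq_square mult_ac)
    moreover have "r * [:- b, 1:] \<noteq> 0" using rS(2) by (simp only: mult_eq_0_iff) auto
    ultimately show ?thesis using rS(1) by blast
  next
    case False
    then have "[:- b, 1:] * q = r\<^sup>2 * (\<Prod>a\<in>insert b S. [:- a, 1:])"
      unfolding rS(3) prod.insert[OF rS(1) False] by (simp only: mult_ac)
    then show ?thesis using rS(1,2) by blast
  qed
qed

lemma ev_prod_linear: "ev x (\<Prod>a\<in>S. [:- a, 1:]) = root_prod x S"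
  unfolding evh_prod[OF field_hom_const] evh_linear[OF field_hom_const] root_prod_def ..

lemma hyper_form:
  assumes x: "x \<notin> constants" and q: "quad (rat x) b"
  obtains y S where "finite S" "y\<^sup>2 = root_prod x S" "quad (rat x) y" "adj (rat x) y = adj (rat x) b"
proof -
  have "b\<^sup>2 \<in> rat x" using q by (simp add: quad_def)
  then obtain p r where pr: "r \<noteq> 0" "b\<^sup>2 = ev x p / ev x r" by (rule rat_cases[OF x])
  have b0: "b \<noteq> 0" using quad_nonzero[OF q] .
  have er: "ev x r \<noteq> 0" using ev_nonzero[OF x] pr(1) by simp
  have "p * r \<noteq> 0" using pr b0 by auto
  then obtain s S where s: "finite S" "s \<noteq> 0" "p * r = s\<^sup>2 * (\<Prod>a\<in>S. [:- a, 1:])"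
    using poly_square_class by blast
  have es: "ev x s \<noteq> 0" using ev_nonzero[OF x] s(2) by simp
  have "ev x (p * r) = (ev x s)\<^sup>2 * root_prod x S"
    unfolding s(3) evh_mult[OF field_hom_const] evh_power[OF field_hom_const] ev_prod_linear ..
  moreover have "ev x (p * r) = b\<^sup>2 * (ev x r)\<^sup>2" unfolding pr(2) using er by (simp add: power2_eq_square)
  ultimately have e: "b\<^sup>2 * (ev x r)\<^sup>2 = (ev x s)\<^sup>2 * root_prod x S" by simp
  define l where "l = ev x r / ev x s"
  have l: "l \<in> rat x" "l \<noteq> 0" using er es by (auto simp: l_def intro: cf_divide)
  have "(l * b)\<^sup>2 = (b\<^sup>2 * (ev x r)\<^sup>2) / (ev x s)\<^sup>2" by (simp add: l_def power_mult_distrib power_divide)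
  also have "\<dots> = root_prod x S" unfolding e using es by simp
  finally have "(l * b)\<^sup>2 = root_prod x S" .
  then show thesis using that[OF s(1)] adj_scale(1,2)[OF q l] by blast
qed

lemma nonconst_nonzero: "x \<notin> constants \<Longrightarrow> x - const c \<noteq> 0" "x \<notin> constants \<Longrightarrow> x \<noteq> 0"
proof -
  show "x \<notin> constants \<Longrightarrow> x - const c \<noteq> 0" for c by auto
  from this[of 0] show "x \<notin> constants \<Longrightarrow> x \<noteq> 0" by simp
qed

lemma rat_shift_inverse: "x \<notin> constants \<Longrightarrow> rat (inverse (x - const c)) = rat x"
proof (rule rat_eqI)
  assume x: "x \<notin> constants"
  show "inverse (x - const c) \<in> rat x" by (intro cf_inverse cf_diff) auto
  have "inverse (inverse (x - const c)) + const c \<in> rat (inverse (x - const c))"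
    by (intro cf_add cf_inverse[OF cfield_rat gen_in_rat]) auto
  then show "x \<in> rat (inverse (x - const c))" by simp
qed

lemma shift_inverse_nonconst: "x \<notin> constants \<Longrightarrow> inverse (x - const c) \<notin> constants"
proof
  assume x: "x \<notin> constants" "inverse (x - const c) \<in> constants"
  then obtain d where "inverse (x - const c) = const d" by auto
  then have "x - const c = inverse (const d)" by (metis inverse_inverse_eq)
  then have "x = const (inverse d + c)" by (simp add: diff_eq_eq)
  then show False using x(1) by blast
qed

text \<open>
  If the number of roots is odd, \<open>\<infinity>\<close> is a branch point. The coordinate \<open>1/(x - c)\<close> with \<open>c\<close> not a
  root moves this branch point to \<open>0\<close>.
\<close>

lemma even_form:
  assumes x: "x \<notin> constants" and q: "quad (rat x) b"
  obtains x' y g S where "hyperelliptic x' y S g" "rat x' = rat x" "adj (rat x) y = adj (rat x) b"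
proof -
  obtain y S where S: "finite S" "y\<^sup>2 = root_prod x S" and y: "quad (rat x) y" "adj (rat x) y = adj (rat x) b"
    by (rule hyper_form[OF x q])
  show thesis
  proof (cases "even (card S)")
    case True
    have "card S \<noteq> 0"
    proof
      assume "card S = 0"
      then have "y\<^sup>2 = 1" using S by (simp add: root_prod_def)
      then have "(y - 1) * (y + 1) = 0" by (simp add: power2_eq_square algebra_simps)
      then have "y = const 1 \<or> y = const (- 1)" by (auto simp: eq_neg_iff_add_eq_0)
      then show False using y(1) cf_const[OF cfield_rat] by (auto simp only: quad_def)
    qed
    then have "card S = 2 * (card S div 2 - 1) + 2" using True by presburger
    then have "hyperelliptic x y S (card S div 2 - 1)" using x S by unfold_locales
    then show ?thesis using that y(2) by blast
  next
    case False
    obtain c where c: "c \<notin> S" using S(1) ex_new_if_finite infinite_UNIV_char_0 by blast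
    define x' where "x' = inverse (x - const c)"
    have x': "x' \<notin> constants" "rat x' = rat x"
      using shift_inverse_nonconst[OF x] rat_shift_inverse[OF x] by (auto simp: x'_def)
    define f where "f a = 1 / (a - c)" for a
    have injf: "inj_on f S" by (auto simp: inj_on_def f_def)
    have f0: "0 \<notin> f ` S" using c by (auto simp: f_def)
    have x0: "x' \<noteq> 0" using nonconst_nonzero(2)[OF x'(1)] .
    have lin: "(x - const a) * x' = const (c - a) * (x' - const (f a))" if "a \<in> S" for a
    proof -
      have ac: "a - c \<noteq> 0" using that c by auto
      have "(x - const c) * x' = 1" using nonconst_nonzero(1)[OF x] by (simp add: x'_def)
      then have "(x - const a) * x' = 1 + const (c - a) * x'" by (simp add: algebra_simps)
      moreover have "const (c - a) * const (f a) = - 1"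
      proof -
        have "(c - a) * f a = - 1" using ac by (simp add: f_def field_simps)
        then have "const ((c - a) * f a) = const (- 1)" by simp
        then show ?thesis by (simp del: const_simps(6))
      qed
      ultimately show ?thesis by (simp only: right_diff_distrib) simp
    qed
    define C where "C = (\<Prod>a\<in>S. c - a)"
    have C0: "C \<noteq> 0" using c S(1) by (auto simp: C_def)
    have "(\<Prod>a\<in>S. (x - const a) * x') = (\<Prod>a\<in>S. const (c - a) * (x' - const (f a)))"
      using lin by (intro prod.cong) auto
    then have "root_prod x S * x' ^ card S = const C * (\<Prod>a\<in>S. x' - const (f a))"
      unfolding root_prod_def C_def const_prod by (simp add: prod.distrib)
    also have "(\<Prod>a\<in>S. x' - const (f a)) = root_prod x' (f ` S)"
      unfolding root_prod_def using injf by (simp add: prod.reindex)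
    finally have e: "root_prod x S * x' ^ card S = const C * root_prod x' (f ` S)" .
    define S' where "S' = insert 0 (f ` S)"
    have S': "finite S'" "card S' = Suc (card S)" using S(1) f0 injf by (auto simp: S'_def card_image)
    have e': "root_prod x S * x' ^ Suc (card S) = const C * root_prod x' S'"
      using e f0 S(1) by (simp add: S'_def root_prod_def mult_ac)
    obtain j where j: "Suc (card S) = 2 * j" using False by (metis evenE even_Suc)
    have Cq: "const (csqrt C) ^ 2 = const C" by (simp flip: const_simps(8))
    define l where "l = x' ^ j / const (csqrt C)"
    have xr: "x' \<in> rat x" using gen_in_rat[of x'] unfolding x'(2) .
    have l: "l \<in> rat x" "l \<noteq> 0" using x0 C0 xr by (auto simp: l_def intro!: cf_divide cf_power)
    have "(l * y)\<^sup>2 = (root_prod x S * x' ^ (2 * j)) / const (csqrt C) ^ 2"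
      by (simp add: l_def power_mult_distrib power_divide S(2) power_mult mult.commute[of 2 j] mult_ac)
    also have "\<dots> = root_prod x' S'" unfolding j[symmetric] e' Cq using C0 by simp
    finally have y': "(l * y)\<^sup>2 = root_prod x' S'" .
    have "card S' = 2 * (j - 1) + 2" using S'(2) j by simp
    then have "hyperelliptic x' (l * y) S' (j - 1)" using x'(1) S'(1) y' by unfold_locales
    then show ?thesis using that x'(2) adj_scale(2)[OF y(1) l] y(2) by simp
  qed
qed

text \<open>
  The conic \<open>y\<^sup>2 = x\<^sup>2 - 4\<close> is parametrised by \<open>x = z + 1/z\<close>, \<open>y = z - 1/z\<close>, so the hyperelliptic
  formula with \<open>g = 0\<close> applies.
\<close>

lemma genus_rational:
  assumes z: "z \<notin> constants"
  shows "has_genus (rat z) 0"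
proof -
  define x y where "x = z + inverse z" and "y = z - inverse z"
  have z0: "z \<noteq> 0" using nonconst_nonzero(2)[OF z] .
  have xc: "x \<notin> constants"
  proof
    assume "x \<in> constants"
    then obtain c where "z + inverse z = const c" by (auto simp: x_def)
    then have "(z + inverse z) * z = const c * z" by simp
    moreover have "(z + inverse z) * z = z * z + 1" using z0 by (simp add: distrib_right)
    moreover have "ev z [:1, - c, 1:] = (z * z + 1) - const c * z" by (simp add: algebra_simps)
    ultimately have "ev z [:1, - c, 1:] = 0" by simp
    then show False using ev_nonzero[OF z, of "[:1, - c, 1:]"] by simp
  qed
  have y2: "y\<^sup>2 = root_prod x {2, - 2}"
    using z0 by (simp add: root_prod_def x_def y_def power2_eq_square algebra_simps)
  interpret hyperelliptic x y "{2, - 2}" 0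
    by unfold_locales (use xc y2 in auto)
  have "rat z = K"
  proof
    have "z \<in> K"
    proof -
      have "(x + y) / 2 \<in> K" using cf_K y_K rat_K[of x] by (auto intro: cf)
      then show ?thesis by (simp add: x_def y_def)
    qed
    then show "rat z \<subseteq> K" using rat_least cf_K by blast
    have "x \<in> rat z" "y \<in> rat z" by (auto simp: x_def y_def intro!: cf_add cf_diff cf_inverse)
    then show "K \<subseteq> rat z" unfolding K_def using adj_least[OF cfield_rat] rat_least[OF cfield_rat] by blast
  qed
  then show ?thesis using genus by simp
qed

section \<open>Automorphisms of hyperelliptic fields of genus at least two\<close>

context hyperelliptic
begin

lemma ord_x_ge: "R \<in> points K \<Longrightarrow> ord_at R x \<ge> - inf_div R"
proof (rule points_rat_cases[OF x K_restrict[of R]])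
  assume R: "R \<in> points K"
  note o = ord_K[OF R gen_in_rat nonconst_nonzero(2)[OF x]]
  {
    fix a assume "R \<inter> rat x = pt x a"
    then show ?thesis using o ord_pt_linear[OF x, of a 0] inf_div_eq[OF R] pt_neq_inf ram_pos[of R] by simp
  }
  assume i: "R \<inter> rat x = pt_inf x"
  then show ?thesis using o ord_pt_inf_linear[OF x, of 0] inf_div_eq[OF R] unram_inf[OF R i] by simp
qed

lemma ord_auto_x:
  assumes s: "auto_on K s" and R: "R \<in> points K"
  shows "ord_at R (s x) = ord_at (s ` R) x"
    "ord_at R (s x) \<ge> - (point_div (s ` Q_inf) R + point_div (s ` iota ` Q_inf) R)"
proof -
  have iQ: "iota ` Q_inf \<in> points K" using auto_on_point(1)[OF cf_K auto_iota Q_inf(1)] .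
  have x0: "x \<noteq> 0" using nonconst_nonzero(2)[OF x] .
  show o0: "ord_at R (s x) = ord_at (s ` R) x"
    using ord_at_auto[OF laur_K s R rat_K[OF gen_in_rat] x0] by simp
  have "\<dots> \<ge> - inf_div (s ` R)" using ord_x_ge auto_on_point(1)[OF cf_K s R] by blast
  also have "inf_div (s ` R) = point_div (s ` Q_inf) R + point_div (s ` iota ` Q_inf) R"
    using point_div_auto[OF cf_K s _ R] Q_inf(1) iQ by (simp add: fibre_div_def)
  finally show "ord_at R (s x) \<ge> - (point_div (s ` Q_inf) R + point_div (s ` iota ` Q_inf) R)" using o0 by simp
qed

text \<open>
  The hyperelliptic pencil is unique. The function \<open>x' = s x\<close> has simple poles at two points, so
  the poles of \<open>h = x' - \<iota> x'\<close> are bounded by two fibres over the line. As fibres are linearly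
  equivalent to the one at infinity, \<open>h\<close> times a function of the line has poles bounded by twice
  the divisor at infinity. For \<open>g \<ge> 2\<close> it then comes from the line by \<open>small_poles_in_rat\<close>, so it
  is \<open>\<iota>\<close>-invariant; but \<open>h\<close> is anti-invariant. Hence \<open>h = 0\<close>.
\<close>

lemma auto_preserves_line:
  assumes g: "g \<ge> 2" and s: "auto_on K s"
  shows "s x \<in> rat x"
proof -
  define x' where "x' = s x"
  have xK: "x \<in> K" using rat_K by simp
  have x0: "x \<noteq> 0" using nonconst_nonzero(2)[OF x] .
  have x': "x' \<in> K" "x' \<noteq> 0" using auto_on_simps(1)[OF s xK] auto_on_more(6)[OF cf_K s xK] x0 by (auto simp: x'_def)
  define Q1 Q2 where "Q1 = s ` Q_inf" and "Q2 = s ` iota ` Q_inf"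
  have iQ: "iota ` Q_inf \<in> points K" using auto_on_point(1)[OF cf_K auto_iota Q_inf(1)] .
  have Q: "Q1 \<in> points K" "Q2 \<in> points K"
    using auto_on_point(1)[OF cf_K s] Q_inf(1) iQ by (auto simp: Q1_def Q2_def)
  have o1: "ord_at R x' \<ge> - (point_div Q1 R + point_div Q2 R)" if "R \<in> points K" for R
    using ord_auto_x(2)[OF s that] by (simp add: x'_def Q1_def Q2_def)
  have i: "iota x' \<in> K" "iota x' \<noteq> 0"
    using auto_on_simps(1)[OF auto_iota x'(1)] auto_on_more(6)[OF cf_K auto_iota x'(1)] x'(2) by auto
  have o2: "ord_at R (iota x') \<ge> - (point_div (iota ` Q1) R + point_div (iota ` Q2) R)" if R: "R \<in> points K" for R
    using ord_at_auto[OF laur_K auto_iota R x'] o1[OF auto_on_point(1)[OF cf_K auto_iota R]]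
      point_div_auto[OF cf_K auto_iota _ R] Q by simp
  define h where "h = x' - iota x'"
  have hK: "h \<in> K" using x' i cf_K by (auto simp: h_def intro: cf)
  have nn: "point_div A B \<ge> 0" for A B by (simp add: point_div_def)
  have oh: "ord_at R h \<ge> - (fibre_div Q1 R + fibre_div Q2 R)" if R: "R \<in> points K" and "h \<noteq> 0" for R
  proof -
    have "- iota x' \<in> K" "- iota x' \<noteq> 0" "ord_at R (- iota x') = ord_at R (iota x')"
      using i cf_K ord_minus[OF laur_K R i] by (auto intro: cf)
    moreover have "- (fibre_div Q1 R + fibre_div Q2 R) \<le> ord_at R x'" "- (fibre_div Q1 R + fibre_div Q2 R) \<le> ord_at R (iota x')"
      using o1[OF R] o2[OF R] nn[of Q1 R] nn[of Q2 R] nn[of "iota ` Q1" R] nn[of "iota ` Q2" R]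
      by (auto simp: fibre_div_def)
    ultimately show ?thesis using ord_add[OF laur_K R x', of "- iota x'"] \<open>h \<noteq> 0\<close> by (simp add: h_def)
  qed
  obtain w1 where w1: "w1 \<in> rat x" "w1 \<noteq> 0" "\<And>R. R \<in> points K \<Longrightarrow> ord_at R w1 = fibre_div Q1 R - inf_div R"
    by (rule fibre_div_principal[OF Q(1)]) blast
  obtain w2 where w2: "w2 \<in> rat x" "w2 \<noteq> 0" "\<And>R. R \<in> points K \<Longrightarrow> ord_at R w2 = fibre_div Q2 R - inf_div R"
    by (rule fibre_div_principal[OF Q(2)]) blast
  have wK: "w1 * w2 \<in> K" "w1 * w2 \<noteq> 0" "w1 * w2 \<in> rat x" using w1 w2 rat_K[OF w1(1)] rat_K[OF w2(1)] cf_K by (auto intro: cf_mult)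
  have "h * (w1 * w2) \<in> rat x"
  proof (rule small_poles_in_rat[of _ 2])
    show "h * (w1 * w2) \<in> K" using hK wK cf_K by (auto intro: cf)
    fix R assume R: "R \<in> points K" and "h * (w1 * w2) \<noteq> 0"
    then have h0: "h \<noteq> 0" by auto
    have "ord_at R (h * (w1 * w2)) = ord_at R h + (ord_at R w1 + ord_at R w2)"
      using ord_mult[OF laur_K R hK h0 wK(1,2)] ord_mult[OF laur_K R rat_K[OF w1(1)] w1(2) rat_K[OF w2(1)] w2(2)] by simp
    then show "- int 2 * inf_div R \<le> ord_at R (h * (w1 * w2))"
      using oh[OF R h0] w1(3)[OF R] w2(3)[OF R] by simp
  qed (rule g)
  then have "h * (w1 * w2) / (w1 * w2) \<in> rat x" using wK by (intro cf_divide) auto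
  then have hr: "h \<in> rat x" using wK(2) by simp
  have "iota h = h" using conj_base[OF quad_y hr] by (simp add: iota_def)
  moreover have "iota h = - h"
    using auto_on_more(2)[OF cf_K auto_iota x'(1) i(1)] auto_on_simps(2)[OF auto_iota x'(1)] by (simp add: h_def)
  ultimately have "2 * h = 0" by (simp add: eq_neg_iff_add_eq_0)
  then have "iota x' = x'" by (simp add: h_def)
  then show ?thesis
    using conj_fixed[OF quad_y, of x'] x'(1) by (simp add: iota_def K_def x'_def)
qed

text \<open>
  The transformed coordinate lies on the line and has a single simple pole there, either at \<open>\<infinity>\<close> or
  at a finite point \<open>c\<close>.
\<close>

lemma auto_moebius:
  assumes g: "g \<ge> 2" and s: "auto_on K s"
  obtains a b where "s x = const a * x + const b" | a b c where "(x - const c) * s x = const a * x + const b"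
proof -
  define x' where "x' = s x"
  have xr: "x' \<in> rat x" using auto_preserves_line[OF g s] by (simp add: x'_def)
  have xK: "x \<in> K" using rat_K by simp
  have x0: "x \<noteq> 0" using nonconst_nonzero(2)[OF x] .
  have x': "x' \<in> K" "x' \<noteq> 0" using auto_on_simps(1)[OF s xK] auto_on_more(6)[OF cf_K s xK] x0 by (auto simp: x'_def)
  define Q1 Q2 where "Q1 = s ` Q_inf" and "Q2 = s ` iota ` Q_inf"
  have iQ: "iota ` Q_inf \<in> points K" using auto_on_point(1)[OF cf_K auto_iota Q_inf(1)] .
  have Q: "Q1 \<in> points K" "Q2 \<in> points K"
    using auto_on_point(1)[OF cf_K s] Q_inf(1) iQ by (auto simp: Q1_def Q2_def)
  have o0: "ord_at R x' = ord_at (s ` R) x"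
    and o1: "ord_at R x' \<ge> - (point_div Q1 R + point_div Q2 R)" if "R \<in> points K" for R
    using ord_auto_x[OF s that] by (simp_all add: x'_def Q1_def Q2_def)
  \<comment> \<open>the pole at \<open>Q1\<close> is simple, so \<open>Q1\<close> is unramified over the line and its conjugate is the
      other pole\<close>
  have "ord_at Q1 x' = ord_at Q_inf x" using o0[OF Q(1)] auto_on_point(2)[OF cf_K s Q_inf(1)] by (simp add: Q1_def)
  also have "\<dots> = -1" using ord_K[OF Q_inf(1) gen_in_rat x0] unram_inf[OF Q_inf] Q_inf(2) ord_pt_inf_linear[OF x, of 0] by simp
  finally have m1: "ram Q1 * ord_at (Q1 \<inter> rat x) x' = -1" using ord_K[OF Q(1) xr x'(2)] by simp
  then have r1: "ram Q1 = 1" "ord_at (Q1 \<inter> rat x) x' = -1" by (auto simp: ram_def split: if_splits) presburger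
  have ine: "iota ` Q_inf \<noteq> Q_inf" using unram_inf[OF Q_inf] by (auto simp: ram_def)
  have Q12: "Q1 \<noteq> Q2" using ine auto_on_point(2)[OF cf_K s] Q_inf(1) iQ unfolding Q1_def Q2_def by metis
  define i1 where "i1 = iota ` Q1"
  have i1: "i1 \<in> points K" using auto_on_point(1)[OF cf_K auto_iota Q(1)] by (simp add: i1_def)
  have "i1 \<noteq> Q1" using r1(1) by (auto simp: ram_def i1_def)
  have "ord_at i1 x' = ram i1 * ord_at (Q1 \<inter> rat x) x'"
    using ord_K[OF i1 xr x'(2)] iota_restrict[OF Q(1)] by (simp add: i1_def)
  then have "ord_at i1 x' < 0" using r1(2) ram_pos[of i1] by simp
  then have "i1 = Q2" using o1[OF i1] \<open>i1 \<noteq> Q1\<close> by (auto simp: point_div_def split: if_splits)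
  then have same: "Q2 \<inter> rat x = Q1 \<inter> rat x" using iota_restrict[OF Q(1)] by (simp add: i1_def)
  have o2: "ord_at P x' \<ge> (if P = Q1 \<inter> rat x then -1 else 0)" if P: "P \<in> points (rat x)" for P
  proof (cases "P = Q1 \<inter> rat x")
    case False
    obtain R where R: "R \<in> points K" "R \<inter> rat x = P" using above[OF P] by blast
    then have "R \<noteq> Q1" "R \<noteq> Q2" using False same by auto
    then have "ram R * ord_at P x' \<ge> 0" using o1[OF R(1)] ord_K[OF R(1) xr x'(2)] R(2) by (simp add: point_div_def)
    then show ?thesis using False ram_pos[of R] by (simp add: zero_le_mult_iff)
  qed (use r1(2) in simp)
  have lin: "\<exists>a b. f = const a * x + const b"
    if f: "f \<in> rat x" "f \<noteq> 0" "\<And>a. ord_at (pt x a) f \<ge> 0" "ord_at (pt_inf x) f \<ge> -1" for f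
  proof -
    obtain p where p: "f = ev x p" "p \<noteq> 0" using regular_imp_polynomial[OF x f(1-3)] by blast
    then have "degree p \<le> 1" using f(4) ord_pt_inf_ev[OF x p(2)] by simp
    then have "p = [:coeff p 0, coeff p 1:]"
      by (intro poly_eqI) (auto simp: coeff_pCons coeff_eq_0 split: nat.split)
    then have "f = ev x [:coeff p 0, coeff p 1:]" using p(1) by simp
    then show ?thesis by (intro exI[of _ "coeff p 1"] exI[of _ "coeff p 0"]) (simp add: mult.commute add.commute)
  qed
  show thesis
  proof (rule points_rat_cases[OF x K_restrict[OF Q(1)]])
    fix c assume c: "Q1 \<inter> rat x = pt x c"
    define f where "f = (x - const c) * x'"
    have l: "x - const c \<in> rat x" "x - const c \<noteq> 0" using nonconst_nonzero(1)[OF x] by (auto intro: cf)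
    have om: "ord_at P f = ord_at P (x - const c) + ord_at P x'" if "P \<in> points (rat x)" for P
      unfolding f_def using ord_mult[OF laur_k that l xr x'(2)] .
    have "\<exists>a b. f = const a * x + const b"
    proof (rule lin)
      show "f \<in> rat x" "f \<noteq> 0" using l xr x' by (auto simp: f_def intro: cf_mult)
      show "ord_at (pt x a) f \<ge> 0" for a
        using om[OF pt_in_points[OF x]] o2[OF pt_in_points[OF x]] ord_pt_linear[OF x, of a c] pt_inj[of a c] c
        by (smt (verit))
      show "ord_at (pt_inf x) f \<ge> -1"
        using om[OF pt_inf_in_points[OF x]] o2[OF pt_inf_in_points[OF x]] ord_pt_inf_linear[OF x, of c] c pt_neq_inf[of c]
        by (smt (verit))
    qed
    then show thesis using that(2) by (auto simp: f_def x'_def)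
  next
    assume i: "Q1 \<inter> rat x = pt_inf x"
    have "\<exists>a b. x' = const a * x + const b"
    proof (rule lin[OF xr x'(2)])
      show "ord_at (pt x a) x' \<ge> 0" for a
        using o2[OF pt_in_points[OF x], of a] i pt_neq_inf[of a] by simp
      show "ord_at (pt_inf x) x' \<ge> -1"
        using o2[OF pt_inf_in_points[OF x]] i by simp
    qed
    then show thesis using that(1) by (auto simp: x'_def)
  qed
qed

text \<open>
  A Moebius involution is conjugate to \<open>t \<mapsto> - t\<close>. If it fixes \<open>\<infinity>\<close> it is \<open>x \<mapsto> b - x\<close>. Otherwise it
  is \<open>w \<mapsto> m/w\<close> for \<open>w = x - c\<close>, with fixed points the two square roots of \<open>m\<close>, and \<open>t\<close> is the
  coordinate with these at \<open>0\<close> and \<open>\<infinity>\<close>.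
\<close>

lemma auto_diagonal:
  assumes g: "g \<ge> 2" and s: "auto_on K s" and sx: "s x \<noteq> x"
  obtains t where "t \<notin> constants" "rat t = rat x" "s t = - t"
proof -
  define x' where "x' = s x"
  have xK: "x \<in> K" using rat_K by simp
  have x'K: "x' \<in> K" and sx': "s x' = x" using auto_on_simps(1,2)[OF s xK] by (auto simp: x'_def)
  have ne: "x - x' \<noteq> 0" using sx by (auto simp: x'_def)
  have cK: "const c \<in> K" for c using cf_K by simp
  have sadd: "s (u + v) = s u + s v" "s (u * v) = s u * s v" "s (u - v) = s u - s v" if "u \<in> K" "v \<in> K" for u v
    using auto_on_simps(3,4)[OF s that(1)] auto_on_more(2)[OF cf_K s that(1)] that by auto
  have sc: "s (const c) = const c" for c using auto_on_const(1)[OF s] .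
  note cl = cf_add[OF cf_K] cf_mult[OF cf_K] cf_diff[OF cf_K]
  show thesis
  proof (rule auto_moebius[OF g s])
    fix a b assume e: "s x = const a * x + const b"
    then have 1: "x' = const a * x + const b" by (simp add: x'_def)
    then have "s x' = s (const a * x + const b)" by simp
    then have 2: "x = const a * x' + const b" using sadd xK cK cl sc sx' by (simp add: x'_def)
    \<comment> \<open>subtract the equation from its image under \<open>s\<close>\<close>
    have "x - x' = (const a * x' + const b) - (const a * x + const b)" using 1 2 by metis
    then have "(x - x') * (1 + const a) = 0" by (simp add: algebra_simps)
    then have "const (1 + a) = 0" using ne by simp
    then have "a = - 1" by (simp del: const_simps(3) add: eq_neg_iff_add_eq_0 add.commute)
    then have 3: "x' = const b - x" using 1 by simp
    define t where "t = x - const (b / 2)"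
    have bb: "const b = const (b / 2) + const (b / 2)" by (simp flip: const_simps(3))
    have "s t = x' - const (b / 2)"
      unfolding t_def x'_def using sadd(3)[OF xK cK] sc by metis
    then have "s t = - t" unfolding 3 by (subst (asm) bb) (simp add: t_def)
    moreover have "t \<notin> constants"
    proof
      assume "t \<in> constants"
      then have "t + const (b / 2) \<in> constants" by (intro cf_add[OF cfield_constants] cf_const[OF cfield_constants])
      then show False using x by (simp add: t_def)
    qed
    moreover have "rat t = rat x"
    proof (rule rat_eqI)
      show "t \<in> rat x" unfolding t_def by (intro cf_diff cf_const cfield_rat gen_in_rat)
      have "t + const (b / 2) \<in> rat t" by (intro cf_add cf_const cfield_rat gen_in_rat)
      then show "x \<in> rat t" by (simp add: t_def)
    qed
    ultimately show thesis using that by blast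
  next
    fix a b c assume e: "(x - const c) * s x = const a * x + const b"
    then have 1: "(x - const c) * x' = const a * x + const b" by (simp add: x'_def)
    then have "s ((x - const c) * x') = s (const a * x + const b)" by simp
    then have 2: "(x' - const c) * x = const a * x' + const b"
      using sadd xK x'K cK cl sc sx' by (simp add: x'_def)
    \<comment> \<open>subtract the equation from its image under \<open>s\<close>\<close>
    have "(x - const c) * x' - (x' - const c) * x = const a * x - const a * x'" unfolding 1 2 by simp
    then have "(x - x') * (const c - const a) = 0" by (simp add: algebra_simps)
    then have ac: "a = c" using ne by simp
    define m where "m = b + c\<^sup>2"
    define w w' where "w = x - const c" and "w' = x' - const c"
    have XX: "w * w' = const m"
      using 1 unfolding ac w_def w'_def m_def by (simp add: algebra_simps power2_eq_square)
    have sX: "s w = w'" using sadd xK cK sc by (simp add: w_def w'_def x'_def)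
    have X0: "w \<noteq> 0" using nonconst_nonzero(1)[OF x] by (simp add: w_def)
    have XK: "w \<in> K" using xK cK cl by (simp add: w_def)
    have m0: "m \<noteq> 0"
    proof
      assume "m = 0"
      then have "w' = 0" using XX X0 by simp
      then show False using sX auto_on_more(6)[OF cf_K s XK] X0 by simp
    qed
    define mu where "mu = csqrt m"
    have mu: "mu\<^sup>2 = m" "mu \<noteq> 0" using m0 by (auto simp: mu_def)
    have XC: "w \<notin> constants"
    proof
      assume "w \<in> constants"
      then have "w + const c \<in> constants" by (intro cf_add[OF cfield_constants]) auto
      then show False using x by (simp add: w_def)
    qed
    have Xmu: "w + const mu \<noteq> 0" "w - const mu \<noteq> 0"
      using nonconst_nonzero(1)[OF XC, of "- mu"] nonconst_nonzero(1)[OF XC, of mu] by auto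
    define t where "t = (w - const mu) / (w + const mu)"
    have t1: "t * (w + const mu) = w - const mu" using Xmu by (simp add: t_def)
    have "w * (1 - t) = const mu * (1 + t)" using t1 by (simp add: algebra_simps)
    moreover have t1': "1 - t \<noteq> 0"
    proof
      assume "1 - t = 0"
      then have "w + const mu = w - const mu" using t1 by simp
      then have "2 * const mu = 0" by (simp add: algebra_simps)
      then show False using mu by simp
    qed
    ultimately have Xt: "w = const mu * (1 + t) / (1 - t)" by (simp add: field_simps)
    have "t \<notin> constants"
    proof
      assume "t \<in> constants"
      then have "w \<in> constants" unfolding Xt by (intro cf_divide cf_mult cf_add cf_diff cfield_constants cf_1 cf_const)
      then show False using XC by simp
    qed
    moreover have "rat t = rat x"
    proof (rule rat_eqI)
      show "t \<in> rat x" unfolding t_def w_def by (intro cf_divide cf_diff cf_add cf_const) auto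
      have "const mu * (1 + t) / (1 - t) + const c \<in> rat t"
        by (intro cf_divide cf_mult cf_add cf_diff cf_1 cf_const) auto
      then show "x \<in> rat t" unfolding Xt[symmetric] by (simp add: w_def)
    qed
    moreover have "s t = - t"
    proof -
      have i: "w + const mu \<in> K" "w - const mu \<in> K" using XK cK cl by auto
      have "s t = (w' - const mu) / (w' + const mu)"
        unfolding t_def using auto_on_more(4)[OF cf_K s i(1,2)] sadd XK cK sc sX by simp
      also have "\<dots> = (w * (w' - const mu)) / (w * (w' + const mu))" using X0 by simp
      also have "w * (w' - const mu) = - const mu * (w - const mu)"
        using XX by (simp add: algebra_simps mu(1)[symmetric] power2_eq_square)
      also have "w * (w' + const mu) = const mu * (w + const mu)"
        using XX by (simp add: algebra_simps mu(1)[symmetric] power2_eq_square)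
      also have "- const mu * (w - const mu) / (const mu * (w + const mu)) = - t"
        using mu(2) by (simp add: t_def)
      finally show ?thesis .
    qed
    ultimately show thesis using that by blast
  qed
qed

end

section \<open>The normal form of a bielliptic curve of genus two\<close>

text \<open>
  Roots of a polynomial in \<open>t\<^sup>2\<close>, in terms of its roots as a polynomial in \<open>u = t\<^sup>2\<close>.
\<close>

definition square_roots :: "complex set \<Rightarrow> complex set"
  where "square_roots T = {s. s\<^sup>2 \<in> T}"

lemma root_prod_square_roots:
  assumes "finite T" "0 \<notin> T"
  shows "finite (square_roots T) \<and> card (square_roots T) = 2 * card T \<and> root_prod x (square_roots T) = root_prod (x\<^sup>2) T"
  using assms
proof (induction T rule: finite_induct)
  case (insert a T)
  define r where "r = csqrt a"
  have r: "r\<^sup>2 = a" "r \<noteq> 0" using insert(4) by (auto simp: r_def)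
  have rr: "r \<noteq> - r" using r(2) by (simp add: eq_neg_iff_add_eq_0)
  have "s\<^sup>2 = a \<longleftrightarrow> s = r \<or> s = - r" for s using r(1) by (metis power2_eq_iff)
  then have e: "square_roots (insert a T) = insert r (insert (- r) (square_roots T))"
    by (auto simp: square_roots_def)
  have n: "r \<notin> square_roots T" "- r \<notin> square_roots T" using r insert(2) by (auto simp: square_roots_def)
  have IH: "finite (square_roots T)" "card (square_roots T) = 2 * card T" "root_prod x (square_roots T) = root_prod (x\<^sup>2) T"
    using insert by auto
  have "(x - const r) * (x - const (- r)) = x\<^sup>2 - const a"
    by (simp add: r(1)[symmetric] power2_eq_square algebra_simps)
  moreover have "root_prod x (insert r (insert (- r) (square_roots T))) =
      (x - const r) * (x - const (- r)) * root_prod x (square_roots T)"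
    unfolding root_prod_def using n IH(1) rr by (simp add: mult.assoc del: const_simps(5))
  moreover have "root_prod (x\<^sup>2) (insert a T) = (x\<^sup>2 - const a) * root_prod (x\<^sup>2) T"
    unfolding root_prod_def using insert(1,2) by simp
  ultimately have "root_prod x (square_roots (insert a T)) = root_prod (x\<^sup>2) (insert a T)"
    unfolding e IH(3)[symmetric] by (simp only:)
  moreover have "finite (square_roots (insert a T))" "card (square_roots (insert a T)) = 2 * card (insert a T)"
    unfolding e using n IH rr insert(1,2) by auto
  ultimately show ?case by simp
qed (auto simp: square_roots_def root_prod_def)

lemma square_nonconst: "t \<notin> constants \<Longrightarrow> t\<^sup>2 \<notin> constants"
proof
  assume t: "t \<notin> constants" "t\<^sup>2 \<in> constants"
  then obtain d where "t\<^sup>2 = const d" by auto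
  then have "t\<^sup>2 = (const (csqrt d))\<^sup>2" using power2_csqrt[of d] by (metis const_simps(8))
  then have "t = const (csqrt d) \<or> t = const (- csqrt d)" by (simp add: power2_eq_iff)
  then show False using t by blast
qed

lemma root_prod_uminus:
  assumes "finite S"
  shows "root_prod (- x) S = const ((- 1) ^ card S) * root_prod x (uminus ` S)"
proof -
  have "root_prod x (uminus ` S) = (\<Prod>a\<in>S. x + const a)" by (simp add: root_prod_def prod.reindex)
  moreover have "root_prod (- x) S = (\<Prod>a\<in>S. (- 1) * (x + const a))" unfolding root_prod_def by (rule prod.cong) auto
  moreover have "\<dots> = (- 1) ^ card S * (\<Prod>a\<in>S. x + const a)" by (simp only: prod.distrib prod_constant)
  ultimately show ?thesis by simp
qed

text \<open>
  The map \<open>s \<mapsto> - s\<close> has no fixed point on \<open>S\<close>.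
\<close>

lemma even_card_symmetric:
  assumes "finite S" "uminus ` S = S" "(0::complex) \<notin> S"
  shows "S = square_roots ((\<lambda>s. s\<^sup>2) ` S)" "0 \<notin> (\<lambda>s. s\<^sup>2) ` S" "even (card S)"
proof -
  have "t \<in> S" if "t\<^sup>2 = s\<^sup>2" "s \<in> S" for s t
    using that assms(2) by (metis image_eqI power2_eq_iff)
  then show e: "S = square_roots ((\<lambda>s. s\<^sup>2) ` S)" by (auto simp: square_roots_def)
  show z: "0 \<notin> (\<lambda>s. s\<^sup>2) ` S" using assms(3) by auto
  show "even (card S)" using root_prod_square_roots[OF _ z] assms(1) e by (metis dvd_triv_left finite_imageI)
qed

text \<open>
  As \<open>s\<close> preserves the line, it multiplies \<open>y\<close> by a function \<open>v\<close> of the line with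
  \<open>v\<^sup>2 = \<plusminus> \<Prod>(x + a) / \<Prod>(x - a)\<close>. Comparing parities of orders, the set of roots is symmetric and
  \<open>v\<close> is constant. If \<open>0\<close> were a root, their number would be odd and \<open>v\<^sup>2 = -1\<close>, contradicting
  \<open>s (s y) = y\<close>.
\<close>

lemma diagonal_form:
  assumes t: "t \<notin> constants" and q: "quad (rat t) b" and s: "auto_on (adj (rat t) b) s" and st: "s t = - t"
  obtains y T where "finite T" "0 \<notin> T" "y\<^sup>2 = root_prod (t\<^sup>2) T" "y\<^sup>2 = root_prod t (square_roots T)"
    "adj (rat t) y = adj (rat t) b" "quad (rat t) y"
proof -
  define K where "K = adj (rat t) b"
  have cK: "cfield K" using quad_cfield_adj[OF q] by (simp add: K_def)
  have s: "auto_on K s" using s by (simp add: K_def)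
  obtain y S where S: "finite S" "y\<^sup>2 = root_prod t S" and y: "quad (rat t) y" "adj (rat t) y = K"
    using hyper_form[OF t q] unfolding K_def by metis
  have rK: "f \<in> K" if "f \<in> rat t" for f using base_in_adj[OF cfield_rat that, of y] y(2) by simp
  have yK: "y \<in> K" using gen_in_adj[OF cfield_rat, of y t] y(2) by simp
  have y0: "y \<noteq> 0" using quad_nonzero[OF y(1)] .
  have mt: "- t \<in> rat t" by (intro cf_uminus) auto
  have sev: "s (ev t p) = ev (- t) p" for p using auto_on_ev[OF cK s rK[OF gen_in_rat]] st by simp
  have srat: "s f \<in> rat t" if fr: "f \<in> rat t" for f
  proof -
    obtain p r where f: "r \<noteq> 0" "f = ev t p / ev t r" by (rule rat_cases[OF t fr])
    have "s f = ev (- t) p / ev (- t) r"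
      unfolding f(2) using auto_on_more(4)[OF cK s rK[OF ev_in_rat] rK[OF ev_in_rat]] sev by simp
    then show ?thesis using ev_in[OF cfield_rat mt] by (auto intro: cf_divide)
  qed
  have sy: "s y \<in> K" "s (s y) = y" using auto_on_simps(1,2)[OF s yK] by auto
  have sy2: "(s y)\<^sup>2 = const ((- 1) ^ card S) * root_prod t (uminus ` S)"
  proof -
    have "(s y)\<^sup>2 = s (y\<^sup>2)" using auto_on_more(5)[OF cK s yK] by simp
    also have "\<dots> = s (ev t (\<Prod>a\<in>S. [:- a, 1:]))" unfolding S(2) ev_prod_linear ..
    also have "\<dots> = ev (- t) (\<Prod>a\<in>S. [:- a, 1:])" by (rule sev)
    also have "\<dots> = root_prod (- t) S" by (rule ev_prod_linear)
    finally show ?thesis using root_prod_uminus[OF S(1)] by simp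
  qed
  obtain u v where uv: "u \<in> rat t" "v \<in> rat t" "s y = u + v * y" using sy(1) y(2) adjE by metis
  have "s y \<notin> rat t"
  proof
    assume "s y \<in> rat t"
    then have "y \<in> rat t" using srat sy(2) by metis
    then show False using y(1) by (simp add: quad_def)
  qed
  have Y: "y\<^sup>2 \<in> rat t" using y(1) by (simp add: quad_def)
  have "u\<^sup>2 + v\<^sup>2 * y\<^sup>2 + (2 * u * v) * y = (s y)\<^sup>2 + 0 * y"
    using uv(3) by (simp add: power2_eq_square algebra_simps)
  moreover have "u\<^sup>2 + v\<^sup>2 * y\<^sup>2 \<in> rat t" "2 * u * v \<in> rat t" "(s y)\<^sup>2 \<in> rat t" "0 \<in> rat t"
    using uv Y root_prod_in[OF cfield_rat gen_in_rat, of t "uminus ` S"] unfolding sy2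
    by (auto intro!: cf_add cf_mult cf_power cf_numeral cf_0 simp del: const_simps)
  ultimately have "2 * u * v = 0" using quad_unique[OF y(1)] by blast
  moreover have "v \<noteq> 0" using \<open>s y \<notin> rat t\<close> uv by auto
  ultimately have u0: "u = 0" by simp
  then have syv: "s y = v * y" using uv(3) by simp
  have vS: "const ((- 1) ^ card S) * root_prod t (uminus ` S) = v\<^sup>2 * root_prod t S"
    using sy2 S(2) syv by (simp add: power_mult_distrib)
  note L = laur_rat[OF t] and P = pt_in_points[OF t]
  have sfr: "root_prod t A \<in> rat t" "root_prod t A \<noteq> 0" for A using root_prod_in[OF cfield_rat gen_in_rat] root_prod_nonzero[OF t] by auto
  have par: "(if a \<in> uminus ` S then 1 else 0) = 2 * ord_at (pt t a) v + (if a \<in> S then 1 else 0)" for a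
  proof -
    have c0: "(- 1 :: complex) ^ card S \<noteq> 0" by simp
    have "ord_at (pt t a) (const ((- 1) ^ card S) * root_prod t (uminus ` S)) = ord_at (pt t a) (root_prod t (uminus ` S))"
      using ord_mult[OF L P[of a] _ _ sfr, of "const ((- 1) ^ card S)" "uminus ` S"]
        ord_const[OF L P[of a] sfr c0] const_simps(7)[of "(- 1) ^ card S"] cf_const[OF cfield_rat] c0
      by (simp del: const_simps)
    moreover have "ord_at (pt t a) (v\<^sup>2 * root_prod t S) = 2 * ord_at (pt t a) v + ord_at (pt t a) (root_prod t S)"
      using ord_mult[OF L P[of a] cf_power[OF cfield_rat uv(2), of 2] _ sfr[of S]] ord_power[OF L P[of a] uv(2) \<open>v \<noteq> 0\<close>, of 2] \<open>v \<noteq> 0\<close>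
      by simp
    ultimately show ?thesis using vS ord_pt_root_prod[OF t, of _ a] S(1) by simp
  qed
  have sym: "uminus ` S = S"
  proof (intro Set.set_eqI)
    fix a show "a \<in> uminus ` S \<longleftrightarrow> a \<in> S" using par[of a] by (auto split: if_splits) presburger+
  qed
  have v2: "v\<^sup>2 = const ((- 1) ^ card S)" using vS sym sfr[of S] by simp
  have "0 \<notin> S"
  proof
    assume z: "0 \<in> S"
    have "uminus ` (S - {0}) = uminus ` S - uminus ` {0}" by (rule image_set_diff) simp
    then have "uminus ` (S - {0}) = S - {0}" using sym by simp
    then have "even (card (S - {0}))" using even_card_symmetric(3)[of "S - {0}"] S(1) by simp
    then have "odd (card S)" using z S(1) by (metis card_Suc_Diff1 even_Suc)
    then have v1: "v\<^sup>2 = - 1" using v2 by simp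
    then have "v\<^sup>2 = (const \<i>)\<^sup>2" by (simp flip: const_simps(8))
    then obtain c where vc: "v = const c" by (metis power2_eq_iff const_simps(5))
    have "s (s y) = s v * s y" unfolding syv using auto_on_simps(4)[OF s _ yK] rK[OF uv(2)] syv by simp
    also have "s v = v" using auto_on_const(1)[OF s] vc by simp
    finally have "y = v\<^sup>2 * y" using sy(2) syv by (simp add: power2_eq_square mult.assoc)
    then have "2 * y = 0" unfolding v1 by (simp add: eq_neg_iff_add_eq_0)
    then show False using y0 by simp
  qed
  note E = even_card_symmetric[OF S(1) sym this]
  define T where "T = (\<lambda>s. s\<^sup>2) ` S"
  have T: "finite T" "0 \<notin> T" "S = square_roots T" using E S(1) by (auto simp: T_def)
  show thesis
    using that[OF T(1,2), of y] root_prod_square_roots[OF T(1,2), of t] S(2) T(3) y K_def by simp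
qed

text \<open>
  The Moebius transformation with \<open>a, b, c \<mapsto> 0, 1, \<infinity>\<close>; it maps \<open>\<infinity>\<close> to \<open>p\<close> and \<open>0\<close> to \<open>p a / c\<close>.
\<close>

lemma moebius_identities:
  fixes a b c u :: "'a::field"
  assumes "u \<noteq> c" "b \<noteq> a" "c \<noteq> 0"
  defines "p \<equiv> (b - c) / (b - a)"
  defines "z \<equiv> p * ((u - a) / (u - c))"
  shows "z - 1 = (a - c) / (b - a) * ((u - b) / (u - c))"
    "z - p = p * (c - a) / (u - c)"
    "z - p * a / c = p * (c - a) / c * (u / (u - c))"
proof -
  have n: "u - c \<noteq> 0" "b - a \<noteq> 0" using assms by auto
  have "z = (b - c) * (u - a) / ((b - a) * (u - c))"
    by (simp only: z_def p_def times_divide_times_eq)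
  then have "z - 1 = ((b - c) * (u - a) - (b - a) * (u - c)) / ((b - a) * (u - c))"
    using n by (simp add: divide_diff_eq_iff)
  also have "(b - c) * (u - a) - (b - a) * (u - c) = (a - c) * (u - b)" by (simp add: algebra_simps)
  finally show "z - 1 = (a - c) / (b - a) * ((u - b) / (u - c))" by simp
  have z: "z = p * (u - a) / (u - c)" by (simp only: z_def times_divide_eq_right)
  have "z - p = (p * (u - a) - p * (u - c)) / (u - c)" unfolding z using n(1) by (rule divide_diff_eq_iff)
  also have "p * (u - a) - p * (u - c) = p * (c - a)" by (simp add: algebra_simps)
  finally show "z - p = p * (c - a) / (u - c)" .
  have "z - p * a / c = (p * (u - a) * c - p * a * (u - c)) / (c * (u - c))"
    unfolding z using diff_frac_eq[OF n(1) assms(3), of "p * (u - a)" "p * a"] by (simp only: mult.commute)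
  also have "p * (u - a) * c - p * a * (u - c) = p * (c - a) * u" by (simp add: algebra_simps)
  finally show "z - p * a / c = p * (c - a) / c * (u / (u - c))" by simp
qed

text \<open>
  An element \<open>p + q a\<close> with square in \<open>k\<close> has \<open>p = 0\<close> or \<open>q = 0\<close>, so \<open>b\<close> could lie in \<open>k(a)\<close> only
  if \<open>b\<close> or \<open>a b\<close> lay in \<open>k\<close>.
\<close>

lemma biquadI:
  assumes L: "laurent_field k" and a: "a\<^sup>2 \<in> k" "a \<noteq> 0" "P1 \<in> points k" "odd (ord_at P1 (a\<^sup>2))"
    and b: "b\<^sup>2 \<in> k" "b \<noteq> 0" "P2 \<in> points k" "odd (ord_at P2 (b\<^sup>2))"
    and ab: "P3 \<in> points k" "odd (ord_at P3 ((a * b)\<^sup>2))"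
  shows "biquad k a b"
proof -
  have k: "cfield k" using L laur_cfield by blast
  have qa: "quad k a" using quad_of_odd[OF L a(3,1,2,4)] .
  have qb: "quad k b" using quad_of_odd[OF L b(3,1,2,4)] .
  have "(a * b)\<^sup>2 \<in> k" using a(1) b(1) k by (auto simp: power_mult_distrib intro: cf_mult)
  then have qc: "quad k (a * b)" using quad_of_odd[OF L ab(1) _ _ ab(2)] a(2) b(2) by simp
  have "b \<notin> adj k a"
  proof
    assume "b \<in> adj k a"
    then obtain p q where pq: "p \<in> k" "q \<in> k" "b = p + q * a" by (rule adjE)
    have "p\<^sup>2 + q\<^sup>2 * a\<^sup>2 + (2 * p * q) * a = b\<^sup>2 + 0 * a"
      using pq(3) by (simp add: power2_eq_square algebra_simps)
    moreover have "p\<^sup>2 + q\<^sup>2 * a\<^sup>2 \<in> k" "2 * p * q \<in> k" "0 \<in> k"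
      using pq a(1) k by (auto intro!: cf_add cf_mult cf_power cf_numeral cf_0)
    ultimately have "2 * p * q = 0" using quad_unique[OF qa] b(1) by blast
    then consider "p = 0" | "q = 0" by auto
    then show False
    proof cases
      case 1
      then have "a * b = q * a\<^sup>2" using pq(3) by (simp add: power2_eq_square algebra_simps)
      then have "a * b \<in> k" using pq(2) a(1) k by (auto intro: cf_mult)
      then show False using qc by (simp add: quad_def)
    next
      case 2
      then show False using pq qb by (simp add: quad_def)
    qed
  qed
  then have "quad (adj k a) b"
    using quad_cfield_adj[OF qa] base_in_adj[OF k b(1)] by (simp add: quad_def)
  then show ?thesis using L qa b(1) by unfold_locales
qed

lemma root_prod_insert: "finite S \<Longrightarrow> a \<notin> S \<Longrightarrow> root_prod x (insert a S) = (x - const a) * root_prod x S"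
  by (auto simp: root_prod_def)

text \<open>
  The bielliptic involution \<open>s\<close> moves the hyperelliptic coordinate, for otherwise its fixed field
  \<open>E\<close> would be the rational field \<open>\<complex>(x)\<close>. So there is a coordinate \<open>t\<close> with \<open>s t = - t\<close>, the
  equation is \<open>Y\<^sup>2 = (t\<^sup>2 - a1) (t\<^sup>2 - a2) (t\<^sup>2 - a3)\<close>, with three factors because the genus is
  two, and \<open>z\<close> is the coordinate on the line of \<open>u = t\<^sup>2\<close> with \<open>a1, a2, a3\<close> at \<open>0, 1, \<infinity>\<close>. The
  branch points \<open>p\<close> and \<open>r\<close> are the places of \<open>u = \<infinity>\<close> and \<open>u = 0\<close>; \<open>e1\<close> and \<open>e2\<close> are \<open>Y\<close> and \<open>t Y\<close>
  up to a factor from \<open>\<complex>(u)\<close>.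
\<close>

theorem bielliptic_normal_form:
  assumes gen: "has_genus (adj (rat x) b) 2" and x: "x \<notin> constants" and q: "quad (rat x) b"
    and E: "quad E c" "adj E c = adj (rat x) b" "E \<noteq> rat x"
  obtains z p r e1 e2 where "z \<notin> constants" "p \<noteq> 0" "p \<noteq> 1" "r \<noteq> 0" "r \<noteq> 1" "p \<noteq> r"
    "e1\<^sup>2 = root_prod z {0, 1, p}" "e2\<^sup>2 = root_prod z {0, 1, r}"
    "biquad (rat z) e1 e2" "adj (adj (rat z) e1) e2 = adj (rat x) b" "adj (rat z) (e1 * e2) = rat x"
proof -
  define K where "K = adj (rat x) b"
  define s where "s = conj E c"
  have cE: "cfield E" using E(1) by (simp add: quad_def)
  have s: "auto_on K s" using auto_on_conj[OF E(1)] E(2) by (simp add: s_def K_def)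
  obtain x' y g S where H: "hyperelliptic x' y S g" and x': "rat x' = rat x" "adj (rat x) y = K"
    using even_form[OF x q] unfolding K_def by metis
  interpret H: hyperelliptic x' y S g by fact
  have HK: "H.K = K" using x' by (simp add: H.K_def)
  have cK: "cfield K" using H.cf_K HK by simp
  have g: "g = 2" using has_genus_unique[OF H.genus, of 2] gen HK by (simp add: K_def)
  have "s x' \<noteq> x'"
  proof
    \<comment> \<open>two subfields of index two, one inside the other, coincide\<close>
    assume fx: "s x' = x'"
    have "x' \<in> K" using H.rat_K[OF gen_in_rat] HK by simp
    then have "x' \<in> E" using conj_fixed[OF E(1)] fx E(2) by (simp add: s_def K_def)
    then have sub: "rat x \<subseteq> E" using rat_least[OF cE] x'(1) by metis
    have "E \<subseteq> rat x"
    proof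
      fix f assume f: "f \<in> E"
      have "f \<in> adj (rat x) b" using base_in_adj[OF cE f, of c] E(2) by simp
      then obtain u v where uv: "u \<in> rat x" "v \<in> rat x" "f = u + v * b" by (rule adjE)
      show "f \<in> rat x"
      proof (cases "v = 0")
        case False
        then have "b = (f - u) / v" using uv(3) by simp
        moreover have "(f - u) / v \<in> E" using f uv sub by (intro cf_divide cf_diff cE) auto
        ultimately have "adj (rat x) b \<subseteq> E" using adj_least[OF cE sub] by simp
        then have "c \<in> E" using gen_in_adj[OF cE, of c] E(2) by blast
        then show ?thesis using E(1) by (simp add: quad_def)
      qed (use uv in simp)
    qed
    then show False using sub E(3) by blast
  qed
  then obtain t where t: "t \<notin> constants" "rat t = rat x" "s t = - t"
    using H.auto_diagonal[of s] g s HK x'(1) by (metis order_refl)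
  obtain Y T where T: "finite T" "0 \<notin> T" and Y: "Y\<^sup>2 = root_prod (t\<^sup>2) T" "Y\<^sup>2 = root_prod t (square_roots T)"
    "adj (rat t) Y = K" "quad (rat t) Y"
    using diagonal_form[OF t(1), of b s] q t s unfolding K_def by metis
  have sq: "finite (square_roots T)" "card (square_roots T) = 2 * card T" using root_prod_square_roots[OF T] by auto
  have "card T \<noteq> 0"
  proof
    assume "card T = 0"
    then have "Y\<^sup>2 = 1" using Y T by (simp add: root_prod_def)
    then have "(Y - 1) * (Y + 1) = 0" by (simp add: power2_eq_square algebra_simps)
    then have "Y = const 1 \<or> Y = const (- 1)" by (auto simp: eq_neg_iff_add_eq_0)
    then show False using Y(4) cf_const[OF cfield_rat] by (auto simp only: quad_def)
  qed
  then have "hyperelliptic t Y (square_roots T) (card T - 1)"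
    using t(1) sq Y(2) by unfold_locales auto
  then interpret H2: hyperelliptic t Y "square_roots T" "card T - 1" .
  have "H2.K = K" using Y(3) by (simp add: H2.K_def)
  then have "card T - 1 = 2" using has_genus_unique[OF H2.genus, of 2] gen by (simp add: K_def)
  then have "card T = 3" by simp
  then obtain a1 a2 a3 where T3: "T = {a1, a2, a3}" and d: "a1 \<noteq> a2" "a1 \<noteq> a3" "a2 \<noteq> a3"
    by (metis card_3_iff)
  have nz: "a1 \<noteq> 0" "a2 \<noteq> 0" "a3 \<noteq> 0" using T(2) T3 by auto
  define u where "u = t\<^sup>2"
  have u: "u \<notin> constants" using square_nonconst[OF t(1)] by (simp add: u_def)
  have Yu: "Y\<^sup>2 = (u - const a1) * (u - const a2) * (u - const a3)"
    using Y(1) T3 d by (simp add: u_def root_prod_def mult.assoc)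
  have n3: "u - const a3 \<noteq> 0" using nonconst_nonzero(1)[OF u] .
  define p r where "p = (a2 - a3) / (a2 - a1)" and "r = p * a1 / a3"
  define z where "z = const p * ((u - const a1) / (u - const a3))"
  note I = moebius_identities[of u "const a3" "const a2" "const a1"]
  have z1: "z - const 1 = const ((a1 - a3) / (a2 - a1)) * ((u - const a2) / (u - const a3))"
    and zp: "z - const p = const (p * (a3 - a1)) / (u - const a3)"
    and zr: "z - const r = const (p * (a3 - a1) / a3) * (u / (u - const a3))"
    using I n3 d nz by (auto simp: z_def p_def r_def)
  have pr: "p \<noteq> 0" "p \<noteq> 1" "r \<noteq> 0" using d nz by (auto simp: p_def r_def)
  moreover have "p * a3 \<noteq> p * a1" using d pr by simp
  ultimately have pr: "p \<noteq> 0" "p \<noteq> 1" "r \<noteq> 0" "p \<noteq> r" using nz by (auto simp: r_def eq_divide_eq)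
  have "r \<noteq> 1"
  proof
    assume "r = 1"
    then have "(a2 - a3) * a1 = (a2 - a1) * a3" using d nz by (simp add: r_def p_def field_simps)
    then have "a2 * (a1 - a3) = 0" by (simp add: algebra_simps)
    then show False using d nz by simp
  qed
  define k1 where "k1 = p * ((a1 - a3) / (a2 - a1)) * (p * (a3 - a1))"
  define k2 where "k2 = p * ((a1 - a3) / (a2 - a1)) * (p * (a3 - a1) / a3)"
  have k0: "k1 \<noteq> 0" "k2 \<noteq> 0" using pr d nz by (auto simp: k1_def k2_def)
  define e1 where "e1 = const (csqrt k1) * Y / (u - const a3)\<^sup>2"
  define e2 where "e2 = const (csqrt k2) * t * Y / (u - const a3)\<^sup>2"
  have ck: "const (csqrt k) ^ 2 = const k" for k by (metis const_simps(8) power2_csqrt)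
  have e1: "e1\<^sup>2 = root_prod z {0, 1, p}"
  proof -
    have "e1\<^sup>2 = const k1 * Y\<^sup>2 / (u - const a3) ^ 4"
      by (simp add: e1_def power_mult_distrib power_divide ck flip: power_mult)
    also have "\<dots> = const k1 * ((u - const a1) * (u - const a2)) / (u - const a3) ^ 3"
      unfolding Yu using n3 by (simp add: power_numeral_reduce)
    also have "\<dots> = z * (z - const 1) * (z - const p)"
      unfolding z1 zp unfolding z_def k1_def by (simp add: power_numeral_reduce mult_ac)
    also have "\<dots> = root_prod z {0, 1, p}" using pr by (simp add: root_prod_def mult.assoc)
    finally show ?thesis .
  qed
  have e2: "e2\<^sup>2 = root_prod z {0, 1, r}"
  proof -
    have "e2\<^sup>2 = const k2 * u * Y\<^sup>2 / (u - const a3) ^ 4"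
      by (simp add: e2_def power_mult_distrib power_divide ck u_def flip: power_mult)
    also have "\<dots> = const k2 * u * ((u - const a1) * (u - const a2)) / (u - const a3) ^ 3"
      unfolding Yu using n3 by (simp add: power_numeral_reduce)
    also have "\<dots> = z * (z - const 1) * (z - const r)"
      unfolding z1 zr unfolding z_def k2_def by (simp add: power_numeral_reduce mult_ac)
    also have "\<dots> = root_prod z {0, 1, r}" using pr \<open>r \<noteq> 1\<close> by (simp add: root_prod_def mult.assoc)
    finally show ?thesis .
  qed
  have znp: "z - const p \<noteq> 0" using zp pr d n3 by simp
  have uz: "u = const (p * (a3 - a1)) / (z - const p) + const a3"
    unfolding zp using n3 pr d by simp
  have zc: "z \<notin> constants"
  proof
    assume "z \<in> constants"
    then have "u \<in> constants" unfolding uz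
      by (intro cf_add cf_divide cf_diff cfield_constants cf_const) auto
    then show False using u by simp
  qed
  have rzu: "rat z = rat u"
  proof (rule rat_eqI)
    show "z \<in> rat u" unfolding z_def by (intro cf_mult cf_divide cf_diff cf_const) auto
    have "const (p * (a3 - a1)) / (z - const p) + const a3 \<in> rat z"
      by (intro cf_add cf_divide cf_diff cf_const) auto
    then show "u \<in> rat z" using uz by metis
  qed
  have Y0: "Y \<noteq> 0" using quad_nonzero[OF Y(4)] .
  have t0: "t \<noteq> 0" using nonconst_nonzero(2)[OF t(1)] .
  have e0: "e1 \<noteq> 0" "e2 \<noteq> 0" using Y0 t0 n3 k0 by (auto simp: e1_def e2_def)
  have sfz: "root_prod z A \<in> rat z" for A using root_prod_in[OF cfield_rat gen_in_rat] .
  have o12: "odd (ord_at (pt z p) ((e1 * e2)\<^sup>2))"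
    using ord_mult[OF laur_rat[OF zc] pt_in_points[OF zc, of p] sfz root_prod_nonzero[OF zc] sfz root_prod_nonzero[OF zc], of "{0, 1, p}" "{0, 1, r}"]
      ord_pt_root_prod[OF zc, of "{0, 1, p}" p] ord_pt_root_prod[OF zc, of "{0, 1, r}" p] e1 e2 pr
    by (simp add: power_mult_distrib)
  have bq: "biquad (rat z) e1 e2"
    by (rule biquadI[OF laur_rat[OF zc] _ e0(1) pt_in_points[OF zc, of 0] _ _ e0(2) pt_in_points[OF zc, of 0] _
          pt_in_points[OF zc, of p] o12])
      (use e1 e2 sfz ord_pt_root_prod[OF zc, of "{0, 1, p}" 0] ord_pt_root_prod[OF zc, of "{0, 1, r}" 0] in auto)
  interpret B: biquad "rat z" e1 e2 by fact
  have tK: "t \<in> K" "Y \<in> K" "u \<in> K" using H2.rat_K[OF gen_in_rat] H2.y_K \<open>H2.K = K\<close> cK by (auto simp: u_def intro: cf_power)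
  have e1K: "e1 \<in> K" "e2 \<in> K" "z \<in> K" unfolding e1_def e2_def z_def
    by (intro cf_divide cf_mult cf_diff cf_power cf_const cK tK)+
  have "B.M = K"
  proof
    have "rat z \<subseteq> K" using rat_least[OF cK e1K(3)] .
    then show "B.M \<subseteq> K" unfolding B.M_def using adj_least[OF cK] e1K by blast
    have k: "f \<in> B.M" if "f \<in> rat z" for f using B.K1_M B.k_K1 that by blast
    have e1M: "e1 \<in> B.M" "e2 \<in> B.M" using B.K1_M B.a_K1 B.b_M by auto
    have uM: "u \<in> B.M" using k rzu gen_in_rat by metis
    have "t = const (csqrt k1) * e2 / (const (csqrt k2) * e1)"
      using Y0 n3 k0 by (simp add: e1_def e2_def)
    moreover have "const (csqrt k1) * e2 / (const (csqrt k2) * e1) \<in> B.M"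
      by (intro cf_divide cf_mult cf_const B.cf_M e1M)
    ultimately have tM: "t \<in> B.M" by metis
    have "Y = e1 * (u - const a3)\<^sup>2 / const (csqrt k1)" using n3 k0 by (simp add: e1_def)
    moreover have "e1 * (u - const a3)\<^sup>2 / const (csqrt k1) \<in> B.M"
      by (intro cf_divide cf_mult cf_const cf_power cf_diff B.cf_M e1M uM)
    ultimately have "Y \<in> B.M" by metis
    then show "K \<subseteq> B.M" unfolding Y(3)[symmetric] using adj_least[OF B.cf_M] rat_least[OF B.cf_M tM] by blast
  qed
  moreover have "B.K3 = rat x"
  proof
    define l where "l = const (csqrt k1 * csqrt k2) * Y\<^sup>2 / (u - const a3) ^ 4"
    have l: "l \<in> rat z" "l \<noteq> 0"
    proof -
      have "Y\<^sup>2 \<in> rat u" unfolding Yu by (intro cf_mult cf_diff cf_const) auto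
      moreover have "(u - const a3) ^ 4 \<in> rat u" by (intro cf_power cf_diff cf_const) auto
      ultimately show "l \<in> rat z" unfolding rzu l_def by (intro cf_divide cf_mult cf_const cfield_rat)
      show "l \<noteq> 0" using Y0 n3 k0 by (simp add: l_def)
    qed
    have e12: "e1 * e2 = l * t" by (simp add: e1_def e2_def l_def power2_eq_square power_numeral_reduce mult_ac)
    have "t \<in> rat t" by simp
    have "u \<in> rat t" by (auto simp: u_def intro: cf_power)
    then have "rat z \<subseteq> rat x" unfolding rzu using rat_least[of "rat t" u] t(2) by simp
    moreover have "e1 * e2 \<in> rat x" unfolding e12 using l(1) calculation \<open>t \<in> rat t\<close> t(2) by (auto intro: cf_mult)
    ultimately show "B.K3 \<subseteq> rat x" unfolding B.K3_def using adj_least[OF cfield_rat] by blast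
    have "e1 * e2 / l \<in> B.K3"
      using gen_in_adj[OF cfield_rat, of "e1 * e2" z] B.k_K3[OF l(1)] B.cf_K3 by (auto simp: B.K3_def intro: cf_divide)
    then have "t \<in> B.K3" unfolding e12 using l(2) by simp
    then show "rat x \<subseteq> B.K3" using rat_least[OF B.cf_K3] t(2) by metis
  qed
  ultimately show thesis
    using that[OF zc pr(1,2,3) \<open>r \<noteq> 1\<close> pr(4) e1 e2 bq] by (simp add: B.M_def B.K3_def K_def)
qed

section \<open>Fibres\<close>

definition fibre :: "func set \<Rightarrow> func set \<Rightarrow> func set \<Rightarrow> func set set"
  where "fibre M k P = {Q \<in> points M. Q \<inter> k = P}"

lemma fibre_quad:
  assumes L: "laurent_field k" and q: "quad k b" and P: "P \<in> points k"
  shows "finite (fibre (adj k b) k P)" "card (fibre (adj k b) k P) = (if odd (ord_at P (b\<^sup>2)) then 1 else 2)"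
proof -
  obtain Q where Q: "Q \<in> points (adj k b)" "Q \<inter> k = P" using quad_point_above[OF L q P] by blast
  have "conj k b ` Q \<in> points (adj k b)"
    using auto_on_point(1)[OF quad_cfield_adj[OF q] auto_on_conj[OF q] Q(1)] .
  then have e: "fibre (adj k b) k P = {Q, conj k b ` Q}"
  proof (intro subset_antisym subsetI)
    fix Q' assume "Q' \<in> fibre (adj k b) k P"
    then have "Q' \<in> points (adj k b)" "Q' \<inter> k = Q \<inter> k" using Q(2) by (simp_all only: fibre_def mem_Collect_eq)
    then show "Q' \<in> {Q, conj k b ` Q}" using quad_fibre[OF L q Q(1)] by blast
  next
    fix Q' assume "Q' \<in> {Q, conj k b ` Q}"
    then show "Q' \<in> fibre (adj k b) k P"
      using \<open>conj k b ` Q \<in> points (adj k b)\<close> Q quad_conj_restrict[OF L q Q(1)] unfolding fibre_def by blast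
  qed
  then show "finite (fibre (adj k b) k P)" by simp
  show "card (fibre (adj k b) k P) = (if odd (ord_at P (b\<^sup>2)) then 1 else 2)"
  proof (cases "conj k b ` Q = Q")
    case True
    then have "card {Q, conj k b ` Q} = 1" by simp
    then show ?thesis unfolding e using quad_ramified[OF L q Q(1)] Q(2) True by simp
  next
    case False
    then have "card {Q, conj k b ` Q} = 2" by (metis card_2_iff)
    then show ?thesis unfolding e using quad_ramified[OF L q Q(1)] Q(2) False by simp
  qed
qed

lemma fibre_tower:
  assumes "k \<subseteq> l" "\<And>Q. Q \<in> points M \<Longrightarrow> Q \<inter> l \<in> points l"
  shows "fibre M k P = (\<Union>R\<in>fibre l k P. fibre M l R)"
proof
  have e: "Q \<inter> l \<inter> k = Q \<inter> k" for Q using assms(1) by blast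
  show "fibre M k P \<subseteq> (\<Union>R\<in>fibre l k P. fibre M l R)"
  proof
    fix Q assume "Q \<in> fibre M k P"
    then have "Q \<inter> l \<in> fibre l k P" "Q \<in> fibre M l (Q \<inter> l)" using assms(2) e by (auto simp: fibre_def)
    then show "Q \<in> (\<Union>R\<in>fibre l k P. fibre M l R)" by blast
  qed
  show "(\<Union>R\<in>fibre l k P. fibre M l R) \<subseteq> fibre M k P" using e by (auto simp: fibre_def)
qed

lemma fibre_disjoint: "R \<noteq> R' \<Longrightarrow> fibre M l R \<inter> fibre M l R' = {}"
  by (auto simp: fibre_def)

section \<open>Conics\<close>

text \<open>
  Parametrise the conic \<open>f\<^sup>2 = (z - a) (z - b)\<close> by lines through its point \<open>z = b\<close>:
  \<open>m = f / (z - b)\<close>.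
\<close>

lemma conic_rational:
  assumes z: "z \<notin> constants" and a: "f\<^sup>2 = (z - const a) * (z - const b)" "a \<noteq> b" and q: "quad (rat z) f"
  obtains m where "m \<notin> constants" "adj (rat z) f = rat m"
proof -
  have n: "z - const b \<noteq> 0" using nonconst_nonzero(1)[OF z] .
  define m where "m = f / (z - const b)"
  have m2: "m\<^sup>2 * (z - const b) = z - const a" using a(1) n by (simp add: m_def power_divide power2_eq_square)
  have m1: "1 - m\<^sup>2 \<noteq> 0"
  proof
    assume "1 - m\<^sup>2 = 0"
    then have "z - const b = z - const a" using m2 by simp
    then show False using a(2) by simp
  qed
  have "z * (1 - m\<^sup>2) = const a - const b * m\<^sup>2" using m2 by (simp add: algebra_simps)
  then have zm: "z = (const a - const b * m\<^sup>2) / (1 - m\<^sup>2)" using m1 by (simp add: eq_divide_eq)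
  have zin: "z \<in> K" if "cfield K" "m \<in> K" for K
    unfolding zm using that by (intro cf_divide cf_diff cf_mult cf_power cf_const cf_1)
  have "m \<notin> constants" using zin[OF cfield_constants] z by blast
  moreover have "adj (rat z) f = rat m"
  proof
    have fm: "f = m * (z - const b)" using n by (simp add: m_def)
    have "f \<in> rat m" unfolding fm by (intro cf_mult cf_diff cf_const cfield_rat zin gen_in_rat)
    then show "adj (rat z) f \<subseteq> rat m"
      using adj_least[OF cfield_rat] rat_least[OF cfield_rat zin[OF cfield_rat gen_in_rat]] by blast
    have "m \<in> adj (rat z) f"
      unfolding m_def by (intro cf_divide cf_diff cf_const quad_cfield_adj[OF q] gen_in_adj base_in_adj cfield_rat gen_in_rat)
    then show "rat m \<subseteq> adj (rat z) f" using rat_least[OF quad_cfield_adj[OF q]] by blast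
  qed
  ultimately show thesis using that by blast
qed

lemma rational_torsion':
  assumes "K = rat m" "m \<notin> constants" "P \<in> points K" "Q \<in> points K"
  shows "torsion_difference K P Q"
  using rational_torsion assms by simp

lemma torsion_difference_auto:
  assumes L: "laurent_field M" and s: "auto_on M s" and P: "P \<in> points M" "Q \<in> points M" and t: "torsion_difference M P Q"
  shows "torsion_difference M (s ` P) (s ` Q)"
proof -
  have K: "cfield M" using laur_cfield[OF L] .
  have "tors M (\<lambda>R. pdiff P Q (s ` R))"
    using tors_auto[OF L s] t torsion_difference_iff_tors[OF P] by simp
  then have "tors M (pdiff (s ` P) (s ` Q))"
    using tors_cong[of M "\<lambda>R. pdiff P Q (s ` R)" "pdiff (s ` P) (s ` Q)"] point_div_auto[OF K s] P by simp
  then show ?thesis using torsion_difference_iff_tors auto_on_point(1)[OF K s] P by blast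
qed

section \<open>Pulling an elliptic curve back along the four-to-one cover of the line\<close>

text \<open>
  Being torsion relative to the base point \<open>W\<close>, as a condition on points of the line. If \<open>W\<close> is a
  ramification point, all points above \<open>R\<close> behave alike (\<open>tau_all\<close>).
\<close>

definition torsion_over :: "func \<Rightarrow> func set \<Rightarrow> func set \<Rightarrow> func set \<Rightarrow> bool"
  where "torsion_over z E W R \<longleftrightarrow> (\<exists>P\<in>points E. P \<inter> rat z = R \<and> torsion_difference E P W)"

text \<open>
  The four-to-one cover of the \<open>z\<close>-line by the \<open>w\<close>-line, as the tower of the square roots \<open>s\<close> of
  \<open>z\<close> and \<open>r\<close> of \<open>z - 1\<close>.
\<close>

locale cover =
  fixes z s r :: func
  assumes z: "z \<notin> constants" and s2: "s\<^sup>2 = z" and r2: "r\<^sup>2 = z - 1"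
begin

text \<open>
  As \<open>(s + r) (s - r) = 1\<close>, both \<open>s\<close> and \<open>r\<close> are rational in \<open>w\<close>: \<open>s = (w + 1/w) / 2\<close> and
  \<open>r = (w - 1/w) / 2\<close>.
\<close>

definition "w = s + r"

lemma s_const: "s \<notin> constants" using z cf_power[OF cfield_constants, of s 2] s2 by metis
lemma s0: "s \<noteq> 0" using nonconst_nonzero(2)[OF s_const] .
lemma r0: "r \<noteq> 0" using r2 nonconst_nonzero(1)[OF z, of 1] by auto

lemma quad_s: "quad (rat z) s"
  by (rule quad_of_odd[OF laur_rat[OF z] pt_in_points[OF z, of 0] _ s0])
    (use s2 ord_pt_linear[OF z, of 0 0] in auto)

lemma z_in_s: "z \<in> rat s" using s2 cf_power[OF cfield_rat gen_in_rat, of s 2] by simp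

lemma rat_s: "adj (rat z) s = rat s"
proof
  show "adj (rat z) s \<subseteq> rat s" using adj_least[OF cfield_rat] rat_least[OF cfield_rat z_in_s] by simp
  show "rat s \<subseteq> adj (rat z) s" using rat_least[OF quad_cfield_adj[OF quad_s] gen_in_adj[OF cfield_rat]] .
qed

lemma r2': "r\<^sup>2 = root_prod s {1, - 1}"
  unfolding r2 s2[symmetric] by (simp add: root_prod_def power2_eq_square algebra_simps)

lemma quad_r: "quad (rat s) r"
  by (rule quad_of_odd[OF laur_rat[OF s_const] pt_in_points[OF s_const, of 1] _ r0])
    (use r2' ord_pt_root_prod[OF s_const, of "{1, - 1}" 1] root_prod_in[OF cfield_rat gen_in_rat, of s "{1, - 1}"] in auto)

lemma inverse_w: "w * (s - r) = 1"
proof -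
  have "w * (s - r) = s\<^sup>2 - r\<^sup>2" by (simp add: w_def power2_eq_square algebra_simps)
  then show ?thesis using s2 r2 by simp
qed

lemma w0: "w \<noteq> 0" using inverse_w by auto

lemma sr_w: "s = (w + inverse w) / 2" "r = (w - inverse w) / 2"
proof -
  have "inverse w = s - r" using inverse_w by (simp add: inverse_unique)
  then show "s = (w + inverse w) / 2" "r = (w - inverse w) / 2" by (auto simp: w_def)
qed

lemma sr_in: "cfield K \<Longrightarrow> w \<in> K \<Longrightarrow> s \<in> K" "cfield K \<Longrightarrow> w \<in> K \<Longrightarrow> r \<in> K"
  using cf_divide[OF _ cf_add[OF _ _ cf_inverse[of K w]] cf_numeral[of K "num.Bit0 num.One"], of w]
    cf_divide[OF _ cf_diff[OF _ _ cf_inverse[of K w]] cf_numeral[of K "num.Bit0 num.One"], of w]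
  unfolding sr_w[symmetric] by auto

lemma w_const: "w \<notin> constants" using sr_in(1)[OF cfield_constants] s_const by blast

lemma rat_w: "adj (rat s) r = rat w"
proof
  have c: "cfield (adj (rat s) r)" using quad_cfield_adj[OF quad_r] .
  show "adj (rat s) r \<subseteq> rat w"
    using adj_least[OF cfield_rat] rat_least[OF cfield_rat] sr_in[OF cfield_rat gen_in_rat] by blast
  have "w \<in> adj (rat s) r" unfolding w_def
    by (intro cf_add c gen_in_adj base_in_adj cfield_rat gen_in_rat)
  then show "rat w \<subseteq> adj (rat s) r" using rat_least[OF c] by blast
qed

lemma z_s: "rat z \<subseteq> rat s" using rat_least[OF cfield_rat z_in_s] .
lemma s_w: "rat s \<subseteq> rat w" using rat_least[OF cfield_rat sr_in(1)[OF cfield_rat gen_in_rat]] .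

lemma w_point_s: "R \<in> points (rat w) \<Longrightarrow> R \<inter> rat s \<in> points (rat s)"
  using quad_restrict_point[OF quad_r] rat_w by simp

lemma w_point_z: "R \<in> points (rat w) \<Longrightarrow> R \<inter> rat z \<in> points (rat z)"
  using quad_restrict_point[OF quad_s, of "R \<inter> rat s"] w_point_s[of R] rat_s z_s
  by (simp add: Int_assoc inf.absorb2)

text \<open>
  The step from \<open>z\<close> to \<open>s\<close> is ramified where \<open>z\<close> has odd order. There the order of \<open>z - 1\<close> doubles,
  so the second step is unramified; in no case are both steps ramified.
\<close>

lemma fibre_w:
  assumes R: "R \<in> points (rat z)"
  shows "finite (fibre (rat w) (rat z) R)"
    "card (fibre (rat w) (rat z) R) \<ge> 2"
    "even (ord_at R z) \<Longrightarrow> even (ord_at R (z - 1)) \<Longrightarrow> card (fibre (rat w) (rat z) R) = 4"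
proof -
  note Fs = fibre_quad[OF laur_rat[OF z] quad_s R, unfolded rat_s s2]
  have Fw: "finite (fibre (rat w) (rat s) S)" "card (fibre (rat w) (rat s) S) = (if odd (ord_at S (r\<^sup>2)) then 1 else 2)"
    if "S \<in> fibre (rat s) (rat z) R" for S
    using fibre_quad[OF laur_rat[OF s_const] quad_r, of S] rat_w that by (auto simp: fibre_def)
  have T: "fibre (rat w) (rat z) R = (\<Union>S\<in>fibre (rat s) (rat z) R. fibre (rat w) (rat s) S)"
    using fibre_tower[OF z_s w_point_s] .
  show "finite (fibre (rat w) (rat z) R)" unfolding T using Fs(1) Fw(1) by blast
  have C: "card (fibre (rat w) (rat z) R) = (\<Sum>S\<in>fibre (rat s) (rat z) R. card (fibre (rat w) (rat s) S))"
    unfolding T by (rule card_UN_disjoint) (use Fs(1) Fw(1) fibre_disjoint in auto)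
  have z1: "z - 1 \<in> rat z" "z - 1 \<noteq> 0"
    using nonconst_nonzero(1)[OF z, of 1] cf_diff[OF cfield_rat gen_in_rat cf_1[OF cfield_rat]] by auto
  have ordS: "ord_at S (r\<^sup>2) = (if odd (ord_at R z) then 2 else 1) * ord_at R (z - 1)"
    if S: "S \<in> fibre (rat s) (rat z) R" for S
  proof -
    have S': "S \<in> points (adj (rat z) s)" "S \<inter> rat z = R" using S rat_s by (auto simp: fibre_def)
    show ?thesis unfolding r2
      using quad_ord[OF laur_rat[OF z] quad_s S'(1) z1] quad_ramified[OF laur_rat[OF z] quad_s S'(1)] S'(2) s2 by simp
  qed
  show "card (fibre (rat w) (rat z) R) \<ge> 2"
  proof (cases "odd (ord_at R z)")
    case True
    then have "card (fibre (rat w) (rat s) S) = 2" if "S \<in> fibre (rat s) (rat z) R" for S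
      using Fw(2)[OF that] ordS[OF that] by simp
    then show ?thesis using C Fs(2) True by simp
  next
    case False
    have "card (fibre (rat w) (rat s) S) \<ge> 1" if "S \<in> fibre (rat s) (rat z) R" for S
      using Fw(2)[OF that] by simp
    then have "(\<Sum>S\<in>fibre (rat s) (rat z) R. card (fibre (rat w) (rat s) S)) \<ge> (\<Sum>S\<in>fibre (rat s) (rat z) R. 1)"
      by (intro sum_mono) auto
    then show ?thesis using C Fs(2) False by simp
  qed
  assume e: "even (ord_at R z)" "even (ord_at R (z - 1))"
  then have "card (fibre (rat w) (rat s) S) = 2" if "S \<in> fibre (rat s) (rat z) R" for S
    using Fw(2)[OF that] ordS[OF that] by simp
  then show "card (fibre (rat w) (rat z) R) = 4" using C Fs(2) e by simp
qed

end

text \<open>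
  The elliptic curve \<open>E: e\<^sup>2 = z (z - 1) (z - p)\<close> and its pullback \<open>E'\<close> to the \<open>w\<close>-line, generated
  by \<open>h = e / (s r)\<close>, a square root of \<open>z - p\<close>. The map from \<open>E'\<close> to \<open>E\<close> is the composite of two
  isogenies of degree two, with intermediate curve \<open>\<complex>(s, r h)\<close>.
\<close>

locale pulled_back = cover +
  fixes e :: func and p :: complex
  assumes p: "p \<noteq> 0" "p \<noteq> 1" and e2: "e\<^sup>2 = root_prod z {0, 1, p}"
begin

definition "E = adj (rat z) e"
definition "h = e / (s * r)"
definition "E' = adj (rat w) h"

lemma e0: "e \<noteq> 0" using e2 root_prod_nonzero[OF z, of "{0, 1, p}"] by auto
lemma h0: "h \<noteq> 0" using e0 s0 r0 by (simp add: h_def)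
lemma srh: "s * (r * h) = e" using s0 r0 by (simp add: h_def)

lemma sfz: "root_prod z A \<in> rat z" using root_prod_in[OF cfield_rat gen_in_rat] .

lemma quad_e: "quad (rat z) e"
  by (rule quad_of_odd[OF laur_rat[OF z] pt_in_points[OF z, of 0] _ e0])
    (use e2 sfz ord_pt_root_prod[OF z, of "{0, 1, p}" 0] in auto)

lemma h2: "h\<^sup>2 = z - const p"
proof -
  have "e\<^sup>2 = z * (z - 1) * (z - const p)" using e2 p by (simp add: root_prod_def mult.assoc)
  moreover have "z \<noteq> 0" "z - 1 \<noteq> 0" using nonconst_nonzero[OF z] nonconst_nonzero(1)[OF z, of 1] by auto
  ultimately show ?thesis by (simp add: h_def power_divide power_mult_distrib s2 r2)
qed

definition "m = csqrt p"
definition "n = csqrt (p - 1)"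

lemma m2: "m\<^sup>2 = p" "m \<noteq> 0" using p by (auto simp: m_def)
lemma n2: "n\<^sup>2 = p - 1" "n \<noteq> 0" using p by (auto simp: n_def)

lemma m_ne: "m \<noteq> 1" "m \<noteq> - 1" "m \<noteq> - m" "- m \<noteq> 1"
proof -
  have "m\<^sup>2 \<noteq> 1" using m2 p by simp
  then show "m \<noteq> 1" "m \<noteq> - 1" by auto
  then show "- m \<noteq> 1" by (metis minus_minus)
  show "m \<noteq> - m" using m2 by (simp add: eq_neg_iff_add_eq_0)
qed

lemma h2': "h\<^sup>2 = root_prod s {m, - m}"
proof -
  have "const m * const m = const p" using m2(1) by (simp add: power2_eq_square flip: const_simps(4))
  then show ?thesis unfolding h2 s2[symmetric] using m_ne(3) by (simp add: root_prod_def power2_eq_square algebra_simps)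
qed

lemma rh2: "(r * h)\<^sup>2 = root_prod z {1, p}"
  using p by (simp add: power_mult_distrib r2 h2 root_prod_def)

lemma B1: "biquad (rat z) s (r * h)"
  by (rule biquadI[OF laur_rat[OF z] _ s0 pt_in_points[OF z, of 0] _ _ _ pt_in_points[OF z, of 1] _
        pt_in_points[OF z, of 0]])
    (use s2 rh2 sfz ord_pt_linear[OF z, of 0 0] ord_pt_root_prod[OF z, of "{1, p}" 1] r0 h0 srh e2
      ord_pt_root_prod[OF z, of "{0, 1, p}" 0] in auto)

lemma B2: "biquad (rat s) r h"
proof (rule biquadI[OF laur_rat[OF s_const] _ r0 pt_in_points[OF s_const, of 1] _ _ h0 pt_in_points[OF s_const, of m] _
        pt_in_points[OF s_const, of 1]])
  have i: "root_prod s A \<in> rat s" for A using root_prod_in[OF cfield_rat gen_in_rat] .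
  show "r\<^sup>2 \<in> rat s" "h\<^sup>2 \<in> rat s" unfolding r2' h2' by (rule i)+
  show "odd (ord_at (pt s 1) (r\<^sup>2))" unfolding r2' using ord_pt_root_prod[OF s_const, of "{1, - 1}" 1] by simp
  show "odd (ord_at (pt s m) (h\<^sup>2))" unfolding h2' using ord_pt_root_prod[OF s_const, of "{m, - m}" m] by simp
  have "ord_at (pt s 1) (root_prod s {1, - 1} * root_prod s {m, - m}) = ord_at (pt s 1) (root_prod s {1, - 1}) + ord_at (pt s 1) (root_prod s {m, - m})"
    by (rule ord_mult[OF laur_rat[OF s_const] pt_in_points[OF s_const] i root_prod_nonzero[OF s_const] i root_prod_nonzero[OF s_const]])
  also have "\<dots> = 1"
    using ord_pt_root_prod[OF s_const, of "{1, - 1}" 1] ord_pt_root_prod[OF s_const, of "{m, - m}" 1] m_ne(1,4) by simp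
  finally show "odd (ord_at (pt s 1) ((r * h)\<^sup>2))" unfolding power_mult_distrib r2' h2' by simp
qed

sublocale B1: biquad "rat z" s "r * h" by (rule B1)
sublocale B2: biquad "rat s" r h by (rule B2)

text \<open>
  The two biquadratic towers share the intermediate curve. In the first one the quadratic subfields
  are \<open>\<complex>(s)\<close>, a conic, and \<open>E\<close>; in the second one they are \<open>\<complex>(w)\<close>, a conic, and the intermediate
  curve.
\<close>

lemma fields: "B1.K1 = rat s" "B1.K3 = E" "B1.M = B2.K3" "B2.K1 = rat w" "B2.M = E'"
  using rat_s rat_w srh
  by (auto simp: B1.K1_def B1.K3_def B1.M_def B2.K1_def B2.K3_def B2.M_def E_def E'_def)

lemma rational_B1: "\<exists>v. v \<notin> constants \<and> B1.K2 = rat v"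
proof -
  have "(r * h)\<^sup>2 = (z - const 1) * (z - const p)" unfolding rh2 using p by (simp add: root_prod_def)
  from conic_rational[OF z this _ B1.qb] show ?thesis using p unfolding B1.K2_def by metis
qed

lemma rational_B2: "\<exists>v. v \<notin> constants \<and> B2.K2 = rat v"
proof -
  have "h\<^sup>2 = (s - const m) * (s - const (- m))" unfolding h2' using m_ne(3) by (simp add: root_prod_def)
  from conic_rational[OF s_const this m_ne(3) B2.qb] show ?thesis unfolding B2.K2_def by metis
qed

lemma laur_E': "laurent_field E'" using B2.laur_M fields by simp
lemma laur_E: "laurent_field E" using B1.laur_K3 fields by simp
lemma cf_E': "cfield E'" using laur_E' laur_cfield by blast

lemma sub: "rat z \<subseteq> E" "E \<subseteq> B2.K3" "B2.K3 \<subseteq> E'" "rat w \<subseteq> E'"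
proof -
  show "rat z \<subseteq> E" using base_in_adj[OF cfield_rat] by (auto simp: E_def)
  have "s \<in> B1.M" "r * h \<in> B1.M" using B1.K1_M[OF B1.a_K1] B1.b_M by auto
  then have "e \<in> B1.M" using cf_mult[OF B1.cf_M] srh by metis
  then have "E \<subseteq> B1.M" unfolding E_def using adj_least[OF B1.cf_M] B1.k_K1 B1.K1_M by blast
  then show "E \<subseteq> B2.K3" using fields(3) by simp
  have "r \<in> B2.M" "h \<in> B2.M" using B2.K1_M[OF B2.a_K1] B2.b_M by auto
  then have "r * h \<in> B2.M" using cf_mult[OF B2.cf_M] by blast
  then have "B2.K3 \<subseteq> B2.M" unfolding B2.K3_def using adj_least[OF B2.cf_M] B2.k_K1 B2.K1_M by blast
  then show "B2.K3 \<subseteq> E'" using fields(5) by simp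
  show "rat w \<subseteq> E'" using base_in_adj[OF cfield_rat] by (auto simp: E'_def)
qed

lemma E'_point_E: "Q \<in> points E' \<Longrightarrow> Q \<inter> E \<in> points E"
  using B1.M_point(3)[of "Q \<inter> B2.K3"] B2.M_point(3)[of Q] fields sub by (simp add: Int_assoc inf.absorb2)

lemma E'_point_w: "Q \<in> points E' \<Longrightarrow> Q \<inter> rat w \<in> points (rat w)"
  using B2.M_point(1) fields by simp

text \<open>
  In both towers the other two quadratic subfields are rational, where all differences of points
  are torsion, so \<open>torsion_iff\<close> leaves only the condition on the third one.
\<close>

lemma torsion_descends:
  assumes Q: "Q \<in> points E'" "Q0 \<in> points E'"
  shows "torsion_difference E' Q Q0 \<longleftrightarrow> torsion_difference E (Q \<inter> E) (Q0 \<inter> E)"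
proof -
  have Q2: "Q \<in> points B2.M" "Q0 \<in> points B2.M" using Q fields by auto
  have Q1: "Q \<inter> B2.K3 \<in> points B1.M" "Q0 \<inter> B2.K3 \<in> points B1.M" using B2.M_point(3) Q2 fields by auto
  have "torsion_difference B2.K2 (Q \<inter> B2.K2) (Q0 \<inter> B2.K2)"
    using rational_torsion' rational_B2 B2.M_point(2) Q2 by metis
  moreover have "torsion_difference B2.K1 (Q \<inter> B2.K1) (Q0 \<inter> B2.K1)"
    using rational_torsion'[OF fields(4) w_const] B2.M_point(1) Q2 by metis
  ultimately have 1: "torsion_difference E' Q Q0 \<longleftrightarrow> torsion_difference B2.K3 (Q \<inter> B2.K3) (Q0 \<inter> B2.K3)"
    using B2.torsion_iff[OF Q2] fields by simp
  have "torsion_difference B1.K2 (Q \<inter> B2.K3 \<inter> B1.K2) (Q0 \<inter> B2.K3 \<inter> B1.K2)"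
    using rational_torsion' rational_B1 B1.M_point(2) Q1 by metis
  moreover have "torsion_difference B1.K1 (Q \<inter> B2.K3 \<inter> B1.K1) (Q0 \<inter> B2.K3 \<inter> B1.K1)"
    using rational_torsion'[OF fields(1) s_const] B1.M_point(1) Q1 by metis
  ultimately have "torsion_difference B1.M (Q \<inter> B2.K3) (Q0 \<inter> B2.K3) \<longleftrightarrow>
      torsion_difference B1.K3 (Q \<inter> B2.K3 \<inter> B1.K3) (Q0 \<inter> B2.K3 \<inter> B1.K3)"
    using B1.torsion_iff[OF Q1] by simp
  then show ?thesis using 1 fields sub(2) by (simp add: Int_assoc inf.absorb2)
qed

text \<open>
  The branch points of \<open>E'\<close>. With \<open>m\<^sup>2 = p\<close> and \<open>n\<^sup>2 = p - 1\<close> these are the values \<open>w = s + r\<close> at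
  which \<open>z = p\<close>.
\<close>

definition "S = {m + n, m - n, - m + n, - m - n}"

lemma mn_ne: "m + n \<noteq> 0" "m - n \<noteq> 0"
proof -
  have "m\<^sup>2 - n\<^sup>2 = 1" using m2 n2 by simp
  then have "(m + n) * (m - n) = 1" by (simp add: power2_eq_square algebra_simps)
  then show "m + n \<noteq> 0" "m - n \<noteq> 0" by auto
qed

lemma roots_distinct: "m + n \<notin> {m - n, - m + n, - m - n}" "m - n \<notin> {- m + n, - m - n}" "- m + n \<notin> {- m - n}"
proof -
  have two: "a \<noteq> - a" if "a \<noteq> 0" for a :: complex using that by (simp add: eq_neg_iff_add_eq_0)
  have "- m - n = - (m + n)" "- m + n = - (m - n)" by auto
  then have "m + n \<noteq> - m - n" "m - n \<noteq> - m + n" using two mn_ne by metis+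
  moreover have "m + n \<noteq> m - n" "- m + n \<noteq> - m - n" using two[OF n2(2)] by auto
  moreover have "m + n \<noteq> - m + n" "m - n \<noteq> - m - n" using two[OF m2(2)] by auto
  ultimately show "m + n \<notin> {m - n, - m + n, - m - n}" "m - n \<notin> {- m + n, - m - n}" "- m + n \<notin> {- m - n}"
    by blast+
qed

lemma S: "finite S" "card S = 4" "0 \<notin> S"
proof -
  show "finite S" by (simp add: S_def)
  have "card S = Suc (card {m - n, - m + n, - m - n})"
    unfolding S_def by (rule card_insert_disjoint) (use roots_distinct in auto)
  also have "card {m - n, - m + n, - m - n} = Suc (card {- m + n, - m - n})"
    by (rule card_insert_disjoint) (use roots_distinct in auto)
  also have "card {- m + n, - m - n} = Suc (card {- m - n})"
    by (rule card_insert_disjoint) (use roots_distinct in auto)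
  finally show "card S = 4" by simp
  have "- m - n = - (m + n)" "- m + n = - (m - n)" by auto
  then have "- m - n \<noteq> 0" "- m + n \<noteq> 0" using mn_ne neg_equal_0_iff_equal by metis+
  then show "0 \<notin> S" using mn_ne unfolding S_def by (metis empty_iff insert_iff)
qed

text \<open>
  The factor \<open>2 w\<close> clears denominators: \<open>y\<^sup>2 = w^4 + (2 - 4 p) w\<^sup>2 + 1\<close>.
\<close>

definition "y = 2 * w * h"

lemma y2: "y\<^sup>2 = root_prod w S"
proof -
  have cm: "(const m)\<^sup>2 = const p" "(const n)\<^sup>2 = const p - 1"
    using m2 n2 const_simps(8)[of m 2] const_simps(8)[of n 2] by auto
  have "(2 * w * s)\<^sup>2 = (w\<^sup>2 + 1)\<^sup>2"
  proof -
    have "2 * s = w + inverse w" using sr_w(1) by (metis nonzero_mult_div_cancel_left times_divide_eq_right two_neq_zero)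
    then have "w * (2 * s) = w * (w + inverse w)" by simp
    then have "2 * w * s = w\<^sup>2 + 1" using w0 by (simp add: power2_eq_square distrib_left mult.left_commute mult.commute)
    then show ?thesis by simp
  qed
  then have a: "4 * w\<^sup>2 * z = (w\<^sup>2 + 1)\<^sup>2" by (simp add: power_mult_distrib s2)
  have "y\<^sup>2 = 4 * w\<^sup>2 * z - 4 * w\<^sup>2 * const p"
    by (simp add: y_def power_mult_distrib h2 right_diff_distrib)
  then have 1: "y\<^sup>2 = (w\<^sup>2 + 1)\<^sup>2 - 4 * w\<^sup>2 * const p" using a by simp
  have "root_prod w S = (w - const (m + n)) * (w - const (m - n)) * (w - const (- m + n)) * (w - const (- m - n))"
  proof -
    have "root_prod w S = (w - const (m + n)) * root_prod w {m - n, - m + n, - m - n}"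
      unfolding S_def by (rule root_prod_insert) (use roots_distinct in auto)
    also have "root_prod w {m - n, - m + n, - m - n} = (w - const (m - n)) * root_prod w {- m + n, - m - n}"
      by (rule root_prod_insert) (use roots_distinct in auto)
    also have "root_prod w {- m + n, - m - n} = (w - const (- m + n)) * root_prod w {- m - n}"
      by (rule root_prod_insert) (use roots_distinct in auto)
    also have "root_prod w {- m - n} = w - const (- m - n)" by (simp add: root_prod_def)
    finally show ?thesis by (simp only: mult.assoc)
  qed
  also have "\<dots> = ((w - const m)\<^sup>2 - (const n)\<^sup>2) * ((w + const m)\<^sup>2 - (const n)\<^sup>2)"
    by (simp add: power2_eq_square algebra_simps)
  also have "\<dots> = (w\<^sup>2 - (const m)\<^sup>2)\<^sup>2 - (const n)\<^sup>2 * (2 * w\<^sup>2 + 2 * (const m)\<^sup>2) + ((const n)\<^sup>2)\<^sup>2"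
    by (simp add: power2_eq_square algebra_simps)
  also have "\<dots> = (w\<^sup>2 + 1)\<^sup>2 - 4 * w\<^sup>2 * const p"
    unfolding cm by (simp add: power2_eq_square algebra_simps)
  finally show ?thesis using 1 by simp
qed

sublocale H: hyperelliptic w y S 1
  using w_const S y2 by unfold_locales auto

lemma quad_h: "quad (rat w) h" using B2.q1 fields by simp

lemma H_K: "H.K = E'"
proof -
  have "2 * w \<in> rat w" "2 * w \<noteq> 0" using w0 by (auto intro!: cf_mult cf_numeral)
  from adj_scale(2)[OF quad_h this] show ?thesis unfolding H.K_def unfolding E'_def y_def .
qed

lemma elliptic_E': "Z \<in> points E' \<Longrightarrow> elliptic_curve E' Z"
  using H.genus curve_adj[OF H.quad_y w_const] H_K by (simp add: elliptic_curve_def H.K_def)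

lemma ex_Z: "\<exists>Z\<in>points E'. Z \<inter> rat w = pt w (m + n)"
  using H.above[OF pt_in_points[OF w_const]] H_K by simp

text \<open>
  The origin of \<open>E'\<close>: a ramification point over the \<open>w\<close>-line, above \<open>z = p\<close>.
\<close>

definition "Z = (SOME Z. Z \<in> points E' \<and> Z \<inter> rat w = pt w (m + n))"

lemma Z: "Z \<in> points E'" "Z \<inter> rat w = pt w (m + n)"
  using someI_ex[of "\<lambda>Z. Z \<in> points E' \<and> Z \<inter> rat w = pt w (m + n)"] ex_Z by (auto simp: Z_def)

lemma Z_ramified: "conj (rat w) y ` Z = Z"
  using quad_ramified[OF laur_rat[OF w_const] H.quad_y, of Z] Z H_K y2 ord_pt_root_prod[OF w_const S(1), of "m + n"]
  by (simp add: H.K_def S_def)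

lemma Z_over_p: "Z \<inter> rat z = pt z p"
proof -
  have zw: "rat z \<subseteq> rat w" using z_s s_w by blast
  then have e: "Z \<inter> rat z = pt w (m + n) \<inter> rat z" using Z(2) by blast
  have P: "Z \<inter> rat z \<in> points (rat z)" using w_point_z[of "Z \<inter> rat w"] E'_point_w[OF Z(1)] zw
    by (simp add: Int_assoc inf.absorb2)
  have zin: "z \<in> rat w" "z - const p \<in> rat w" "z - const p \<noteq> 0"
    using zw gen_in_rat[of z] nonconst_nonzero(1)[OF z] by (auto intro!: cf_diff)
  note L = laur_rat[OF w_const] and Q = pt_in_points[OF w_const, of "m + n"]
  have wh: "4 * w\<^sup>2 * (z - const p) = root_prod w S" using y2 by (simp add: y_def power_mult_distrib h2)
  have c4: "4 * w\<^sup>2 \<in> rat w" "4 * w\<^sup>2 \<noteq> 0" using w0 by (auto intro!: cf_mult cf_numeral cf_power)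
  have "ord_at (pt w (m + n)) (4 * w\<^sup>2) = 0"
  proof -
    have "ord_at (pt w (m + n)) w = 0"
      using ord_pt_linear[OF w_const, of "m + n" 0] S(3) by (auto simp: S_def)
    moreover have "ord_at (pt w (m + n)) 4 = 0"
      using ord_const[OF L Q gen_in_rat w0, of 4] by simp
    ultimately show ?thesis
      using ord_mult[OF L Q cf_numeral[OF cfield_rat] four_neq_zero cf_power[OF cfield_rat gen_in_rat, of w 2]]
        ord_power[OF L Q gen_in_rat w0, of 2] w0 by simp
  qed
  then have "ord_at (pt w (m + n)) (z - const p) = 1"
    using ord_mult[OF L Q c4 zin(2,3)] wh ord_pt_root_prod[OF w_const S(1), of "m + n"] by (simp add: S_def)
  then have pos: "inverse (z - const p) \<notin> pt w (m + n)" "z - const p \<in> pt w (m + n)"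
    using ord_pos_iff[OF L Q zin(2,3)] ord_mem[OF L Q zin(2,3)] by auto
  have "z - const p + const p \<in> pt w (m + n)"
    using points_props(4)[OF Q pos(2) points_props(3)[OF Q]] .
  then have "z \<in> Z \<inter> rat z" unfolding e by simp
  moreover have "inverse (z - const p) \<notin> Z \<inter> rat z" unfolding e using pos by blast
  ultimately show ?thesis using pt_unique[OF z P] by blast
qed

lemma fixed_over:
  assumes "P \<in> points E" "P \<inter> rat z = pt z a" "a \<in> {0, 1, p}"
  shows "conj (rat z) e ` P = P"
  using quad_ramified[OF laur_rat[OF z] quad_e, of P] assms e2 ord_pt_root_prod[OF z, of "{0, 1, p}" a]
  by (auto simp: E_def)

text \<open>
  Twice the difference of two ramification points is the pullback of a divisor of degree zero on
  the line.
\<close>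

lemma branch_torsion:
  assumes P: "P \<in> points E" "P \<inter> rat z = pt z p" and W: "W \<in> points E" "W \<inter> rat z = pt z 0"
  shows "torsion_difference E P W"
proof -
  have "torsion_difference (rat z) (P \<inter> rat z) (W \<inter> rat z)"
    using rational_torsion[OF z] P(2) W(2) z by simp
  then have "tors E (\<lambda>R. pdiff P W R + pdiff (conj (rat z) e ` P) (conj (rat z) e ` W) R)"
    using quad_torsion_iff[OF laur_rat[OF z] quad_e, of P W] P(1) W(1) by (simp add: E_def)
  then have "tors E (\<lambda>R. int 2 * pdiff P W R)" using fixed_over P W by (simp add: algebra_simps)
  then have "tors E (pdiff P W)" by (rule tors_div) simp
  then show ?thesis using torsion_difference_iff_tors[OF P(1) W(1)] by simp
qed

text \<open>
  Any two points of the same fibre are equal or conjugate, and the conjugation fixes \<open>W\<close>.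
\<close>

lemma tau_all:
  assumes W: "W \<in> points E" "W \<inter> rat z = pt z 0" and P: "P \<in> points E" and t: "torsion_over z E W (P \<inter> rat z)"
  shows "torsion_difference E P W"
proof -
  obtain P' where P': "P' \<in> points E" "P' \<inter> rat z = P \<inter> rat z" "torsion_difference E P' W"
    using t by (auto simp: torsion_over_def)
  have A: "auto_on E (conj (rat z) e)" using auto_on_conj[OF quad_e] by (simp add: E_def)
  have "P = P' \<or> P = conj (rat z) e ` P'"
    using quad_fibre[OF laur_rat[OF z] quad_e, of P' P] P P' by (simp add: E_def)
  moreover have "torsion_difference E (conj (rat z) e ` P') W"
    using torsion_difference_auto[OF laur_E A P'(1) W(1) P'(3)] fixed_over[OF W] by simp
  ultimately show ?thesis using P'(3) by blast
qed

text \<open>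
  The base point \<open>W\<close> lies above \<open>z = 0\<close>, whereas the origin \<open>Z\<close> lies above \<open>z = p\<close>; on \<open>E\<close> their
  difference is torsion by \<open>branch_torsion\<close>.
\<close>

lemma torsion_image:
  assumes W: "W \<in> points E" "W \<inter> rat z = pt z 0" and R: "R \<in> points (rat w)"
  shows "(\<exists>Q\<in>torsion_points E' Z. Q \<inter> rat w = R) \<longleftrightarrow> torsion_over z E W (R \<inter> rat z)"
proof -
  have zw: "rat z \<subseteq> rat w" using z_s s_w by blast
  have ZE: "Z \<inter> E \<in> points E" "Z \<inter> E \<inter> rat z = pt z p"
    using E'_point_E[OF Z(1)] Z_over_p sub(1) by (auto simp: Int_assoc inf.absorb2)
  have ZW: "torsion_difference E (Z \<inter> E) W" using branch_torsion[OF ZE W] .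
  have r: "Q \<inter> E \<inter> rat z = Q \<inter> rat w \<inter> rat z" for Q using sub(1) zw by blast
  have iff: "torsion_difference E' Q Z \<longleftrightarrow> torsion_difference E (Q \<inter> E) W" if Q: "Q \<in> points E'" for Q
  proof -
    have QE: "Q \<inter> E \<in> points E" using E'_point_E[OF Q] .
    show ?thesis
      using torsion_descends[OF Q Z(1)] torsion_difference_equiv[OF laur_E] QE ZE(1) W(1) ZW by metis
  qed
  show ?thesis
  proof
    assume "\<exists>Q\<in>torsion_points E' Z. Q \<inter> rat w = R"
    then obtain Q where Q: "Q \<in> points E'" "torsion_difference E' Q Z" "Q \<inter> rat w = R"
      by (auto simp: torsion_points_def)
    then show "torsion_over z E W (R \<inter> rat z)"
      unfolding torsion_over_def using iff[OF Q(1)] E'_point_E[OF Q(1)] r[of Q] by blast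
  next
    assume t: "torsion_over z E W (R \<inter> rat z)"
    obtain Q where Q: "Q \<in> points E'" "Q \<inter> rat w = R" using H.above[OF R] H_K by auto
    have "torsion_difference E (Q \<inter> E) W"
      using tau_all[OF W E'_point_E[OF Q(1)]] t r[of Q] Q(2) by simp
    then show "\<exists>Q\<in>torsion_points E' Z. Q \<inter> rat w = R"
      using iff[OF Q(1)] Q by (auto simp: torsion_points_def)
  qed
qed

end

section \<open>Morphisms\<close>

lemma morphism_simps:
  assumes "morphism \<phi> K L"
  shows "\<phi> (const c) = const c" "\<phi> 0 = 0" "\<phi> 1 = 1" "x \<in> L \<Longrightarrow> \<phi> x \<in> K"
    "x \<in> L \<Longrightarrow> y \<in> L \<Longrightarrow> \<phi> (x + y) = \<phi> x + \<phi> y" "x \<in> L \<Longrightarrow> y \<in> L \<Longrightarrow> \<phi> (x * y) = \<phi> x * \<phi> y"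
proof -
  have h: "\<phi> \<in> ring_hom (restr L) (restr K)" and c: "\<phi> (const c) = const c" for c
    using assms by (auto simp: morphism_def)
  show "\<phi> (const c) = const c" "\<phi> 0 = 0" "\<phi> 1 = 1" using c c[of 0] c[of 1] by auto
  show "x \<in> L \<Longrightarrow> \<phi> x \<in> K" using ring_hom_closed[OF h] by simp
  show "x \<in> L \<Longrightarrow> y \<in> L \<Longrightarrow> \<phi> (x + y) = \<phi> x + \<phi> y" using ring_hom_add[OF h] by simp
  show "x \<in> L \<Longrightarrow> y \<in> L \<Longrightarrow> \<phi> (x * y) = \<phi> x * \<phi> y" using ring_hom_mult[OF h] by simp
qed

text \<open>
  A morphism is only known on \<open>L\<close>; these rules transport field operations and subfields along it.
\<close>

lemma morphism_more:
  assumes m: "morphism \<phi> K L" and L: "cfield L"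
  shows morphism_inverse: "x \<in> L \<Longrightarrow> \<phi> (inverse x) = inverse (\<phi> x)"
    and morphism_divide: "x \<in> L \<Longrightarrow> y \<in> L \<Longrightarrow> \<phi> (x / y) = \<phi> x / \<phi> y"
    and morphism_inj: "inj_on \<phi> L"
    and morphism_ev: "x \<in> L \<Longrightarrow> \<phi> (ev x p) = ev (\<phi> x) p"
    and morphism_image: "cfield (\<phi> ` L)"
    and morphism_rat: "x \<in> L \<Longrightarrow> \<phi> ` rat x = rat (\<phi> x)"
proof -
  note S = morphism_simps[OF m]
  show i: "\<phi> (inverse x) = inverse (\<phi> x)" if "x \<in> L" for x
  proof (cases "x = 0")
    case False
    then have "\<phi> x * \<phi> (inverse x) = 1" using S(6)[OF that cf_inverse[OF L that]] S(3) by simp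
    then show ?thesis by (simp add: inverse_unique)
  qed (simp add: S)
  show d: "\<phi> (x / y) = \<phi> x / \<phi> y" if "x \<in> L" "y \<in> L" for x y
    using S(6)[OF that(1) cf_inverse[OF L that(2)]] i[OF that(2)] by (simp add: divide_inverse)
  show "inj_on \<phi> L"
  proof (rule inj_onI)
    fix x y assume xy: "x \<in> L" "y \<in> L" "\<phi> x = \<phi> y"
    have mxy: "- y \<in> L" "x + (- y) \<in> L" by (intro cf_uminus cf_add L xy)+
    have "\<phi> (y + (- y)) = \<phi> y + \<phi> (- y)" using S(5)[OF xy(2) mxy(1)] .
    then have "\<phi> (x + (- y)) = 0" using S(5)[OF xy(1) mxy(1)] xy(3) S(2) by simp
    then have z: "\<phi> (x - y) = 0" by simp
    show "x = y"
    proof (rule ccontr)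
      assume "x \<noteq> y"
      then have "(x - y) * inverse (x - y) = 1" by simp
      then have "\<phi> (x - y) * \<phi> (inverse (x - y)) = 1" using S(6)[of "x - y" "inverse (x - y)"] S(3) mxy(2) cf_inverse[OF L] cf_diff[OF L xy(1,2)] by simp
      then show False using z by simp
    qed
  qed
  show ev: "\<phi> (ev x p) = ev (\<phi> x) p" if "x \<in> L" for x p
    using that L by (induction p) (auto simp: S ev_in cf)
  show "cfield (\<phi> ` L)"
    unfolding cfield_def
  proof (intro conjI ballI)
    show "constants \<subseteq> \<phi> ` L" using S(1) cf_const[OF L] by (metis image_eqI image_subsetI)
  next
    fix x y assume "x \<in> \<phi> ` L" "y \<in> \<phi> ` L"
    then obtain x' y' where "x = \<phi> x'" "y = \<phi> y'" "x' \<in> L" "y' \<in> L" by blast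
    then show "x + y \<in> \<phi> ` L" "x * y \<in> \<phi> ` L"
      using S(5,6)[of x' y'] cf_add[OF L] cf_mult[OF L] by (metis image_eqI)+
  next
    fix x assume "x \<in> \<phi> ` L"
    then obtain x' where "x = \<phi> x'" "x' \<in> L" by blast
    then show "inverse x \<in> \<phi> ` L" using i cf_inverse[OF L] by (metis image_eqI)
  qed
  show "\<phi> ` rat x = rat (\<phi> x)" if x: "x \<in> L"
  proof -
    have e: "\<phi> (ev x p / ev x q) = ev (\<phi> x) p / ev (\<phi> x) q" for p q
      using d[OF ev_in[OF L x] ev_in[OF L x]] ev[OF x] by simp
    have n: "ev x q = 0 \<longleftrightarrow> ev (\<phi> x) q = 0" for q
    proof
      assume "ev (\<phi> x) q = 0"
      then have "\<phi> (ev x q) = \<phi> 0" using ev[OF x] S(2) by simp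
      then show "ev x q = 0" using \<open>inj_on \<phi> L\<close> ev_in[OF L x] cf_0[OF L] by (meson inj_onD)
    next
      assume "ev x q = 0"
      then show "ev (\<phi> x) q = 0" using ev[OF x, of q] S(2) by simp
    qed
    show ?thesis
    proof
      show "\<phi> ` rat x \<subseteq> rat (\<phi> x)" using e n by (auto simp: rat_def)
      show "rat (\<phi> x) \<subseteq> \<phi> ` rat x"
      proof
        fix f assume "f \<in> rat (\<phi> x)"
        then obtain p q where "ev (\<phi> x) q \<noteq> 0" "f = ev (\<phi> x) p / ev (\<phi> x) q" by (rule ratE)
        then show "f \<in> \<phi> ` rat x" using e[of p q] n ratI[of x q p] by (metis image_eqI)
      qed
    qed
  qed
qed

lemma double_cover_quad:
  assumes "double_cover \<phi> K L" "cfield K" "cfield L"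
  obtains b where "quad (\<phi> ` L) b" "K = adj (\<phi> ` L) b"
proof -
  have m: "morphism \<phi> K L" and d: "has_dim_over (\<phi> ` L) K 2" using assms(1) by (auto simp: double_cover_def)
  have "\<phi> ` L \<subseteq> K" using morphism_simps(4)[OF m] by blast
  then show thesis using has_dim_2_quad[OF morphism_image[OF m assms(3)] assms(2) _ d] that by blast
qed

text \<open>
  Along \<open>\<phi>\<close> the point below \<open>Q\<close> in \<open>L\<close> corresponds to \<open>Q \<inter> k\<close>, with uniformizers corresponding to
  uniformizers. At a fixed point of the involution a uniformizer of \<open>Q \<inter> k\<close> has order two.
\<close>

lemma fixed_point_ramified:
  assumes m: "morphism \<phi> (adj k b) L" and L: "cfield L" and k: "\<phi> ` L = k" "laurent_field k" and q: "quad k b"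
    and Q: "Q \<in> points (adj k b)" "conj k b ` Q = Q"
  shows "Q \<in> ramification_points \<phi> (adj k b) L"
proof -
  define P where "P = point_map \<phi> L Q"
  have Qk: "Q \<inter> k \<in> points k" using quad_restrict_point[OF q Q(1)] .
  have im: "\<phi> ` P = Q \<inter> k" using k(1) by (auto simp: P_def point_map_def)
  have PL: "P \<subseteq> L" by (auto simp: P_def point_map_def)
  have mem: "f \<in> P \<longleftrightarrow> \<phi> f \<in> Q \<inter> k" if "f \<in> L" for f
    using that k(1) by (auto simp: P_def point_map_def)
  note S = morphism_simps[OF m] and inv = morphism_inverse[OF m L]
  have z: "\<phi> f = 0 \<longleftrightarrow> f = 0" if "f \<in> L" for f
    using inj_onD[OF morphism_inj[OF m L], of f 0] that cf_0[OF L] S(2) by auto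
  have mi: "f \<in> maximal_ideal P \<longleftrightarrow> \<phi> f \<in> maximal_ideal (Q \<inter> k)" if "f \<in> L" for f
    using mem[OF that] mem[OF cf_inverse[OF L that]] inv[OF that] z[OF that] by (simp add: maximal_ideal_def)
  have miP: "maximal_ideal P \<subseteq> L" using PL by (auto simp: maximal_ideal_def)
  have un: "uniformizer P t \<longleftrightarrow> uniformizer (Q \<inter> k) (\<phi> t)" if t: "t \<in> L" for t
  proof -
    have "maximal_ideal P = (\<lambda>g. t * g) ` P \<longleftrightarrow> maximal_ideal (Q \<inter> k) = (\<lambda>g. \<phi> t * g) ` (Q \<inter> k)"
    proof -
      have "\<phi> ` maximal_ideal P = maximal_ideal (Q \<inter> k)"
      proof
        show "\<phi> ` maximal_ideal P \<subseteq> maximal_ideal (Q \<inter> k)" using mi miP by blast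
        show "maximal_ideal (Q \<inter> k) \<subseteq> \<phi> ` maximal_ideal P"
        proof
          fix g assume g: "g \<in> maximal_ideal (Q \<inter> k)"
          then have "g \<in> k" by (auto simp: maximal_ideal_def)
          then obtain f where "f \<in> L" "g = \<phi> f" using k(1) by blast
          then show "g \<in> \<phi> ` maximal_ideal P" using mi g by blast
        qed
      qed
      moreover have "\<phi> ` (\<lambda>g. t * g) ` P = (\<lambda>g. \<phi> t * g) ` (Q \<inter> k)"
        unfolding im[symmetric] image_image using S(6)[OF t] PL by (intro image_cong) auto
      moreover have "(\<lambda>g. t * g) ` P \<subseteq> L" using PL t L by (auto intro: cf_mult)
      ultimately show ?thesis using inj_on_image_eq_iff[OF morphism_inj[OF m L] miP] by metis
    qed
    then show ?thesis using mem[OF t] by (simp add: uniformizer_def)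
  qed
  obtain u where u: "u \<in> k" "uniformizer (Q \<inter> k) u"
    using ex_uniformizer[OF k(2) Qk cf_1[OF laur_cfield[OF k(2)]] one_neq_zero] by blast
  then obtain u' where "u' \<in> L" "u = \<phi> u'" using k(1) by blast
  then have "uniformizer P u'" using un u by blast
  define t where "t = (SOME t. uniformizer P t)"
  have t: "uniformizer P t" unfolding t_def using someI[of "uniformizer P", OF \<open>uniformizer P u'\<close>] .
  then have tL: "t \<in> L" using PL by (auto simp: uniformizer_def)
  then have "\<phi> t \<in> k" "\<phi> t \<noteq> 0" "ord_at (Q \<inter> k) (\<phi> t) = 1"
    using un[OF tL] t ord_uniformizer[OF k(2) Qk cf_1[OF laur_cfield[OF k(2)]] one_neq_zero, of "\<phi> t"] by auto
  then have "ord_at Q (\<phi> t) = 2" using quad_ord[OF k(2) q Q(1)] Q(2) by simp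
  then show ?thesis using Q(1) unfolding ramification_points_def ramification_index_def t_def P_def by simp
qed

section \<open>The projective line\<close>

definition line_coord :: func where "line_coord = to_ac (Fract [:0, 1:] 1)"

text \<open>
  This recognises the abstract fraction field inside \<open>func\<close> as the rational functions in its
  coordinate.
\<close>

lemma ev_line_coord: "ev line_coord p = to_ac (Fract p 1)"
proof (induction p)
  case 0
  then show ?case by (simp add: Zero_fract_def[symmetric])
next
  case (pCons a p)
  have "ev line_coord (pCons a p) = const a + line_coord * ev line_coord p" by simp
  also have "\<dots> = to_ac (Fract [:a:] 1 + Fract [:0, 1:] 1 * Fract p 1)"
    unfolding pCons by (simp only: const_def line_coord_def to_ac_add to_ac_mult)
  also have "Fract [:a:] 1 + Fract [:0, 1:] 1 * Fract p 1 = Fract (pCons a p) 1" by simp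
  finally show ?case .
qed

lemma line_coord_const: "line_coord \<notin> constants"
proof
  assume "line_coord \<in> constants"
  then obtain c where "line_coord = const c" by auto
  then have "Fract [:0, 1:] 1 = Fract [:c:] (1 :: complex poly)" by (simp add: line_coord_def const_def)
  then show False by (simp add: eq_fract)
qed

lemma projective_line_rat: "projective_line = rat line_coord"
proof
  show "projective_line \<subseteq> rat line_coord"
  proof
    fix f assume "f \<in> projective_line"
    then obtain g where g: "f = to_ac g" by (auto simp: projective_line_def)
    obtain p q where pq: "g = Fract p q" "q \<noteq> 0" by (cases g) auto
    have "g = Fract p 1 / Fract q 1" using pq by simp
    then have "to_ac g = to_ac (Fract p 1) / to_ac (Fract q 1)" by (metis to_ac_divide)
    then have "f = ev line_coord p / ev line_coord q" unfolding g ev_line_coord .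
    moreover have "ev line_coord q \<noteq> 0" using ev_nonzero[OF line_coord_const] pq by simp
    ultimately show "f \<in> rat line_coord" using ratI by simp
  qed
  show "rat line_coord \<subseteq> projective_line"
    by (auto simp: rat_def ev_line_coord projective_line_def simp flip: to_ac_divide)
qed

text \<open>
  The \<open>w\<close>-line for an arbitrary non-constant function \<open>w\<close> is a copy of the projective line.
\<close>

lemma subst_morphism:
  assumes w: "w \<notin> constants" and K: "cfield K" "rat w \<subseteq> K"
  shows "morphism (subst const line_coord w) K projective_line" "subst const line_coord w ` projective_line = rat w"
proof -
  note S = subst_simps[OF field_hom_const w line_coord_const]
  have i: "subst const line_coord w ` rat line_coord = rat w"
  proof
    have e: "subst const line_coord w (ev line_coord p / ev line_coord q) = ev w p / ev w q" if "q \<noteq> 0" for p q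
      using subst_eq[OF field_hom_const w line_coord_const that] .
    show "subst const line_coord w ` rat line_coord \<subseteq> rat w"
    proof clarify
      fix f assume "f \<in> rat line_coord"
      then obtain p q where "q \<noteq> 0" "f = ev line_coord p / ev line_coord q" by (rule rat_cases[OF line_coord_const])
      then show "subst const line_coord w f \<in> rat w" using e ev_nonzero[OF w] ratI by simp
    qed
    show "rat w \<subseteq> subst const line_coord w ` rat line_coord"
    proof
      fix f assume "f \<in> rat w"
      then obtain p q where pq: "q \<noteq> 0" "f = ev w p / ev w q" by (rule rat_cases[OF w])
      then have "f = subst const line_coord w (ev line_coord p / ev line_coord q)" using e by simp
      moreover have "ev line_coord p / ev line_coord q \<in> rat line_coord" using ev_nonzero[OF line_coord_const] pq ratI by simp
      ultimately show "f \<in> subst const line_coord w ` rat line_coord" by blast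
    qed
  qed
  then show "subst const line_coord w ` projective_line = rat w" by (simp add: projective_line_rat)
  have "subst const line_coord w \<in> ring_hom (restr projective_line) (restr K)"
    by (rule ring_hom_memI) (use S S(1)[of 1] i K(2) projective_line_rat in auto)
  then show "morphism (subst const line_coord w) K projective_line" using S(1) by (simp add: morphism_def)
qed

context pulled_back
begin

lemma elliptic_double_cover_E': "elliptic_double_cover (subst const line_coord w) E' Z"
proof -
  note M = subst_morphism[OF w_const cf_E' sub(4)]
  have c: "cfield projective_line" by (simp add: projective_line_rat)
  have "double_cover (subst const line_coord w) E' projective_line"
    using M quad_has_dim_2[OF quad_h] by (simp add: double_cover_def E'_def)
  moreover have "Z \<in> ramification_points (subst const line_coord w) E' projective_line"
  proof -
    have e: "E' = adj (rat w) y" using H_K unfolding H.K_def by simp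
    show ?thesis unfolding e
      by (rule fixed_point_ramified[OF _ c M(2) laur_rat[OF w_const] H.quad_y])
        (use M(1) Z(1) Z_ramified e in auto)
  qed
  ultimately show ?thesis using elliptic_E'[OF Z(1)] by (simp add: elliptic_double_cover_def)
qed

end

section \<open>The comparison\<close>

text \<open>
  For \<open>R\<close> on the \<open>z\<close>-line let \<open>\<tau> R\<close> mean that the points above \<open>R\<close> on both elliptic curves are
  torsion. Then the packet consists of the points of \<open>K\<close> above the set \<open>A\<close> defined by \<open>\<tau>\<close>, and the
  intersection corresponds to the points \<open>N\<close> of the \<open>w\<close>-line above \<open>A\<close>. The two sets are compared
  fibre by fibre.
\<close>

theorem packet_le_intersection:
  assumes K: "bielliptic K" and T: "hyperelliptic_torsion_packet K Tp" "finite Tp"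
  obtains \<phi>1 E1 Z1 \<phi>2 E2 Z2 where "elliptic_double_cover \<phi>1 E1 Z1" "elliptic_double_cover \<phi>2 E2 Z2"
    "finite (common_torsion \<phi>1 E1 Z1 \<phi>2 E2 Z2)" "card Tp \<le> card (common_torsion \<phi>1 E1 Z1 \<phi>2 E2 Z2)"
proof -
  have cK: "cfield K" and gK: "has_genus K 2" using K curve_cfield by (auto simp: bielliptic_def)
  obtain E0 Z0 \<phi>E where E0: "elliptic_curve E0 Z0" "double_cover \<phi>E K E0" using K by (auto simp: bielliptic_def)
  obtain \<phi> where \<phi>: "double_cover \<phi> K projective_line" "ramification_points \<phi> K projective_line \<subseteq> Tp"
    and pk: "torsion_packet K Tp" using T(1) by (auto simp: hyperelliptic_torsion_packet_def)
  have cP: "cfield projective_line" by (simp add: projective_line_rat)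
  have m\<phi>: "morphism \<phi> K projective_line" using \<phi>(1) by (simp add: double_cover_def)
  have TP: "line_coord \<in> projective_line" by (simp add: projective_line_rat)
  define x where "x = \<phi> line_coord"
  have imx: "\<phi> ` projective_line = rat x"
    using morphism_rat[OF m\<phi> cP TP] by (simp add: projective_line_rat x_def)
  have x: "x \<notin> constants"
  proof
    assume "x \<in> constants"
    then obtain c where "\<phi> line_coord = const c" by (auto simp: x_def)
    then have "\<phi> line_coord = \<phi> (const c)" using morphism_simps(1)[OF m\<phi>] by simp
    then have "line_coord = const c" using inj_onD[OF morphism_inj[OF m\<phi> cP]] TP cf_const[OF cP] by blast
    then show False using line_coord_const by blast
  qed
  obtain b where b: "quad (rat x) b" "K = adj (rat x) b" using double_cover_quad[OF \<phi>(1) cK cP] imx by metis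
  have cE0: "cfield E0" and gE0: "has_genus E0 1" using E0(1) curve_cfield by (auto simp: elliptic_curve_def)
  have mE: "morphism \<phi>E K E0" using E0(2) by (simp add: double_cover_def)
  obtain c where c: "quad (\<phi>E ` E0) c" "K = adj (\<phi>E ` E0) c" using double_cover_quad[OF E0(2) cK cE0] by metis
  have "\<phi>E ` E0 \<noteq> rat x"
  proof
    assume e: "\<phi>E ` E0 = rat x"
    then obtain t where t: "t \<in> E0" "\<phi>E t = x" using gen_in_rat[of x] by (metis imageE)
    have "\<phi>E ` rat t = \<phi>E ` E0" using morphism_rat[OF mE cE0 t(1)] t(2) e by simp
    then have "rat t = E0"
      using inj_on_image_eq_iff[OF morphism_inj[OF mE cE0] rat_least[OF cE0 t(1)] order_refl] by simp
    moreover have "t \<notin> constants"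
    proof
      assume "t \<in> constants"
      then obtain d where "t = const d" by auto
      then have "x = const d" using t(2) morphism_simps(1)[OF mE] by simp
      then show False using x by blast
    qed
    ultimately have "has_genus E0 0" using genus_rational[of t] by simp
    then show False using has_genus_unique[OF gE0] by auto
  qed
  then obtain z p q e1 e2 where z: "z \<notin> constants" and p: "p \<noteq> 0" "p \<noteq> 1" and q: "q \<noteq> 0" "q \<noteq> 1" "p \<noteq> q"
    and e: "e1\<^sup>2 = root_prod z {0, 1, p}" "e2\<^sup>2 = root_prod z {0, 1, q}" and B: "biquad (rat z) e1 e2"
    and BK: "adj (adj (rat z) e1) e2 = K" "adj (rat z) (e1 * e2) = rat x"
    using bielliptic_normal_form[OF _ x b(1) c(1)] b(2) c(2) gK by metis
  interpret B: biquad "rat z" e1 e2 by fact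
  have MK: "B.M = K" and K3: "B.K3 = rat x" using BK by (auto simp: B.M_def B.K3_def)
  obtain s where s: "s\<^sup>2 = z" using nth_root_exists[of 2 z] by auto
  obtain r where r: "r\<^sup>2 = z - 1" using nth_root_exists[of 2 "z - 1"] by auto
  interpret C: cover z s r using z s r by unfold_locales
  interpret P1: pulled_back z s r e1 p using p e by unfold_locales auto
  interpret P2: pulled_back z s r e2 q using q e by unfold_locales auto
  have E12: "P1.E = B.K1" "P2.E = B.K2" by (auto simp: P1.E_def P2.E_def B.K1_def B.K2_def)
  have zK1: "rat z \<subseteq> B.K1" "rat z \<subseteq> B.K2" using B.k_K1 B.k_K2 by auto
  \<comment> \<open>\<open>E1\<close> is ramified over the common branch point \<open>0\<close> but \<open>\<complex>(x)\<close> is not, so a point of \<open>K\<close> above it is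
      ramified over \<open>\<complex>(x)\<close>: a Weierstrass point\<close>
  obtain W1 where W1: "W1 \<in> points B.K1" "W1 \<inter> rat z = pt z 0"
    using quad_point_above[OF B.laur_k B.qa pt_in_points[OF z, of 0]] by (auto simp: B.K1_def)
  obtain W where W: "W \<in> points K" "W \<inter> B.K1 = W1"
    using quad_point_above[OF B.laur_K1 B.q1 W1(1)] B.M_eq1 MK by auto
  have Wz: "W \<inter> rat z = pt z 0" using W(2) W1(2) zK1(1) by blast
  have WM: "W \<in> points B.M" using W MK by simp
  have WE: "W \<inter> P1.E \<in> points P1.E" "W \<inter> P1.E \<inter> rat z = pt z 0" "W \<inter> P2.E \<in> points P2.E" "W \<inter> P2.E \<inter> rat z = pt z 0"
    using B.M_point(1,2)[OF WM] Wz zK1 unfolding E12 by auto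
  have "W \<in> Tp"
  proof -
    define W3 where "W3 = W \<inter> B.K3"
    have W3: "W3 \<in> points (adj (rat z) (e1 * e2))" "W3 \<inter> rat z = pt z 0"
      using B.M_point(3)[OF WM] Wz B.k_K3 by (auto simp: W3_def B.K3_def)
    have sfz: "root_prod z A \<in> rat z" "root_prod z A \<noteq> 0" for A using root_prod_in[OF cfield_rat gen_in_rat] root_prod_nonzero[OF z] by auto
    have "ord_at (pt z 0) ((e1 * e2)\<^sup>2) = 2"
      unfolding power_mult_distrib e
      using ord_mult[OF laur_rat[OF z] pt_in_points[OF z, of 0] sfz sfz] ord_pt_root_prod[OF z, of _ 0] by simp
    then have "ord_at W3 (e1\<^sup>2) = ord_at (pt z 0) (e1\<^sup>2)"
      using quad_ord[OF B.laur_k B.qc W3(1), of "e1\<^sup>2"] quad_ramified[OF B.laur_k B.qc W3(1)] W3(2) sfz e(1) by simp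
    also have "\<dots> = 1" unfolding e(1) using ord_pt_root_prod[OF z, of "{0, 1, p}" 0] by simp
    finally have "conj B.K3 e1 ` W = W"
      using quad_ramified[OF B.laur_K3 B.qca, of W] WM B.M_eq3 by (simp add: W3_def)
    then have "W \<in> ramification_points \<phi> (adj B.K3 e1) projective_line"
      using m\<phi> cP imx K3 B.laur_K3 B.qca WM B.M_eq3 MK by (intro fixed_point_ramified) auto
    then show ?thesis using \<phi>(2) B.M_eq3 MK by auto
  qed
  \<comment> \<open>torsion equivalence is transitive and packets are maximal, so the packet is a full class\<close>
  have LK: "laurent_field K" using B.laur_M MK by simp
  have Xeq: "Tp = {P \<in> points K. torsion_difference K P W}"
  proof -
    have Tp: "Tp \<subseteq> points K" "\<And>P Q. P \<in> Tp \<Longrightarrow> Q \<in> Tp \<Longrightarrow> torsion_difference K P Q"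
      and mx: "\<And>Tp'. Tp \<subseteq> Tp' \<Longrightarrow> Tp' \<subseteq> points K \<Longrightarrow> \<forall>P\<in>Tp'. \<forall>Q\<in>Tp'. torsion_difference K P Q \<Longrightarrow> Tp' = Tp"
      using pk unfolding torsion_packet_def by blast+
    have "{P \<in> points K. torsion_difference K P W} = Tp"
    proof (rule mx)
      show "Tp \<subseteq> {P \<in> points K. torsion_difference K P W}" using Tp \<open>W \<in> Tp\<close> by blast
      show "\<forall>P\<in>{P \<in> points K. torsion_difference K P W}. \<forall>Q\<in>{P \<in> points K. torsion_difference K P W}. torsion_difference K P Q"
        using torsion_difference_equiv(2,3)[OF LK] W(1) by blast
    qed auto
    then show ?thesis by simp
  qed
  define \<tau> where "\<tau> R \<longleftrightarrow> torsion_over z P1.E (W \<inter> P1.E) R \<and> torsion_over z P2.E (W \<inter> P2.E) R" for R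
  have td_iff: "torsion_difference K P W \<longleftrightarrow> \<tau> (P \<inter> rat z)" if P: "P \<in> points K" for P
  proof -
    have PM: "P \<in> points B.M" using P MK by simp
    have "torsion_difference B.K3 (P \<inter> B.K3) (W \<inter> B.K3)"
      using rational_torsion'[OF K3 x] B.M_point(3) PM WM by blast
    then have 1: "torsion_difference K P W \<longleftrightarrow>
      torsion_difference P1.E (P \<inter> P1.E) (W \<inter> P1.E) \<and> torsion_difference P2.E (P \<inter> P2.E) (W \<inter> P2.E)"
      using B.torsion_iff[OF PM WM] E12 MK by simp
    have PE: "P \<inter> P1.E \<in> points P1.E" "P \<inter> P2.E \<in> points P2.E" using B.M_point[OF PM] E12 by auto
    have i: "P \<inter> P1.E \<inter> rat z = P \<inter> rat z" "P \<inter> P2.E \<inter> rat z = P \<inter> rat z" using zK1 E12 by auto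
    have "torsion_over z P1.E (W \<inter> P1.E) (P \<inter> rat z) \<longleftrightarrow> torsion_difference P1.E (P \<inter> P1.E) (W \<inter> P1.E)"
      using P1.tau_all[OF WE(1,2) PE(1)] i(1) PE(1) unfolding torsion_over_def by metis
    moreover have "torsion_over z P2.E (W \<inter> P2.E) (P \<inter> rat z) \<longleftrightarrow> torsion_difference P2.E (P \<inter> P2.E) (W \<inter> P2.E)"
      using P2.tau_all[OF WE(3,4) PE(2)] i(2) PE(2) unfolding torsion_over_def by metis
    ultimately show ?thesis using 1 unfolding \<tau>_def by blast
  qed
  define A where "A = {R \<in> points (rat z). \<tau> R}"
  define N where "N = {R \<in> points (rat C.w). \<tau> (R \<inter> rat z)}"
  have Kz: "P \<inter> rat z \<in> points (rat z)" if "P \<in> points K" for P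
    using B.M_point(1)[of P] that MK quad_restrict_point[OF B.qa, of "P \<inter> B.K1"] zK1
    by (auto simp: B.K1_def Int_assoc inf.absorb2)
  have XU: "Tp = (\<Union>R\<in>A. fibre K (rat z) R)"
    using Xeq td_iff Kz by (auto simp: A_def fibre_def)
  have NU: "N = (\<Union>R\<in>A. fibre (rat C.w) (rat z) R)"
    using C.w_point_z by (auto simp: N_def A_def fibre_def)
  \<comment> \<open>if \<open>e1\<^sup>2\<close> has odd order at \<open>R\<close>, one of the two steps from the line to \<open>K\<close> is ramified; otherwise \<open>R\<close> is
      none of \<open>0, 1, \<infinity>\<close> and the \<open>w\<close>-line has four points above it\<close>
  have FK: "fibre K (rat z) R \<noteq> {} \<and> finite (fibre K (rat z) R) \<and>
      card (fibre K (rat z) R) \<le> card (fibre (rat C.w) (rat z) R)" if R: "R \<in> points (rat z)" for R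
  proof -
    have t: "fibre K (rat z) R = (\<Union>P\<in>fibre B.K1 (rat z) R. fibre K B.K1 P)"
      using fibre_tower[OF zK1(1), of K] B.M_point(1) MK by simp
    note F1 = fibre_quad[OF B.laur_k B.qa R, folded B.K1_def]
    have F2: "finite (fibre K B.K1 P)" "card (fibre K B.K1 P) \<le> 2" "card (fibre K B.K1 P) \<noteq> 0"
      if "P \<in> fibre B.K1 (rat z) R" for P
      using fibre_quad[OF B.laur_K1 B.q1, of P] B.M_eq1 MK that by (auto simp: fibre_def split: if_splits)
    have fin: "finite (fibre K (rat z) R)" unfolding t using F1(1) F2(1) by blast
    have ne: "fibre K (rat z) R \<noteq> {}"
    proof -
      have "fibre B.K1 (rat z) R \<noteq> {}" using F1(2) by (metis card.empty zero_neq_numeral zero_neq_one)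
      then obtain P where P: "P \<in> fibre B.K1 (rat z) R" by blast
      then have "fibre K B.K1 P \<noteq> {}" using F2(3) by fastforce
      then show ?thesis unfolding t using P by blast
    qed
    have "card (fibre K (rat z) R) \<le> (\<Sum>P\<in>fibre B.K1 (rat z) R. card (fibre K B.K1 P))"
      unfolding t by (rule card_UN_le) (rule F1(1))
    also have "\<dots> \<le> (\<Sum>P\<in>fibre B.K1 (rat z) R. 2)" by (intro sum_mono F2(2))
    finally have le: "card (fibre K (rat z) R) \<le> 2 * (if odd (ord_at R (e1\<^sup>2)) then 1 else 2)"
      using F1(2) by simp
    show ?thesis
    proof (cases "odd (ord_at R (e1\<^sup>2))")
      case True
      then show ?thesis using le C.fibre_w(2)[OF R] fin ne by simp
    next
      case False
      have "even (ord_at R z) \<and> even (ord_at R (z - 1))"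
      proof (rule points_rat_cases[OF z R])
        fix a assume a: "R = pt z a"
        then show ?thesis using False e(1) ord_pt_root_prod[OF z, of "{0, 1, p}" a] ord_pt_linear[OF z, of a 0]
            ord_pt_linear[OF z, of a 1] by (auto split: if_splits)
      next
        assume "R = pt_inf z"
        then show ?thesis using False e(1) ord_pt_inf_root_prod[OF z, of "{0, 1, p}"] p by simp
      qed
      then show ?thesis using le False C.fibre_w(3)[OF R] fin ne by simp
    qed
  qed
  have Apts: "R \<in> points (rat z)" if "R \<in> A" for R using that by (simp add: A_def)
  have finA: "finite A"
  proof (rule finite_subset[OF _ finite_imageI[OF T(2), of "\<lambda>P. P \<inter> rat z"]])
    show "A \<subseteq> (\<lambda>P. P \<inter> rat z) ` Tp"
    proof
      fix R assume R: "R \<in> A"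
      then obtain P where P: "P \<in> fibre K (rat z) R" using FK Apts by blast
      then have "P \<in> Tp" "P \<inter> rat z = R" using XU R by (auto simp: fibre_def)
      then show "R \<in> (\<lambda>P. P \<inter> rat z) ` Tp" by blast
    qed
  qed
  have finN: "finite N" unfolding NU using finA C.fibre_w(1) Apts by blast
  have "card Tp \<le> (\<Sum>R\<in>A. card (fibre K (rat z) R))" unfolding XU by (rule card_UN_le[OF finA])
  also have "\<dots> \<le> (\<Sum>R\<in>A. card (fibre (rat C.w) (rat z) R))" using FK Apts by (intro sum_mono) auto
  also have "\<dots> = card N"
    unfolding NU by (rule card_UN_disjoint[symmetric]) (use finA C.fibre_w(1) Apts fibre_disjoint in auto)
  finally have le: "card Tp \<le> card N" .
  \<comment> \<open>the intersection lives on the projective line, which \<open>\<psi>\<close> identifies with the \<open>w\<close>-line\<close>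
  define \<psi> where "\<psi> = point_map (subst const line_coord C.w) projective_line"
  have \<psi>i: "\<psi> Q = \<psi> (Q \<inter> rat C.w)" for Q
    using subst_morphism(2)[OF C.w_const cfield_rat order_refl] by (auto simp: \<psi>_def point_map_def)
  have inj: "inj_on \<psi> (points (rat C.w))"
  proof (rule inj_onI)
    fix R R' assume R: "R \<in> points (rat C.w)" "R' \<in> points (rat C.w)" "\<psi> R = \<psi> R'"
    have "subst const line_coord C.w ` \<psi> Q = Q" if "Q \<in> points (rat C.w)" for Q
      using subst_morphism(2)[OF C.w_const cfield_rat order_refl] point_mem_K[OF that]
      by (auto simp: \<psi>_def point_map_def)
    then show "R = R'" using R by metis
  qed
  have im1: "\<psi> ` torsion_points P1.E' P1.Z = \<psi> ` {R \<in> points (rat C.w). torsion_over z P1.E (W \<inter> P1.E) (R \<inter> rat z)}"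
  proof -
    have "(\<lambda>Q. Q \<inter> rat C.w) ` torsion_points P1.E' P1.Z = {R \<in> points (rat C.w). torsion_over z P1.E (W \<inter> P1.E) (R \<inter> rat z)}"
      using P1.torsion_image[OF WE(1,2)] P1.E'_point_w by (force simp: torsion_points_def)
    then show ?thesis using \<psi>i by (metis (no_types, lifting) image_cong image_image)
  qed
  have im2: "\<psi> ` torsion_points P2.E' P2.Z = \<psi> ` {R \<in> points (rat C.w). torsion_over z P2.E (W \<inter> P2.E) (R \<inter> rat z)}"
  proof -
    have "(\<lambda>Q. Q \<inter> rat C.w) ` torsion_points P2.E' P2.Z = {R \<in> points (rat C.w). torsion_over z P2.E (W \<inter> P2.E) (R \<inter> rat z)}"
      using P2.torsion_image[OF WE(3,4)] P2.E'_point_w by (force simp: torsion_points_def)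
    then show ?thesis using \<psi>i by (metis (no_types, lifting) image_cong image_image)
  qed
  have "common_torsion (subst const line_coord C.w) P1.E' P1.Z (subst const line_coord C.w) P2.E' P2.Z =
      \<psi> ` {R \<in> points (rat C.w). torsion_over z P1.E (W \<inter> P1.E) (R \<inter> rat z)} \<inter>
      \<psi> ` {R \<in> points (rat C.w). torsion_over z P2.E (W \<inter> P2.E) (R \<inter> rat z)}"
    unfolding common_torsion_def using im1 im2 by (simp add: \<psi>_def)
  also have "\<dots> = \<psi> ` ({R \<in> points (rat C.w). torsion_over z P1.E (W \<inter> P1.E) (R \<inter> rat z)} \<inter>
      {R \<in> points (rat C.w). torsion_over z P2.E (W \<inter> P2.E) (R \<inter> rat z)})"
    by (rule inj_on_image_Int[OF inj, symmetric]) auto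
  also have "\<dots> = \<psi> ` N" unfolding N_def \<tau>_def by (rule arg_cong[of _ _ "(`) \<psi>"]) blast
  finally have I: "common_torsion (subst const line_coord C.w) P1.E' P1.Z (subst const line_coord C.w) P2.E' P2.Z = \<psi> ` N" .
  have "card (\<psi> ` N) = card N" using inj by (intro card_image inj_on_subset[OF inj]) (auto simp: N_def)
  then show thesis
    using that[OF P1.elliptic_double_cover_E' P2.elliptic_double_cover_E'] I finN le by simp
qed

theorem theorem1:
  fixes M_int M_packet :: nat
  assumes "maximal_size {I. \<exists>\<phi>1 E1 Z1 \<phi>2 E2 Z2.
      elliptic_double_cover \<phi>1 E1 Z1 \<and> elliptic_double_cover \<phi>2 E2 Z2 \<and>
      I = common_torsion \<phi>1 E1 Z1 \<phi>2 E2 Z2 \<and> finite I} M_int"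
    and "maximal_size {T. \<exists>C. bielliptic C \<and> hyperelliptic_torsion_packet C T} M_packet"
  shows "M_int \<ge> M_packet"
proof -
  obtain Tp K where Tp: "bielliptic K" "hyperelliptic_torsion_packet K Tp" "finite Tp" "card Tp = M_packet"
    using assms(2) unfolding maximal_size_def by blast
  obtain \<phi>1 E1 Z1 \<phi>2 E2 Z2 where I: "elliptic_double_cover \<phi>1 E1 Z1" "elliptic_double_cover \<phi>2 E2 Z2"
    "finite (common_torsion \<phi>1 E1 Z1 \<phi>2 E2 Z2)" "card Tp \<le> card (common_torsion \<phi>1 E1 Z1 \<phi>2 E2 Z2)"
    by (rule packet_le_intersection[OF Tp(1-3)])
  then have "card (common_torsion \<phi>1 E1 Z1 \<phi>2 E2 Z2) \<le> M_int"
    using assms(1) unfolding maximal_size_def by blast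
  then show ?thesis using I(4) Tp(4) by simp
qed

end
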